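(* Let $D_0,D\subseteq\mathbb R^2$ be open convex sets. The following are equivalent. (i) There is a nonzero $u\in C_c^\infty(D)$ such that $\mathcal R u(\omega,p)=0$ for all $(\omega,p)\in\mathbb S^1\times\mathbb R$ with $L(\omega,p)\cap D_0\neq\varnothing$. (ii) There is a nonzero $u\in L^1(\mathbb R^2)$ with $\operatorname{supp}u\Subset D$ such that $\mathcal R u(\omega,p)=0$ for almost every $(\omega,p)\in\mathbb S^1\times\mathbb R$ with $L(\omega,p)\cap D_0\neq\varnothing$. (iii) There is an ellipse $E$ such that $\overline{D_0}\subseteq E\Subset D$. Each of the conditions (i), (ii), (iii) forces $D_0\Subset D$. If (iii) holds with an ellipse $E$ with center $c$, then the function $u$ in (i) may be chosen real-valued, centrally symmetric about $c$, and strictly negative on an open neighborhood of $E$; in particular, $E\subseteq\operatorname{supp}u$.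
   Context: Functions are complex-valued unless stated otherwise. $\mathbb S^1=\{\omega\in\mathbb R^2:|\omega|=1\}$ carries arc-length measure $d\omega$, and $\mathbb S^1\times\mathbb R$ carries the product measure $d\omega\,dp$ ("almost every" refers to this measure). For $\omega=(\omega_1,\omega_2)$ put $\omega^\perp=(-\omega_2,\omega_1)$. For $\omega\in\mathbb S^1$, $p\in\mathbb R$, let $L(\omega,p)=\{x\in\mathbb R^2:x\cdot\omega=p\}$ and $\mathcal R u(\omega,p)=\int_{L(\omega,p)}u\,ds$, where $ds$ is Euclidean arc length. If $u\in L^1(\mathbb R^2)$, Fubini's theorem in the coordinates $x=p\omega+t\omega^\perp$ defines $\mathcal R u$ as an $L^1(\mathbb S^1\times\mathbb R)$-class. For $u\in L^1(\mathbb R^2)$, $\operatorname{supp}u$ is the complement of the largest open set on which $u=0$ almost everywhere (for continuous $u$ this is the usual closed support). Write $\Omega_0\Subset\Omega_1$ if $\overline{\Omega_0}$ is compact and contained in $\Omega_1$. $C_c^\infty(D)=\{u\in C^\infty(\mathbb R^2):\operatorname{supp}u\Subset D\}$. An ellipse is a closed, nondegenerate elliptic disk $E=c+Q^{1/2}\{x\in\mathbb R^2:|x|\le1\}$, where $c\in\mathbb R^2$ and $Q$ is a real (symmetric) positive definite $2\times2$ matrix; $c$ is called the center of $E$. A function $u$ on $\mathbb R^2$ is centrally symmetric about $c$ if $u(c+x)=u(c-x)$ for every $x\in\mathbb R^2$. *)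

theory Defs
  imports "HOL-Analysis.Analysis"
begin

definition relatively_compact_in :: "'a::topological_space set \<Rightarrow> 'a set \<Rightarrow> bool"  (infix "\<Subset>" 50)
  where "A \<Subset> B \<longleftrightarrow> compact (closure A) \<and> closure A \<subseteq> B"

(* The union is itself an open set on which u vanishes almost everywhere (Lindeloef), hence the
   largest one. *)
definition supp :: "((real^2) \<Rightarrow> complex) \<Rightarrow> (real^2) set"
  where "supp u = - \<Union>{U. open U \<and> (AE x in lebesgue. x \<in> U \<longrightarrow> u x = 0)}"

fun Ck :: "nat \<Rightarrow> ('a::real_normed_vector \<Rightarrow> 'b::real_normed_vector) \<Rightarrow> bool" where
  "Ck 0 f \<longleftrightarrow> continuous_on UNIV f"
| "Ck (Suc k) f \<longleftrightarrow>
     (\<forall>x. f differentiable (at x)) \<and> (\<forall>v. Ck k (\<lambda>x. frechet_derivative f (at x) v))"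

definition Cc_infinity :: "(real^2) set \<Rightarrow> ((real^2) \<Rightarrow> complex) set"
  where "Cc_infinity D = {u. (\<forall>k. Ck k u) \<and> supp u \<Subset> D}"

definition perp :: "real^2 \<Rightarrow> real^2"
  where "perp \<omega> = vector [- (\<omega> $ 2), \<omega> $ 1]"

definition line :: "real^2 \<Rightarrow> real \<Rightarrow> (real^2) set"
  where "line \<omega> p = {x. x \<bullet> \<omega> = p}"

(* For a unit vector \<omega>, t \<mapsto> p \<omega> + t (perp \<omega>) is an arc-length parametrization of line \<omega> p.  For
   integrable u the integrand is integrable for almost every (\<omega>, p); at the remaining pairs the
   integral has a junk value. *)
definition radon :: "((real^2) \<Rightarrow> complex) \<Rightarrow> real^2 \<Rightarrow> real \<Rightarrow> complex"
  where "radon u \<omega> p = (LINT t|lebesgue. u (p *\<^sub>R \<omega> + t *\<^sub>R perp \<omega>))"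

(* Arc length on the unit circle, as the image of Lebesgue measure under the angle
   parametrization. *)
definition arc_length :: "(real^2) measure"
  where "arc_length =
    distr (restrict_space lborel {0..<2*pi}) (restrict_space borel (sphere 0 1))
      (\<lambda>\<theta>. vector [cos \<theta>, sin \<theta>])"

definition positive_definite :: "real^'n^'n \<Rightarrow> bool"
  where "positive_definite Q \<longleftrightarrow> transpose Q = Q \<and> (\<forall>x. x \<noteq> 0 \<longrightarrow> x \<bullet> (Q *v x) > 0)"

(* A positive definite matrix has exactly one positive definite square root, so THE is well
   defined on such Q. *)
definition matrix_sqrt :: "real^'n^'n \<Rightarrow> real^'n^'n"
  where "matrix_sqrt Q = (THE S. positive_definite S \<and> S ** S = Q)"

definition is_ellipse :: "real^2 \<Rightarrow> (real^2) set \<Rightarrow> bool"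
  where "is_ellipse c E \<longleftrightarrow>
    (\<exists>Q. positive_definite Q \<and> E = (\<lambda>x. c + matrix_sqrt Q *v x) ` cball 0 1)"

definition centrally_symmetric :: "real^2 \<Rightarrow> ((real^2) \<Rightarrow> complex) \<Rightarrow> bool"
  where "centrally_symmetric c u \<longleftrightarrow> (\<forall>x. u (c + x) = u (c - x))"

definition smooth_interior_solution ::
    "(real^2) set \<Rightarrow> (real^2) set \<Rightarrow> ((real^2) \<Rightarrow> complex) \<Rightarrow> bool"
  where "smooth_interior_solution D\<^sub>0 D u \<longleftrightarrow>
    u \<in> Cc_infinity D \<and> (\<exists>x. u x \<noteq> 0) \<and>
    (\<forall>\<omega>\<in>sphere 0 1. \<forall>p. line \<omega> p \<inter> D\<^sub>0 \<noteq> {} \<longrightarrow> radon u \<omega> p = 0)"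

definition L1_interior_solution ::
    "(real^2) set \<Rightarrow> (real^2) set \<Rightarrow> ((real^2) \<Rightarrow> complex) \<Rightarrow> bool"
  where "L1_interior_solution D\<^sub>0 D u \<longleftrightarrow>
    integrable lebesgue u \<and> supp u \<Subset> D \<and> \<not> (AE x in lebesgue. u x = 0) \<and>
    (AE (\<omega>, p) in arc_length \<Otimes>\<^sub>M lborel. line \<omega> p \<inter> D\<^sub>0 \<noteq> {} \<longrightarrow> radon u \<omega> p = 0)"

definition separating_ellipse ::
    "(real^2) set \<Rightarrow> (real^2) set \<Rightarrow> real^2 \<Rightarrow> (real^2) set \<Rightarrow> bool"
  where "separating_ellipse D\<^sub>0 D c E \<longleftrightarrow> is_ellipse c E \<and> closure D\<^sub>0 \<subseteq> E \<and> E \<Subset> D"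

end

(* From (ii) to (iii). In the plane with coordinates z = x1 + i tau x2, a line {x. x . om = p} with |om| = 1
   is described by w = om^2 and f = om p. Integrating u against functions of the line defines a bounded
   functional T on the uniform closure P of the polynomials in w and f on the set of lines that meet
   the convex hull of supp u but miss D0: the lines meeting D0 contribute nothing. Moreover T vanishes on w P
   and T(f^k) is a multiple of the k-th moment of z against u. If f - b were invertible modulo w in P
   for every complex b, then Liouville's theorem would give T = 0; if this held for all tau, all moments
   of u would vanish. So for some tau and b the function f - b is not invertible modulo w. After a
   translation b = 0. Homotopies through nonvanishing elements of P, most notably through a pencil
   of conics, show that then D0 lies in the hull and that, where a chord of the polar of the hull crosses
   a chord of the dual set of D0, the product of the segments is at most as large for the former as for
   the latter. By linear programming, the lifts of the two
   dual sets to the paraboloid are then separated by a plane, that is, the sets are separated by a disc,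
   whose polar is the ellipse.

   From (iii) to (i). For the quadratic form q of the ellipse and a bump g = - G' supported in
   (1, infinity), let u(x) = int g(q(x) + s^2) ds. The integral of u over a line on which q has
   minimum m < 1 is the integral over a plane of g(m + r^2) with r^2 quadratic, and this is a
   divergence of a compactly supported field because G vanishes near m. *)

theory Submission
  imports Defs "HOL-Complex_Analysis.Complex_Analysis"
begin

(* clashes with the notation for vector components *)
no_notation fps_nth (infixl "$" 75)

section \<open>Uniform algebras\<close>

text \<open>On the lines through a point z one has f = (cnj z w + z) / 2. Formally, w = 0 is
  therefore an isotropic line, and f = b singles out the one through the real point 2 b. If f - b is
  not invertible modulo w, evaluation at this nonreal line survives on the algebra, and 2 b becomes
  a focus of the ellipse: foci are the points whose isotropic lines touch the conic. The obstacle is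
  that a function in P without zeros need not be a unit of P. Already w has modulus 1 everywhere,
  yet an inverse of w in P would make every f - b invertible modulo w. Units are reached only along
  paths from evident ones, and each path has to end in the ideal of f and w, that is, at a
  polynomial without constant term. Every position of the two sets other than the desired one
  provides such a path. Varying tau is needed because one tau yields only the moments of z^k, which
  do not determine u; as polynomials in tau they do.\<close>

locale uniform_algebra =
  fixes X :: "'z set" and P :: "('z \<Rightarrow> complex) set"
  assumes const: "(\<lambda>_. c) \<in> P"
    and add: "\<lbrakk>g \<in> P; h \<in> P\<rbrakk> \<Longrightarrow> (\<lambda>z. g z + h z) \<in> P"
    and mult: "\<lbrakk>g \<in> P; h \<in> P\<rbrakk> \<Longrightarrow> (\<lambda>z. g z * h z) \<in> P"
    and limit: "(\<And>e. e > 0 \<Longrightarrow> \<exists>q\<in>P. \<forall>z\<in>X. norm (h z - q z) \<le> e) \<Longrightarrow> h \<in> P"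
    and bounded: "h \<in> P \<Longrightarrow> \<exists>B. \<forall>z\<in>X. norm (h z) \<le> B"
begin

text \<open>Members of \<open>P\<close> are total functions, yet only their values on
  \<open>X\<close> count: \<open>limit\<close> with error zero absorbs any change outside
  \<open>X\<close>. Hence quotients such as \<open>1 / g z\<close> can be handled as total
  functions.\<close>

lemma cong: "\<lbrakk>g \<in> P; \<And>z. z \<in> X \<Longrightarrow> h z = g z\<rbrakk> \<Longrightarrow> h \<in> P"
  by (rule limit) (auto intro!: bexI[of _ g])

lemma cmult: "g \<in> P \<Longrightarrow> (\<lambda>z. c * g z) \<in> P"
  by (intro mult const)

lemma minus: "g \<in> P \<Longrightarrow> (\<lambda>z. - g z) \<in> P"
  using cmult[of g "-1"] by simp

lemma diff: "\<lbrakk>g \<in> P; h \<in> P\<rbrakk> \<Longrightarrow> (\<lambda>z. g z - h z) \<in> P"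
  using add[of g "\<lambda>z. - h z"] minus[of h] by simp

lemma power: "g \<in> P \<Longrightarrow> (\<lambda>z. g z ^ n) \<in> P"
  by (induction n) (auto intro: const mult)

lemma sum: "\<lbrakk>finite I; \<And>i. i \<in> I \<Longrightarrow> g i \<in> P\<rbrakk> \<Longrightarrow> (\<lambda>z. \<Sum>i\<in>I. g i z) \<in> P"
  by (induction I rule: finite_induct) (auto intro: const add)

lemmas algebra_intros = const add mult cmult minus diff power

lemma neumann:
  assumes g: "g \<in> P" and r: "r < 1" "\<And>z. z \<in> X \<Longrightarrow> norm (g z) \<le> r"
  shows "(\<lambda>z. 1 / (1 - g z)) \<in> P"
\<comment> \<open>For empty \<open>X\<close> the bound \<open>r\<close> may be negative, and the
  geometric estimate needs it nonnegative.\<close>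
proof (cases "X = {}")
  case True then show ?thesis by (intro cong[OF g]) auto
next
  case False
  then have r0: "r \<ge> 0" using r(2) norm_ge_zero order_trans by blast
  show ?thesis
  proof (rule limit)
    fix e :: real assume "e > 0"
    have "(\<lambda>n. r ^ n / (1 - r)) \<longlonglongrightarrow> 0 / (1 - r)"
      using r0 r(1) by (intro tendsto_divide LIMSEQ_realpow_zero) auto
    then have "eventually (\<lambda>n. r ^ n / (1 - r) < e) sequentially"
      using \<open>e > 0\<close> by (simp add: order_tendsto_iff)
    then obtain n where n: "r ^ n / (1 - r) < e" by (auto simp: eventually_sequentially)
    show "\<exists>q\<in>P. \<forall>z\<in>X. norm (1 / (1 - g z) - q z) \<le> e"
    proof (intro bexI ballI)
      fix z assume z: "z \<in> X"
      have ne: "g z \<noteq> 1" using r(2)[OF z] r(1) by auto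
      have "(\<Sum>i<n. g z ^ i) = (1 - g z ^ n) / (1 - g z)"
        using ne by (simp add: sum_gp_strict)
      then have "norm (1 / (1 - g z) - (\<Sum>i<n. g z ^ i)) = norm (g z) ^ n / norm (1 - g z)"
        using ne by (simp add: diff_divide_distrib[symmetric] norm_divide norm_power)
      also have "\<dots> \<le> r ^ n / (1 - r)"
      proof (rule frac_le)
        have "norm (1::complex) \<le> norm (1 - g z) + norm (g z)"
          using norm_triangle_ineq[of "1 - g z" "g z"] by simp
        then show "1 - r \<le> norm (1 - g z)" using r(2)[OF z] by simp
      qed (use r r0 z in \<open>auto intro: power_mono\<close>)
      finally show "norm (1 / (1 - g z) - (\<Sum>i<n. g z ^ i)) \<le> e" using n by simp
    qed (auto intro!: sum power g)
  qed
qed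

text \<open>Quantitative openness of the units: \<open>A / B = 1 - (B - A) / B\<close> differs from
  1 by at most 1/2. The admissible distance depends only on the lower bound \<open>d\<close>, so
  steps of fixed length can be iterated along a path.\<close>

lemma inverse_near:
  assumes A: "A \<in> P" and B: "(\<lambda>z. 1 / B z) \<in> P" and d: "d > 0"
    and Bd: "\<And>z. z \<in> X \<Longrightarrow> norm (B z) \<ge> d"
    and AB: "\<And>z. z \<in> X \<Longrightarrow> norm (A z - B z) \<le> d / 2" and BP: "B \<in> P"
  shows "(\<lambda>z. 1 / A z) \<in> P"
proof -
  have "(\<lambda>z. 1 / (1 - (B z - A z) * (1 / B z))) \<in> P"
  proof (rule neumann)
    show "(\<lambda>z. (B z - A z) * (1 / B z)) \<in> P" by (intro mult diff A B BP)
    fix z assume z: "z \<in> X"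
    have "norm ((B z - A z) * (1 / B z)) = norm (A z - B z) / norm (B z)"
      by (simp add: norm_mult norm_divide norm_minus_commute)
    also have "\<dots> \<le> (d/2) / d"
      using AB[OF z] Bd[OF z] d by (intro frac_le) auto
    finally have "norm ((B z - A z) * (1 / B z)) \<le> (d/2) / d" .
    then show "norm ((B z - A z) * (1 / B z)) \<le> 1/2" using d by simp
  qed simp
  then have "(\<lambda>z. (1 / B z) * (1 / (1 - (B z - A z) * (1 / B z)))) \<in> P" by (rule mult[OF B])
  then show ?thesis
  proof (rule cong)
    fix z assume z: "z \<in> X"
    have "B z \<noteq> 0" using Bd[OF z] d by auto
    then have "1 - (B z - A z) * (1 / B z) = A z / B z" by (simp add: field_simps)
    then show "1 / A z = (1 / B z) * (1 / (1 - (B z - A z) * (1 / B z)))" using \<open>B z \<noteq> 0\<close> by simp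
  qed
qed

text \<open>A nonvanishing member of \<open>P\<close> need not be a unit, but being a unit persists
  along a path of nonvanishing members. Compactness of \<open>Y\<close> gives one lower bound
  \<open>d\<close> and one step length for the whole path; \<open>X\<close> carries no topology, so
  the path lives on \<open>Y\<close> and is pulled back by \<open>y\<close>.\<close>

lemma inverse_homotopy:
  fixes a :: "real \<Rightarrow> 'y::metric_space \<Rightarrow> complex"
  assumes Y: "compact Y" "\<And>z. z \<in> X \<Longrightarrow> y z \<in> Y"
    and cont: "continuous_on ({0..1} \<times> Y) (\<lambda>(t, v). a t v)"
    and nz: "\<And>t v. \<lbrakk>t \<in> {0..1}; v \<in> Y\<rbrakk> \<Longrightarrow> a t v \<noteq> 0"
    and aP: "\<And>t. t \<in> {0..1} \<Longrightarrow> (\<lambda>z. a t (y z)) \<in> P"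
    and start: "(\<lambda>z. 1 / a 0 (y z)) \<in> P"
  shows "(\<lambda>z. 1 / a 1 (y z)) \<in> P"
proof (cases "Y = {}")
  case True then show ?thesis using Y(2) by (intro cong[OF start]) auto
next
  case False
  let ?K = "{0..1::real} \<times> Y"
  have K: "compact ?K" by (intro compact_Times Y) auto
  have "continuous_on ?K (\<lambda>q. norm ((\<lambda>(t, v). a t v) q))" by (intro continuous_on_norm cont)
  then obtain q0 where q0: "q0 \<in> ?K" "\<And>q. q \<in> ?K \<Longrightarrow> norm (case q0 of (t, v) \<Rightarrow> a t v) \<le> norm (case q of (t,v) \<Rightarrow> a t v)"
    using continuous_attains_inf[OF K] False by (metis (no_types, lifting) SigmaI atLeastAtMost_iff equals0D ex_in_conv order_refl zero_le_one)
  define d where "d = norm (case q0 of (t, v) \<Rightarrow> a t v)"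
  have d: "d > 0" using nz q0(1) by (auto simp: d_def split: prod.splits)
  have db: "norm (a t v) \<ge> d" if "t \<in> {0..1}" "v \<in> Y" for t v
    using q0(2)[of "(t,v)"] that by (simp add: d_def)
  have "uniformly_continuous_on ?K (\<lambda>(t, v). a t v)"
    by (rule compact_uniformly_continuous[OF cont K])
  then obtain e where e: "e > 0"
    "\<And>q q'. \<lbrakk>q \<in> ?K; q' \<in> ?K; dist q' q < e\<rbrakk> \<Longrightarrow> dist (case q' of (t,v) \<Rightarrow> a t v) (case q of (t,v) \<Rightarrow> a t v) < d/2"
    using d unfolding uniformly_continuous_on_def by (metis half_gt_zero)
  obtain N :: nat where N: "1 / e < real N" using reals_Archimedean2 by blast
  then have N0: "N > 0" using e(1) by (metis gr0I not_less of_nat_0 zero_le_divide_1_iff less_imp_le)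
  have step: "(\<lambda>z. 1 / a (real k / real N) (y z)) \<in> P" if "k \<le> N" for k
    using that
  proof (induction k)
    case 0 then show ?case using start by simp
  next
    case (Suc k)
    let ?t = "real k / real N" and ?s = "real (Suc k) / real N"
    have t: "?t \<in> {0..1}" "?s \<in> {0..1}" using Suc N0 by auto
    show ?case
    proof (rule inverse_near[OF aP[OF t(2)] _ d])
      show "(\<lambda>z. 1 / a ?t (y z)) \<in> P" using Suc by simp
      show "(\<lambda>z. a ?t (y z)) \<in> P" by (rule aP[OF t(1)])
      fix z assume z: "z \<in> X"
      show "d \<le> norm (a ?t (y z))" using db t Y(2) z by auto
      have "dist (?s, y z) (?t, y z) = 1 / real N"
        using N0 by (simp add: dist_prod_def dist_real_def diff_divide_distrib[symmetric])
      also have "\<dots> < e" using N e(1) N0 by (simp add: field_simps)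
      finally show "norm (a ?s (y z) - a ?t (y z)) \<le> d / 2"
        using e(2)[of "(?t, y z)" "(?s, y z)"] t Y(2)[OF z] by (simp add: dist_norm less_imp_le)
    qed
  qed
  from step[of N] show ?thesis using N0 by simp
qed

text \<open>A Gelfand--Mazur argument: by Liouville's theorem, the resolvent of \<open>f\<close> modulo \<open>w\<close> cannot be
  defined everywhere unless the functional vanishes.\<close>

lemma functional_eq_0:
  fixes T :: "('z \<Rightarrow> complex) \<Rightarrow> complex"
  assumes fP: "f \<in> P" and wP: "w \<in> P"
    and Tadd: "\<And>g h. \<lbrakk>g \<in> P; h \<in> P\<rbrakk> \<Longrightarrow> T (\<lambda>z. g z + h z) = T g + T h"
    and Tcm: "\<And>c g. g \<in> P \<Longrightarrow> T (\<lambda>z. c * g z) = c * T g"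
    and Tb: "\<And>g B. \<lbrakk>g \<in> P; B \<ge> 0; \<And>z. z \<in> X \<Longrightarrow> norm (g z) \<le> B\<rbrakk> \<Longrightarrow> norm (T g) \<le> C * B"
    and Tw: "\<And>g. g \<in> P \<Longrightarrow> T (\<lambda>z. w z * g z) = 0"
    and reg: "\<And>b. \<exists>G\<in>P. \<exists>H\<in>P. \<forall>z\<in>X. (f z - b) * G z + w z * H z = 1"
    and h: "h \<in> P"
  shows "T h = 0"
proof -
  note PI = algebra_intros
  have Tcong: "T g = T h" if "g \<in> P" "h \<in> P" "\<And>z. z \<in> X \<Longrightarrow> g z = h z" for g h
  proof -
    have 1: "(\<lambda>z. (-1) * h z) \<in> P" using that by (intro PI)
    have 2: "(\<lambda>z. g z + (-1) * h z) \<in> P" using that by (intro PI)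
    have "norm (T (\<lambda>z. g z + (-1) * h z)) \<le> C * 0" using that by (intro Tb 2) auto
    then show ?thesis using Tadd[OF that(1) 1] Tcm[OF that(2), of "-1"] by simp
  qed
  obtain G H where GH: "\<And>b. G b \<in> P" "\<And>b. H b \<in> P"
    "\<And>b z. z \<in> X \<Longrightarrow> (f z - b) * G b z + w z * H b z = 1"
    using reg by metis
  \<comment> \<open>Two inverses of \<open>f - b\<close> modulo \<open>w\<close> differ by a
    multiple of \<open>w\<close>, which \<open>T\<close> kills even after multiplication by
    \<open>h\<close>. So the arbitrary choice of \<open>G b\<close> does not matter, and a
    convenient inverse may be substituted.\<close>
  have uniq: "T (\<lambda>z. h z * G' z) = T (\<lambda>z. h z * G b z)"
    if hP: "h \<in> P" and G': "G' \<in> P" "H' \<in> P" "\<And>z. z \<in> X \<Longrightarrow> (f z - b) * G' z + w z * H' z = 1" for b h G' H'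
  proof -
    have "T (\<lambda>z. h z * G' z) = T (\<lambda>z. h z * G b z + w z * (h z * (G' z * H b z - G b z * H' z)))"
    proof (rule Tcong)
      fix z assume z: "z \<in> X"
      note a = G'(3)[OF z] and b = GH(3)[OF z, of b]
      have "G' z - G b z = G' z * ((f z - b) * G b z + w z * H b z) - G b z * ((f z - b) * G' z + w z * H' z)"
        using a b by simp
      also have "\<dots> = w z * (G' z * H b z - G b z * H' z)" by algebra
      finally have "G' z = G b z + w z * (G' z * H b z - G b z * H' z)" by (simp add: algebra_simps)
      then have "h z * G' z = h z * (G b z + w z * (G' z * H b z - G b z * H' z))" by simp
      then show "h z * G' z = h z * G b z + w z * (h z * (G' z * H b z - G b z * H' z))"
        by (simp add: algebra_simps)
    qed (intro PI hP G' GH wP)+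
    also have "\<dots> = T (\<lambda>z. h z * G b z)"
      using Tadd[of "\<lambda>z. h z * G b z" "\<lambda>z. w z * (h z * (G' z * H b z - G b z * H' z))"]
        Tw[of "\<lambda>z. h z * (G' z * H b z - G b z * H' z)"] hP G' GH wP by (simp add: PI)
    finally show ?thesis .
  qed
  have zero: "T (\<lambda>z. h z * G b z) = 0" if hP: "h \<in> P" for b h
  proof -
    define \<rho> where "\<rho> b = T (\<lambda>z. h z * G b z)" for b
    have deriv: "\<exists>D. (\<rho> has_field_derivative D) (at b0)" for b0
    proof -
      let ?G = "G b0"
      obtain K where K: "\<forall>z\<in>X. norm (?G z) \<le> K" using bounded GH(1) by blast
      define K1 where "K1 = max K 1"
      have K1: "\<And>z. z \<in> X \<Longrightarrow> norm (?G z) \<le> K1" "K1 \<ge> 1" using K by (force simp: K1_def)+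
      obtain M where M: "\<forall>z\<in>X. norm (h z) \<le> M" using bounded hP by blast
      define M1 where "M1 = max M 1"
      have M1: "\<And>z. z \<in> X \<Longrightarrow> norm (h z) \<le> M1" "M1 \<ge> 1" using M by (force simp: M1_def)+
      \<comment> \<open>The derivative to be expected of \<open>1 / (f - b)\<close> in
        \<open>b\<close> is its square.\<close>
      define D where "D = T (\<lambda>z. h z * (?G z * ?G z))"
      define L where "L = C * (M1 * (K1 ^ 3 * 2))"
      have est: "norm (\<rho> b - \<rho> b0 - (b - b0) * D) \<le> norm (b - b0) ^ 2 * L"
        if b: "norm (b - b0) \<le> 1 / (2 * K1)" for b
      proof -
        let ?g = "\<lambda>z. (b - b0) * ?G z"
        let ?N = "\<lambda>z. 1 / (1 - ?g z)"
        have small: "norm (?g z) \<le> 1/2" if "z \<in> X" for z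
        proof -
          have "norm (?g z) \<le> (1 / (2 * K1)) * K1"
            unfolding norm_mult using b K1 that by (intro mult_mono) auto
          then show ?thesis using K1(2) by simp
        qed
        have NP: "?N \<in> P" by (rule neumann[OF _ _ small]) (auto intro: PI GH)
        have ne: "1 - ?g z \<noteq> 0" if "z \<in> X" for z using small[OF that] by auto
        have Nb: "norm (?N z) \<le> 2" if "z \<in> X" for z
        proof -
          have "1 \<le> norm (1 - ?g z) + norm (?g z)" using norm_triangle_ineq[of "1 - ?g z" "?g z"] by simp
          then have n: "norm (1 - ?g z) \<ge> 1/2" using small[OF that] by linarith
          have "norm (?N z) = 1 / norm (1 - ?g z)" by (simp add: norm_divide)
          also have "\<dots> \<le> 1 / (1/2)" using n by (intro divide_left_mono) auto
          finally show ?thesis by simp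
        qed
        \<comment> \<open>From \<open>(f - b) G + w H = 1 - (b - b0) G\<close> a Neumann series
          turns the inverse at \<open>b0\<close> into one at \<open>b\<close>. By
          \<open>uniq\<close> it may replace the chosen \<open>G b\<close>, and its dependence on
          \<open>b\<close> is explicit.\<close>
        have 1: "\<rho> b = T (\<lambda>z. h z * (?G z * ?N z))"
          unfolding \<rho>_def
        proof (rule uniq[symmetric, OF hP, where H' = "\<lambda>z. H b0 z * ?N z"])
          fix z assume z: "z \<in> X"
          have "(f z - b) * ?G z + w z * H b0 z = 1 - ?g z" using GH(3)[OF z, of b0] by algebra
          then have "((f z - b) * ?G z + w z * H b0 z) * ?N z = 1" using ne[OF z] by simp
          then show "(f z - b) * (?G z * ?N z) + w z * (H b0 z * ?N z) = 1" by (simp only: algebra_simps)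
        qed (intro PI GH NP)+
        also have "\<dots> = T (\<lambda>z. h z * ?G z + ((b - b0) * (h z * (?G z * ?G z)) + (b - b0)^2 * (h z * (?G z ^ 3 * ?N z))))"
        proof (rule Tcong)
          fix z assume z: "z \<in> X"
          have "?N z = 1 + ?g z + ?g z ^ 2 * ?N z" using ne[OF z] by (simp add: field_simps power2_eq_square)
          then have "h z * (?G z * ?N z) = h z * (?G z * (1 + ?g z + ?g z ^ 2 * ?N z))"
            by (rule arg_cong[where f = "\<lambda>N. h z * (?G z * N)"])
          also have "\<dots> = h z * ?G z + ((b - b0) * (h z * (?G z * ?G z)) + (b - b0)^2 * (h z * (?G z ^ 3 * ?N z)))"
            by algebra
          finally show "h z * (?G z * ?N z) = h z * ?G z + ((b - b0) * (h z * (?G z * ?G z)) + (b - b0)^2 * (h z * (?G z ^ 3 * ?N z)))" .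
        qed (intro PI hP NP GH)+
        also have "\<dots> = \<rho> b0 + ((b - b0) * D + (b - b0)^2 * T (\<lambda>z. h z * (?G z ^ 3 * ?N z)))"
        proof -
          have a: "(\<lambda>z. h z * ?G z) \<in> P" "(\<lambda>z. h z * (?G z * ?G z)) \<in> P" "(\<lambda>z. h z * (?G z ^ 3 * ?N z)) \<in> P"
            by (intro PI hP NP GH)+
          show ?thesis unfolding \<rho>_def D_def
            by (simp only: Tadd[OF a(1) add[OF cmult[OF a(2)] cmult[OF a(3)]]] Tadd[OF cmult[OF a(2)] cmult[OF a(3)]]
                Tcm[OF a(2)] Tcm[OF a(3)])
        qed
        finally have "\<rho> b - \<rho> b0 - (b - b0) * D = (b - b0)^2 * T (\<lambda>z. h z * (?G z ^ 3 * ?N z))" by simp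
        moreover have "norm (T (\<lambda>z. h z * (?G z ^ 3 * ?N z))) \<le> L" unfolding L_def
        proof (rule Tb)
          show "(\<lambda>z. h z * (?G z ^ 3 * ?N z)) \<in> P" by (intro PI hP NP GH)
          fix z assume z: "z \<in> X"
          show "norm (h z * (?G z ^ 3 * ?N z)) \<le> M1 * (K1 ^ 3 * 2)"
            unfolding norm_mult norm_power using K1 M1 Nb z by (intro mult_mono power_mono) auto
        qed (use K1 M1 in auto)
        ultimately show ?thesis by (simp add: norm_mult norm_power mult_left_mono)
      qed
      have "((\<lambda>b. (\<rho> b - \<rho> b0) / (b - b0) - D) \<longlongrightarrow> 0) (at b0)"
      proof (rule Lim_null_comparison)
        show "((\<lambda>b. norm (b - b0) * L) \<longlongrightarrow> 0) (at b0)" by (auto intro!: tendsto_eq_intros)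
        have "eventually (\<lambda>b. b \<in> ball b0 (1 / (2 * K1)) \<and> b \<noteq> b0) (at b0)"
          using K1(2) by (intro eventually_conj eventually_at_in_open' eventually_neq_at_within) auto
        then show "eventually (\<lambda>b. norm ((\<rho> b - \<rho> b0) / (b - b0) - D) \<le> norm (b - b0) * L) (at b0)"
        proof eventually_elim
          case (elim b)
          then have b: "norm (b - b0) \<le> 1 / (2 * K1)" "b - b0 \<noteq> 0" by (auto simp: dist_norm norm_minus_commute)
          have "norm ((\<rho> b - \<rho> b0) / (b - b0) - D) = norm (\<rho> b - \<rho> b0 - (b - b0) * D) / norm (b - b0)"
            using b(2) by (simp add: norm_divide[symmetric] diff_divide_distrib)
          also have "\<dots> \<le> norm (b - b0) ^ 2 * L / norm (b - b0)" by (intro divide_right_mono est b) auto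
          finally show ?case using b(2) by (simp add: power2_eq_square)
        qed
      qed
      then have "(\<rho> has_field_derivative D) (at b0)"
        unfolding has_field_derivative_iff by (simp add: LIM_zero_iff)
      then show ?thesis by blast
    qed
    then have hol: "\<rho> holomorphic_on UNIV"
      by (auto simp: holomorphic_on_def field_differentiable_def)
    obtain R where R: "\<forall>z\<in>X. norm (f z) \<le> R" using bounded fP by blast
    define R1 where "R1 = max R 1"
    have R1: "\<And>z. z \<in> X \<Longrightarrow> norm (f z) \<le> R1" "R1 \<ge> 1" using R by (force simp: R1_def)+
    obtain M where M: "\<forall>z\<in>X. norm (h z) \<le> M" using bounded hP by blast
    define M1 where "M1 = max M 1"
    have M1: "\<And>z. z \<in> X \<Longrightarrow> norm (h z) \<le> M1" "M1 \<ge> 1" using M by (force simp: M1_def)+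
    \<comment> \<open>Far out \<open>f - b\<close> has a genuine inverse, with \<open>H = 0\<close>
      and size of order \<open>1 / |b|\<close>. By \<open>uniq\<close> it gives the same value, so
      the entire function \<rho> tends to 0 at infinity.\<close>
    have far: "norm (\<rho> b) \<le> C * (M1 * 2) * norm (inverse b)" if b: "norm b \<ge> 2 * R1" for b
    proof -
      have b0: "b \<noteq> 0" using b R1(2) by auto
      let ?g = "\<lambda>z. (1/b) * f z" and ?N = "\<lambda>z. 1 / (1 - (1/b) * f z)"
      have small: "norm (?g z) \<le> 1/2" if "z \<in> X" for z
        using R1(1)[OF that] b b0 by (simp add: norm_mult norm_divide field_simps)
      have NP: "?N \<in> P" by (rule neumann[OF cmult[OF fP] _ small]) auto
      have ne: "1 - ?g z \<noteq> 0" if "z \<in> X" for z using small[OF that] by auto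
      have Nb: "norm (?N z) \<le> 2" if "z \<in> X" for z
      proof -
        have "1 \<le> norm (1 - ?g z) + norm (?g z)" using norm_triangle_ineq[of "1 - ?g z" "?g z"] by simp
        then have n: "norm (1 - ?g z) \<ge> 1/2" using small[OF that] by linarith
        have "norm (?N z) = 1 / norm (1 - ?g z)" by (simp add: norm_divide)
        also have "\<dots> \<le> 1 / (1/2)" using n by (intro divide_left_mono) auto
        finally show ?thesis by simp
      qed
      have "\<rho> b = T (\<lambda>z. h z * ((-1/b) * ?N z))" unfolding \<rho>_def
      proof (rule uniq[symmetric, OF hP, where H' = "\<lambda>z. 0"])
        fix z assume z: "z \<in> X"
        have "1 - ?g z = (b - f z) / b" using b0 by (simp add: field_simps)
        moreover have "b - f z \<noteq> 0" using ne[OF z] calculation b0 by auto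
        ultimately show "(f z - b) * ((-1/b) * ?N z) + w z * 0 = 1" using b0 by (simp add: field_simps)
      qed (intro PI NP)+
      also have "norm \<dots> \<le> C * (M1 * (norm (inverse b) * 2))"
      proof (rule Tb)
        show "(\<lambda>z. h z * ((-1/b) * ?N z)) \<in> P" by (intro PI hP NP)
        fix z assume z: "z \<in> X"
        show "norm (h z * ((-1/b) * ?N z)) \<le> M1 * (norm (inverse b) * 2)"
          unfolding norm_mult using M1 Nb z by (intro mult_mono) (auto simp: norm_divide norm_inverse field_simps)
      qed (use M1 in auto)
      finally show ?thesis by (simp add: algebra_simps)
    qed
    have "(\<rho> \<longlongrightarrow> 0) at_infinity"
    proof (rule Lim_null_comparison)
      have "((\<lambda>b. inverse b) \<longlongrightarrow> (0::complex)) at_infinity" by (rule tendsto_inverse_0)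
      then have "((\<lambda>b::complex. norm (inverse b)) \<longlongrightarrow> 0) at_infinity" by (rule tendsto_norm_zero)
      then show "((\<lambda>b. C * (M1 * 2) * norm (inverse b)) \<longlongrightarrow> 0) (at_infinity :: complex filter)"
        by (intro tendsto_mult_right_zero)
      show "eventually (\<lambda>b. norm (\<rho> b) \<le> C * (M1 * 2) * norm (inverse b)) at_infinity"
        unfolding eventually_at_infinity using far by blast
    qed
    then show ?thesis using Liouville_weak[OF hol, of 0 b] by (simp add: \<rho>_def)
  qed
  \<comment> \<open>Inserting \<open>1 = f G + w H\<close> at \<open>b = 0\<close> writes
    \<open>h\<close> as \<open>(f h) G\<close> plus a multiple of \<open>w\<close>; the first part
    is covered by \<open>zero\<close> with \<open>f h\<close> in the role of
    \<open>h\<close>.\<close>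
  have "T h = T (\<lambda>z. ((f z - 0) * h z) * G 0 z + w z * (h z * H 0 z))"
  proof (rule Tcong[OF h])
    fix z assume z: "z \<in> X"
    have "h z = h z * ((f z - 0) * G 0 z + w z * H 0 z)" using GH(3)[OF z, of 0] by simp
    then show "h z = ((f z - 0) * h z) * G 0 z + w z * (h z * H 0 z)" by (simp add: algebra_simps)
  qed (intro PI fP wP h GH)
  also have "\<dots> = T (\<lambda>z. ((f z - 0) * h z) * G 0 z) + T (\<lambda>z. w z * (h z * H 0 z))"
    by (intro Tadd PI fP wP h GH)
  also have "\<dots> = 0"
  proof -
    have "T (\<lambda>z. ((f z - 0) * h z) * G 0 z) = 0" by (intro zero PI fP h)
    moreover have "T (\<lambda>z. w z * (h z * H 0 z)) = 0" by (intro Tw PI h GH)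
    ultimately show ?thesis by simp
  qed
  finally show ?thesis .
qed

end

section \<open>Functions on the lines missing a convex set\<close>

text \<open>The pairs \<open>(om, p)\<close> and \<open>(- om, - p)\<close> describe the same line.
  Both give the same \<open>om^2\<close> and \<open>om p\<close>, but not the same \<open>om\<close>
  and \<open>p\<close>; hence only the former are required to lie in \<open>P\<close>.\<close>

locale line_algebra = uniform_algebra X P for X :: "'z set" and P +
  fixes om :: "'z \<Rightarrow> complex" and p :: "'z \<Rightarrow> real" and D0 D1 :: "complex set"
  assumes om1: "norm (om z) = 1"
    and wP: "(\<lambda>z. om z ^ 2) \<in> P" and fP: "(\<lambda>z. om z * of_real (p z)) \<in> P"
    and D0: "open D0" "convex D0" "D0 \<noteq> {}" and D1: "compact D1" "convex D1" "D1 \<noteq> {}"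
    and miss: "\<And>z x. \<lbrakk>z \<in> X; x \<in> D0\<rbrakk> \<Longrightarrow> x \<bullet> om z \<noteq> p z"
    and meet: "\<And>z. z \<in> X \<Longrightarrow> \<exists>x\<in>D1. x \<bullet> om z = p z"
begin

abbreviation "f \<equiv> \<lambda>z. om z * of_real (p z)"
abbreviation "w \<equiv> \<lambda>z. om z ^ 2"

text \<open>The ideal generated by \<open>f\<close> and \<open>w\<close> is all of \<open>P\<close>:
  invertibility of \<open>f\<close> modulo \<open>w\<close>, the point under test having been moved
  to the origin.\<close>

definition regular :: bool where
  "regular \<longleftrightarrow> (\<exists>G\<in>P. \<exists>H\<in>P. \<forall>z\<in>X. f z * G z + w z * H z = 1)"

text \<open>All lines that miss \<open>D0\<close> and meet \<open>D1\<close>, not only those coming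
  from \<open>X\<close>: this set is compact by geometry alone, and nonvanishing on it can be
  checked line by line.\<close>

definition Y :: "(complex \<times> real) set" where
  "Y = {(v, s). norm v = 1 \<and> (\<forall>x\<in>D0. x \<bullet> v \<noteq> s) \<and> (\<exists>x\<in>D1. x \<bullet> v = s)}"

lemma compact_Y: "compact Y"
proof -
  \<comment> \<open>For \<open>|v| = 1\<close> the point required to lie in \<open>D0\<close> is the
    foot of the perpendicular from \<open>x0\<close> to the line. A line meets \<open>D0\<close> iff
    some point of \<open>D0\<close> has its foot in \<open>D0\<close>, and in this form the
    condition is open in \<open>(v, s)\<close>.\<close>
  define U where "U = (\<Union>x0\<in>D0. {(v, s). x0 + of_real (s - x0 \<bullet> v) * v \<in> D0})"
  have "open U" unfolding U_def
  proof (intro open_UN ballI)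
    fix x0 assume "x0 \<in> D0"
    have "open ((\<lambda>q::complex \<times> real. x0 + of_real (snd q - x0 \<bullet> fst q) * fst q) -` D0)"
      by (intro open_vimage D0 continuous_intros)
    then show "open {(v, s). x0 + of_real (s - x0 \<bullet> v) * v \<in> D0}"
      by (simp add: vimage_def case_prod_unfold)
  qed
  have gap: "(\<exists>x\<in>D0. x \<bullet> v = s) \<longleftrightarrow> (v, s) \<in> U" if "norm v = 1" for v s
  proof
    assume "\<exists>x\<in>D0. x \<bullet> v = s"
    then obtain x where x: "x \<in> D0" "x \<bullet> v = s" by blast
    then have "x + of_real (s - x \<bullet> v) * v \<in> D0" by simp
    then show "(v, s) \<in> U" using x(1) unfolding U_def by blast
  next
    assume "(v, s) \<in> U"
    then obtain x0 where x0: "x0 + of_real (s - x0 \<bullet> v) * v \<in> D0" by (auto simp: U_def)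
    have "v \<bullet> v = 1" using that by (simp add: dot_square_norm)
    then have "(x0 + (s - x0 \<bullet> v) *\<^sub>R v) \<bullet> v = s" by (simp add: inner_add_left)
    then have "(x0 + of_real (s - x0 \<bullet> v) * v) \<bullet> v = s" by (simp only: scaleR_conv_of_real)
    then show "\<exists>x\<in>D0. x \<bullet> v = s" using x0 by blast
  qed
  have "compact ((\<lambda>q. (snd q, fst q \<bullet> snd q)) ` (D1 \<times> sphere 0 1))"
    by (intro compact_continuous_image compact_Times D1 compact_sphere continuous_intros)
  moreover have "Y = (\<lambda>q. (snd q, fst q \<bullet> snd q)) ` (D1 \<times> sphere 0 1) \<inter> - U"
  proof (intro set_eqI iffI)
    fix q assume "q \<in> Y"
    then obtain x where "norm (fst q) = 1" "\<forall>x\<in>D0. x \<bullet> fst q \<noteq> snd q" "x \<in> D1" "x \<bullet> fst q = snd q"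
      by (auto simp: Y_def)
    then show "q \<in> (\<lambda>q. (snd q, fst q \<bullet> snd q)) ` (D1 \<times> sphere 0 1) \<inter> - U"
      using gap[of "fst q" "snd q"] by (auto intro!: image_eqI[of _ _ "(x, fst q)"])
  next
    fix q assume "q \<in> (\<lambda>q. (snd q, fst q \<bullet> snd q)) ` (D1 \<times> sphere 0 1) \<inter> - U"
    then obtain x v where "x \<in> D1" "norm v = 1" "q = (v, x \<bullet> v)" "(v, x \<bullet> v) \<notin> U" by auto
    then show "q \<in> Y" using gap[of v "x \<bullet> v"] by (auto simp: Y_def)
  qed
  ultimately show ?thesis using \<open>open U\<close> by (auto intro: compact_Int_closed)
qed

lemma in_Y: "z \<in> X \<Longrightarrow> (om z, p z) \<in> Y"
  using om1 miss meet by (auto simp: Y_def)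

lemma homotopy:
  fixes a :: "real \<Rightarrow> complex \<times> real \<Rightarrow> complex"
  assumes "continuous_on ({0..1} \<times> Y) (\<lambda>(t, v). a t v)"
    and "\<And>t v. \<lbrakk>t \<in> {0..1}; v \<in> Y\<rbrakk> \<Longrightarrow> a t v \<noteq> 0"
    and "\<And>t. t \<in> {0..1} \<Longrightarrow> (\<lambda>z. a t (om z, p z)) \<in> P"
    and "(\<lambda>z. 1 / a 0 (om z, p z)) \<in> P"
  shows "(\<lambda>z. 1 / a 1 (om z, p z)) \<in> P"
  using inverse_homotopy[of Y "\<lambda>z. (om z, p z)" a, OF compact_Y in_Y assms] by blast

lemma linear_in_P: "(\<lambda>z. f z + b * w z + c) \<in> P"
  by (intro algebra_intros wP fP)

lemma linear_far: "\<exists>R. \<forall>c. norm c \<ge> R \<longrightarrow> (\<lambda>z. 1 / (f z + b * w z + c)) \<in> P"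
proof -
  obtain B where B: "\<forall>z\<in>X. norm (f z + b * w z + 0) \<le> B" using bounded linear_in_P by blast
  define B1 where "B1 = max B 1"
  have B1: "\<And>z. z \<in> X \<Longrightarrow> norm (f z + b * w z) \<le> B1" "B1 \<ge> 1" using B by (force simp: B1_def)+
  have "(\<lambda>z. 1 / (f z + b * w z + c)) \<in> P" if c: "norm c \<ge> 2 * B1" for c
  proof -
    have c0: "c \<noteq> 0" using c B1(2) by auto
    let ?g = "\<lambda>z. (-1/c) * (f z + b * w z)"
    have gP: "?g \<in> P" by (intro algebra_intros wP fP)
    have "(\<lambda>z. (1/c) * (1 / (1 - ?g z))) \<in> P"
    proof (rule cmult, rule neumann[OF gP, of "1/2"])
      fix z assume z: "z \<in> X"
      have "norm (?g z) = norm (f z + b * w z) / norm c" by (simp add: norm_mult norm_divide)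
      also have "\<dots> \<le> B1 / (2 * B1)" using B1 z c by (intro frac_le) auto
      finally show "norm (?g z) \<le> 1/2" using B1(2) by simp
    qed simp
    moreover have "(1/c) * (1 / (1 - ?g z)) = 1 / (f z + b * w z + c)" for z
      using c0 by (simp add: divide_simps) (simp add: algebra_simps)
    ultimately show ?thesis by simp
  qed
  then show ?thesis by blast
qed

text \<open>A linear form with a large constant term is a unit by a Neumann series. The homotopy
  brings the constant term back along a ray, from far out at t = 0 to \<open>c\<close> at t =
  1.\<close>

lemma linear_ray:
  assumes m: "m \<noteq> 0"
    and nz: "\<And>r v s. \<lbrakk>r \<ge> 0; (v, s) \<in> Y\<rbrakk> \<Longrightarrow> v * of_real s + b * v^2 + (c + of_real r * m) \<noteq> 0"
  shows "(\<lambda>z. 1 / (f z + b * w z + c)) \<in> P"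
proof -
  obtain R where R: "\<And>c. norm c \<ge> R \<Longrightarrow> (\<lambda>z. 1 / (f z + b * w z + c)) \<in> P"
    using linear_far by blast
  define r where "r = (\<bar>R\<bar> + norm c) / norm m"
  have r: "r \<ge> 0" by (simp add: r_def)
  have "norm (of_real r * m) = r * norm m" using r by (simp add: norm_mult)
  also have "\<dots> = \<bar>R\<bar> + norm c" using m by (simp add: r_def)
  finally have "norm (of_real r * m) = \<bar>R\<bar> + norm c" .
  then have big: "norm (c + of_real r * m) \<ge> R"
    using norm_triangle_ineq4[of "c + of_real r * m" c] by simp
  define a where "a t q = fst q * of_real (snd q) + b * fst q ^ 2 + (c + of_real ((1 - t) * r) * m)"
    for t :: real and q :: "complex \<times> real"
  have "(\<lambda>z. 1 / a 1 (om z, p z)) \<in> P"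
  proof (rule homotopy)
    show "continuous_on ({0..1} \<times> Y) (\<lambda>(t, v). a t v)"
      unfolding a_def case_prod_unfold by (intro continuous_intros)
    show "a t v \<noteq> 0" if "t \<in> {0..1}" "v \<in> Y" for t v
      using nz[of "(1 - t) * r" "fst v" "snd v"] that r by (simp add: a_def)
    show "(\<lambda>z. a t (om z, p z)) \<in> P" for t unfolding a_def fst_conv snd_conv by (intro linear_in_P)
    show "(\<lambda>z. 1 / a 0 (om z, p z)) \<in> P" using R[OF big] by (simp add: a_def)
  qed
  then show ?thesis by (simp add: a_def)
qed

text \<open>Without constant term the form lies in the ideal of \<open>f\<close> and
  \<open>w\<close>, so one invertible form of this kind suffices. All homotopies aim at such an
  endpoint; for the conic it is quadratic.\<close>

lemma regular_linear:
  assumes "(\<lambda>z. 1 / (f z + b * w z)) \<in> P" and nz: "\<And>v s. (v, s) \<in> Y \<Longrightarrow> v * of_real s + b * v^2 \<noteq> 0"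
  shows regular
  unfolding regular_def
proof (intro bexI ballI)
  fix z assume "z \<in> X"
  then have "f z + b * w z \<noteq> 0" using nz[OF in_Y] by simp
  then show "f z * (1 / (f z + b * w z)) + w z * (b * (1 / (f z + b * w z))) = 1"
    by (simp add: divide_simps)
qed (intro cmult assms)+

lemma unit_cases:
  assumes "norm (v::complex) = 1" "norm e = 1" "Im (cnj e * v) = 0"
  obtains \<sigma> :: real where "\<bar>\<sigma>\<bar> = 1" "v = of_real \<sigma> * e"
proof
  have "norm (cnj e * v) = 1" using assms by (simp add: norm_mult)
  then show "\<bar>Re (cnj e * v)\<bar> = 1" using assms(3) by (simp add: cmod_eq_Re)
  have "cnj e * v = of_real (Re (cnj e * v))" using assms(3) by (simp add: complex_eq_iff)
  then have "of_real (Re (cnj e * v)) * e = (cnj e * e) * v" by (simp add: mult_ac)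
  also have "cnj e * e = 1" using assms(2) by (metis complex_norm_square mult.commute of_real_1 power_one)
  finally show "v = of_real (Re (cnj e * v)) * e" by simp
qed

lemma norm_1_cnj: "norm (v::complex) = 1 \<Longrightarrow> v * cnj v = 1"
  by (metis complex_norm_square of_real_1 power_one)

text \<open>Taking out the unimodular factor \<open>v\<close> makes the zeros readable: for
  \<open>b = - cnj z / 2\<close> and \<open>c = - z / 2\<close> the other factor is the real number
  given by s minus the inner product of z and v, zero exactly on the lines through z.\<close>

lemma linear_form_eq:
  assumes "norm (v::complex) = 1"
  shows "v * of_real s + b * v^2 + c = v * (of_real s + b * v + c * cnj v)"
  using norm_1_cnj[OF assms] by algebra

text \<open>Unless the real point of a nonreal line lies in \<open>D1\<close>, a pencil of parallel lines missing
  \<open>D1\<close> shows regularity.\<close>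

lemma regular_if_0_notin:
  assumes "0 \<notin> D1" shows regular
proof -
  obtain a \<beta> where ab: "\<beta> > 0" "\<And>x. x \<in> D1 \<Longrightarrow> a \<bullet> x > \<beta>"
    using separating_hyperplane_closed_0[OF D1(2) compact_imp_closed[OF D1(1)] assms] by metis
  have a0: "a \<noteq> 0" using ab D1(3) by fastforce
  define e where "e = a /\<^sub>R norm a"
  define k where "k = \<beta> / norm a"
  have e: "norm e = 1" using a0 by (simp add: e_def)
  have k: "k > 0" using ab(1) a0 by (simp add: k_def)
  have D: "x \<bullet> e > k" if "x \<in> D1" for x
    using ab(2)[OF that] a0 by (simp add: e_def k_def divide_inverse inner_commute mult.commute[of _ "inverse _"])
  \<comment> \<open>After division by \<open>v\<close> the imaginary part is
    \<open>- (k + r) * Im (cnj e * v)\<close>, so a zero needs \<open>v\<close> parallel to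
    \<open>e\<close>. The real part then puts the line at height \<open>k - r\<close> along
    \<open>e\<close>, while \<open>D1\<close> lies above \<open>k\<close>.\<close>
  have main: "v * of_real s + (- of_real k * cnj e) * v^2 + (0 + of_real r * e) \<noteq> 0"
    if r: "r \<ge> 0" and Y: "(v, s) \<in> Y" for r v s
  proof
    assume z: "v * of_real s + (- of_real k * cnj e) * v^2 + (0 + of_real r * e) = 0"
    have v: "norm v = 1" using Y by (simp add: Y_def)
    have "v * (of_real s + (- of_real k * cnj e) * v + (0 + of_real r * e) * cnj v) = 0"
      using z linear_form_eq[OF v] by metis
    then have q: "of_real s + (- of_real k * cnj e) * v + (0 + of_real r * e) * cnj v = 0" using v by auto
    have "Im (of_real s + (- of_real k * cnj e) * v + (0 + of_real r * e) * cnj v) = - (k + r) * Im (cnj e * v)"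
      by (simp add: algebra_simps)
    then have "- (k + r) * Im (cnj e * v) = 0" unfolding q by simp
    moreover have "- (k + r) \<noteq> 0" using k r by simp
    ultimately have "Im (cnj e * v) = 0" by (metis mult_eq_0_iff)
    then obtain \<sigma> where s: "\<bar>\<sigma>\<bar> = 1" "v = of_real \<sigma> * e" using unit_cases[OF v e] by blast
    have ee: "cnj e * e = 1" using norm_1_cnj[OF e] by (simp add: mult.commute)
    have E0: "of_real s + (- of_real k * cnj e) * v + (0 + of_real r * e) * cnj v
        = (of_real s - of_real k * of_real \<sigma> * (cnj e * e) + of_real r * of_real \<sigma> * (cnj e * e) :: complex)"
      by (simp add: s(2) mult_ac)
    have "of_real (s - (k - r) * \<sigma>) = of_real s + (- of_real k * cnj e) * v + (0 + of_real r * e) * cnj v"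
      unfolding E0 ee by (simp add: algebra_simps)
    also note q
    finally have "of_real (s - (k - r) * \<sigma>) = (0::complex)" .
    then have sv: "s = (k - r) * \<sigma>" by (simp only: of_real_eq_0_iff)
    obtain x where x: "x \<in> D1" "x \<bullet> v = s" using Y by (auto simp: Y_def)
    have "v = \<sigma> *\<^sub>R e" by (simp add: s(2) scaleR_conv_of_real)
    then have "\<sigma> * (x \<bullet> e) = (k - r) * \<sigma>" using x(2) sv by simp
    then have "x \<bullet> e = k - r" using s(1) by auto
    then show False using D[OF x(1)] r by simp
  qed
  have "(\<lambda>z. 1 / (f z + (- of_real k * cnj e) * w z + 0)) \<in> P"
    by (rule linear_ray[of e]) (use e main in auto)
  then show ?thesis using main[of 0]
    by (intro regular_linear[of "- of_real k * cnj e"]) auto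
qed

text \<open>The form that vanishes on the lines through \<open>x1\<close> has no zero on
  \<open>Y\<close>, since such lines meet \<open>D0\<close>. It is a unit because a ray leads to it
  whose other forms vanish only on parallel lines beyond \<open>x1\<close>, away from
  \<open>D1\<close>. Shifting its weight from the constant term to the coefficient of
  \<open>w\<close> then changes only the imaginary part of its quotient by \<open>v\<close>; so no
  zero appears, and the constant term ends at 0.\<close>

lemma regular_if_not_subset:
  assumes x1: "x1 \<in> D0" "x1 \<notin> D1" shows regular
proof -
  obtain a \<beta> where ab: "a \<bullet> x1 < \<beta>" "\<And>x. x \<in> D1 \<Longrightarrow> a \<bullet> x > \<beta>"
    using separating_hyperplane_closed_point[OF D1(2) compact_imp_closed[OF D1(1)] x1(2)] by metis
  have a0: "a \<noteq> 0" using ab D1(3) by fastforce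
  define e where "e = - (a /\<^sub>R norm a)"
  have e: "norm e = 1" using a0 by (simp add: e_def)
  have D: "x \<bullet> e < x1 \<bullet> e" if "x \<in> D1" for x
  proof -
    have "a \<bullet> x1 < a \<bullet> x" using ab(1) ab(2)[OF that] by simp
    then have "inverse (norm a) * (a \<bullet> x1) < inverse (norm a) * (a \<bullet> x)" using a0 by simp
    then show ?thesis by (simp add: e_def inner_commute)
  qed
  have inn: "(cnj x1 * v + x1 * cnj v) / 2 = of_real (x1 \<bullet> v)" for v
    by (simp add: complex_eq_iff inner_complex_def)
  have main: "v * of_real s + (- cnj x1 / 2) * v^2 + (- x1 / 2 + of_real r * (- e)) \<noteq> 0"
    if r: "r \<ge> 0" and Y: "(v, s) \<in> Y" for r v s
  proof
    assume z: "v * of_real s + (- cnj x1 / 2) * v^2 + (- x1 / 2 + of_real r * (- e)) = 0"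
    have v: "norm v = 1" using Y by (simp add: Y_def)
    have "v * (of_real s + (- cnj x1 / 2) * v + (- x1 / 2 + of_real r * (- e)) * cnj v) = 0"
      using z linear_form_eq[OF v] by metis
    then have "of_real s + (- cnj x1 / 2) * v + (- x1 / 2 + of_real r * (- e)) * cnj v = 0" using v by auto
    then have "of_real s - (cnj x1 * v + x1 * cnj v) / 2 - of_real r * (e * cnj v) = 0"
      by (simp add: algebra_simps add_divide_distrib)
    then have q: "of_real (s - x1 \<bullet> v) = of_real r * (e * cnj v)" by (simp add: inn)
    have "Im (of_real r * (e * cnj v)) = 0" using q[symmetric] by simp
    then have r0: "r = 0 \<or> Im (cnj e * v) = 0" by (auto simp: algebra_simps)
    show False
    proof (cases "r = 0")
      case True
      then have "of_real (s - x1 \<bullet> v) = (0::complex)" using q by simp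
      then have "x1 \<bullet> v = s" by (simp only: of_real_eq_0_iff)
      then show False using Y x1(1) by (auto simp: Y_def)
    next
      case False
      then obtain \<sigma> where s: "\<bar>\<sigma>\<bar> = 1" "v = of_real \<sigma> * e" using unit_cases[OF v e] r0 by blast
      have "e * cnj v = of_real \<sigma>" using norm_1_cnj[OF e] by (simp add: s(2) mult.left_commute)
      then have "of_real (s - x1 \<bullet> v) = (of_real (r * \<sigma>) :: complex)" using q by simp
      then have sv: "s - x1 \<bullet> v = r * \<sigma>" by (simp only: of_real_eq_iff)
      obtain x where x: "x \<in> D1" "x \<bullet> v = s" using Y by (auto simp: Y_def)
      have "v = \<sigma> *\<^sub>R e" by (simp add: s(2) scaleR_conv_of_real)
      then have "\<sigma> * (x \<bullet> e - x1 \<bullet> e - r) = 0" using x(2) sv by (simp add: algebra_simps)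
      then have "x \<bullet> e = x1 \<bullet> e + r" using s(1) by auto
      then show False using D[OF x(1)] r by simp
    qed
  qed
  have start: "(\<lambda>z. 1 / (f z + (- cnj x1 / 2) * w z + (- x1 / 2))) \<in> P"
    by (rule linear_ray[of "- e"]) (use e main in auto)
  define a where "a t q = fst q * of_real (snd q) + (- cnj x1 * of_real (1 + t) / 2) * fst q ^ 2 + (- x1 * of_real (1 - t) / 2)"
    for t :: real and q :: "complex \<times> real"
  have nz: "a t (v, s) \<noteq> 0" if Y: "(v, s) \<in> Y" for t v s
  proof
    have v: "norm v = 1" using Y by (simp add: Y_def)
    assume "a t (v, s) = 0"
    then have "v * (of_real s + (- cnj x1 * of_real (1 + t) / 2) * v + (- x1 * of_real (1 - t) / 2) * cnj v) = 0"
      using linear_form_eq[OF v] by (metis a_def fst_conv snd_conv)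
    then have "of_real s + (- cnj x1 * of_real (1 + t) / 2) * v + (- x1 * of_real (1 - t) / 2) * cnj v = 0" using v by auto
    then have "of_real s - (cnj x1 * v + x1 * cnj v) / 2 - of_real t * (cnj x1 * v - x1 * cnj v) / 2 = 0"
      by (simp add: algebra_simps add_divide_distrib diff_divide_distrib)
    then have "of_real s - of_real (x1 \<bullet> v) - of_real t * (cnj x1 * v - x1 * cnj v) / 2 = 0" by (simp only: inn)
    moreover have "Re (of_real s - of_real (x1 \<bullet> v) - of_real t * (cnj x1 * v - x1 * cnj v) / 2) = s - x1 \<bullet> v" by simp
    ultimately have "s - x1 \<bullet> v = 0" by (metis zero_complex.sel(1))
    then have "s = x1 \<bullet> v" by simp
    then show False using Y x1(1) by (auto simp: Y_def)
  qed
  have "(\<lambda>z. 1 / a 1 (om z, p z)) \<in> P"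
  proof (rule homotopy)
    show "continuous_on ({0..1} \<times> Y) (\<lambda>(t, v). a t v)"
      unfolding a_def case_prod_unfold by (intro continuous_intros ballI) auto
    show "a t v \<noteq> 0" if "t \<in> {0..1}" "v \<in> Y" for t v
      using nz[of "fst v" "snd v" t] that by simp
    show "(\<lambda>z. a t (om z, p z)) \<in> P" for t unfolding a_def fst_conv snd_conv by (intro linear_in_P)
    show "(\<lambda>z. 1 / a 0 (om z, p z)) \<in> P" using start by (simp add: a_def)
  qed
  then show ?thesis using nz[of _ _ 1] by (intro regular_linear[of "- cnj x1"]) (auto simp: a_def)
qed

text \<open>The pencil of conics through two lines missing \<open>D1\<close> and two lines meeting \<open>D0\<close>, written in
  the coordinates \<open>N, U, V\<close> of a line \<open>(om, p)\<close> given by \<open>N = p\<close> and \<open>om - p n = U e + V e'\<close>.\<close>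

lemma regular_conic:
  assumes e: "norm e = 1" "norm e' = 1" and k: "Im (cnj e * e') > 0"
    and pos: "a > 0" "a' > 0" "b > 0" "b' > 0" and ab: "a * a' > b * b'"
    and m: "\<And>\<xi> x. \<lbrakk>- a' \<le> \<xi>; \<xi> \<le> a; x \<in> D1\<rbrakk> \<Longrightarrow> x \<bullet> (n + \<xi> *\<^sub>R e) < 1"
    and l: "\<And>\<eta>. \<eta> \<ge> b \<or> \<eta> \<le> - b' \<Longrightarrow> \<exists>x\<in>D0. x \<bullet> (n + \<eta> *\<^sub>R e') = 1"
    and l0: "\<exists>x\<in>D0. x \<bullet> e' = 0"
  shows regular
proof -
  define K where "K = Im (cnj e * e')"
  define U where "U y = Im (cnj y * e') / K" for y
  define V where "V y = Im (cnj e * y) / K" for y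
  have K: "K > 0" using k by (simp add: K_def)
  have UV: "y = U y *\<^sub>R e + V y *\<^sub>R e'" for y
  proof -
    have "K *\<^sub>R y = Im (cnj y * e') *\<^sub>R e + Im (cnj e * y) *\<^sub>R e'"
      by (simp add: K_def complex_eq_iff algebra_simps)
    then have "inverse K *\<^sub>R (K *\<^sub>R y) = inverse K *\<^sub>R (Im (cnj y * e') *\<^sub>R e + Im (cnj e * y) *\<^sub>R e')" by simp
    then show ?thesis using K by (simp add: U_def V_def scaleR_add_right divide_inverse mult.commute)
  qed
  define c1 where "c1 = 1/a - 1/a'"
  define c2 where "c2 = 1/(a*a')"
  define d1 where "d1 = 1/b - 1/b'"
  define d2 where "d2 = 1/(b*b')"
  have c2: "c2 > 0" "d2 > c2" using pos ab by (auto simp: c2_def d2_def intro!: divide_strict_left_mono)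
  \<comment> \<open>The coordinates \<open>U\<close> and \<open>V\<close> of a line involve
    \<open>cnj v\<close>; multiplied by \<open>v\<close> they become affine in \<open>w\<close> and
    \<open>f\<close>, with these coefficients. The parameter \<open>t\<close> of \<open>Uc\<close>
    and \<open>Vc\<close> switches the translation by \<open>p n\<close> on.\<close>
  define u0 where "u0 = e' / (2 * \<i> * of_real K)"
  define u1 where "u1 = - cnj e' / (2 * \<i> * of_real K)"
  define u2 where "u2 = - (of_real (Im (cnj n * e')) / of_real K :: complex)"
  define v0 where "v0 = - e / (2 * \<i> * of_real K)"
  define v1 where "v1 = cnj e / (2 * \<i> * of_real K)"
  define v2 where "v2 = - (of_real (Im (cnj e * n)) / of_real K :: complex)"
  define Uc where "Uc t q = u0 + u1 * fst q ^ 2 + of_real t * u2 * (fst q * of_real (snd q))"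
    for t :: real and q :: "complex \<times> real"
  define Vc where "Vc t q = v0 + v1 * fst q ^ 2 + of_real t * v2 * (fst q * of_real (snd q))"
    for t :: real and q :: "complex \<times> real"
  have im: "(of_real (Im y) :: complex) = (y - cnj y) / (2 * \<i>)" for y by (simp add: complex_eq_iff)
  have K0: "of_real K \<noteq> (0::complex)" using K by simp
  have Uc: "Uc t (v, s) = v * of_real (U (v - of_real (t * s) * n))" if v: "norm v = 1" for t v s
  proof -
    define \<alpha> \<beta> where "\<alpha> = Im (cnj v * e')" and "\<beta> = Im (cnj n * e')"
    have 1: "U (v - of_real (t * s) * n) = (\<alpha> - t * s * \<beta>) / K"
      by (simp add: U_def \<alpha>_def \<beta>_def algebra_simps)
    have "v * of_real (U (v - of_real (t * s) * n)) =
        (v * of_real \<alpha>) / of_real K - of_real t * (of_real \<beta> / of_real K) * (v * of_real s)"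
      unfolding 1 by (simp add: diff_divide_distrib algebra_simps)
    also have "v * of_real \<alpha> = (e' - v^2 * cnj e') / (2 * \<i>)"
    proof -
      have "v * (cnj v * e' - v * cnj e') = e' - v^2 * cnj e'" using norm_1_cnj[OF v] by algebra
      then show ?thesis by (simp only: \<alpha>_def im complex_cnj_mult complex_cnj_cnj times_divide_eq_right)
    qed
    finally show ?thesis
      unfolding Uc_def fst_conv snd_conv u0_def u1_def u2_def \<beta>_def[symmetric]
      using K0 by (simp add: field_simps)
  qed
  have Vc: "Vc t (v, s) = v * of_real (V (v - of_real (t * s) * n))" if v: "norm v = 1" for t v s
  proof -
    define \<alpha> \<beta> where "\<alpha> = Im (cnj e * v)" and "\<beta> = Im (cnj e * n)"
    have 1: "V (v - of_real (t * s) * n) = (\<alpha> - t * s * \<beta>) / K"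
      by (simp add: V_def \<alpha>_def \<beta>_def algebra_simps)
    have "v * of_real (V (v - of_real (t * s) * n)) =
        (v * of_real \<alpha>) / of_real K - of_real t * (of_real \<beta> / of_real K) * (v * of_real s)"
      unfolding 1 by (simp add: diff_divide_distrib algebra_simps)
    also have "v * of_real \<alpha> = (v^2 * cnj e - e) / (2 * \<i>)"
    proof -
      have "v * (cnj e * v - e * cnj v) = v^2 * cnj e - e" using norm_1_cnj[OF v] by algebra
      then show ?thesis by (simp only: \<alpha>_def im complex_cnj_mult complex_cnj_cnj times_divide_eq_right)
    qed
    finally show ?thesis
      unfolding Vc_def fst_conv snd_conv v0_def v1_def v2_def \<beta>_def[symmetric]
      using K0 by (simp add: field_simps)
  qed
  have UcP: "(\<lambda>z. Uc t (om z, p z)) \<in> P" and VcP: "(\<lambda>z. Vc t (om z, p z)) \<in> P" for t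
    unfolding Uc_def Vc_def fst_conv snd_conv by (intro algebra_intros wP fP)+
  have Ucont: "continuous_on S (\<lambda>q. Uc (g q) (h q))" "continuous_on S (\<lambda>q. Vc (g q) (h q))"
    if "continuous_on S g" "continuous_on S h" for S :: "(real \<times> complex \<times> real) set" and g h
    unfolding Uc_def Vc_def by (intro continuous_intros that)+
  have YD: "norm v = 1" "v \<noteq> 0" "\<exists>x\<in>D1. x \<bullet> v = s" "\<not> (\<exists>x\<in>D0. x \<bullet> v = s)" if "(v, s) \<in> Y" for v s
    using that by (auto simp: Y_def)
  have n1: "x \<bullet> n < 1" if "x \<in> D1" for x using m[of 0 x] that pos by simp

  text \<open>The square root of the degenerate conic at the start of the path.\<close>
  define G where "G t q = Uc t q - \<i> * Vc t q" for t q
  have Gnz: "G t (v, s) \<noteq> 0" if t: "t \<in> {0..1}" and Y: "(v, s) \<in> Y" for t v s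
  proof
    note v = YD[OF Y]
    define y where "y = v - of_real (t * s) * n"
    assume "G t (v, s) = 0"
    then have "v * (of_real (U y) - \<i> * of_real (V y)) = 0"
      by (simp add: G_def Uc[OF v(1)] Vc[OF v(1)] y_def algebra_simps)
    then have "of_real (U y) - \<i> * of_real (V y) = 0" using v(2) by simp
    then have "U y = 0" "V y = 0" by (auto simp: complex_eq_iff)
    then have "y = 0" using UV[of y] by simp
    then have vs: "v = (t * s) *\<^sub>R n" by (simp add: y_def scaleR_conv_of_real)
    then have s: "s \<noteq> 0" using v(2) by auto
    obtain x where x: "x \<in> D1" "x \<bullet> v = s" using v by blast
    then have "s * (t * (x \<bullet> n)) = s * 1" by (simp add: vs)
    then have "t * (x \<bullet> n) = 1" using s by (simp only: mult_cancel_left) auto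
    moreover have "t * (x \<bullet> n) < 1"
    proof (cases "x \<bullet> n \<le> 0")
      case True then have "t * (x \<bullet> n) \<le> 0" using t by (auto intro: mult_nonneg_nonpos)
      then show ?thesis by simp
    next
      case False then have "t * (x \<bullet> n) \<le> 1 * (x \<bullet> n)" using t by (intro mult_right_mono) auto
      then show ?thesis using n1[OF x(1)] by simp
    qed
    ultimately show False by simp
  qed
  have GP: "(\<lambda>z. G t (om z, p z)) \<in> P" for t unfolding G_def by (intro algebra_intros UcP VcP)
  \<comment> \<open>At t = 0 the form is affine in \<open>w\<close>, and its constant term
    dominates: the squared norms compared are \<open>2 + 2 * K\<close> and \<open>2 - 2 * K\<close>.
    Here the orientation \<open>K > 0\<close> decides for U - i V and against U + i V.\<close>
  have G0: "(\<lambda>z. 1 / G 0 (om z, p z)) \<in> P"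
  proof -
    define g1 where "g1 = u0 - \<i> * v0"
    define g2 where "g2 = u1 - \<i> * v1"
    have G0eq: "G 0 (om z, p z) = g1 + g2 * w z" for z
      by (simp add: G_def Uc_def Vc_def g1_def g2_def algebra_simps)
    have "(norm (e' + \<i> * e))^2 = (norm e')^2 + (norm e)^2 + 2 * K"
      unfolding cmod_power2 K_def by (simp add: power2_eq_square algebra_simps)
    then have n1': "(norm (e' + \<i> * e))^2 = 2 + 2 * K" using e by simp
    have "(norm (cnj e' + \<i> * cnj e))^2 = (norm e')^2 + (norm e)^2 - 2 * K"
      unfolding cmod_power2 K_def by (simp add: power2_eq_square algebra_simps)
    then have n2': "(norm (cnj e' + \<i> * cnj e))^2 = 2 - 2 * K" using e by simp
    have "(norm (cnj e' + \<i> * cnj e))^2 < (norm (e' + \<i> * e))^2" using n1' n2' K by simp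
    then have lt: "norm (cnj e' + \<i> * cnj e) < norm (e' + \<i> * e)" by (rule power2_less_imp_less) simp
    have g1: "g1 = (e' + \<i> * e) / (2 * \<i> * of_real K)" by (simp add: g1_def u0_def v0_def add_divide_distrib)
    have g2: "g2 = - (cnj e' + \<i> * cnj e) / (2 * \<i> * of_real K)"
      by (simp add: g2_def u1_def v1_def add_divide_distrib diff_divide_distrib)
    have "norm g2 = norm (cnj e' + \<i> * cnj e) / (2 * K)" "norm g1 = norm (e' + \<i> * e) / (2 * K)"
      unfolding g1 g2 norm_divide norm_minus_cancel using K by (simp_all add: norm_mult)
    then have lt: "norm g2 < norm g1" using lt K by (simp add: divide_strict_right_mono)
    then have g10: "g1 \<noteq> 0" by auto
    have "(\<lambda>z. (1/g1) * (1 / (1 - (- g2/g1) * w z))) \<in> P"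
    proof (rule cmult, rule neumann[of _ "norm g2 / norm g1"])
      show "(\<lambda>z. (- g2/g1) * w z) \<in> P" by (intro algebra_intros wP)
      show "norm g2 / norm g1 < 1" using lt g10 by simp
      fix z show "norm ((- g2/g1) * w z) \<le> norm g2 / norm g1"
        using om1[of z] by (simp add: norm_mult norm_divide norm_power)
    qed
    moreover have "(1/g1) * (1 / (1 - (- g2/g1) * w z)) = 1 / G 0 (om z, p z)" for z
      using g10 by (simp add: G0eq field_simps)
    ultimately show ?thesis by simp
  qed
  have G1: "(\<lambda>z. 1 / G 1 (om z, p z)) \<in> P"
  proof (rule homotopy[where a = G, OF _ _ GP G0])
    show "continuous_on ({0..1} \<times> Y) (\<lambda>(t, v). G t v)"
      unfolding G_def case_prod_unfold by (intro continuous_intros Ucont)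
    show "G t v \<noteq> 0" if "t \<in> {0..1}" "v \<in> Y" for t v using Gnz[of t "fst v" "snd v"] that by simp
  qed

  define s where "s = (of_real d2 * v0^2 + of_real c2 * u0^2) / (2 * u0 * v0)"
  have Ims: "Im s > 0"
  proof -
    have e0: "e \<noteq> 0" "e' \<noteq> 0" using e by auto
    have "s = - (of_real d2 * (e / e') + of_real c2 * (e' / e)) / 2"
      using e0 K0 by (simp add: s_def u0_def v0_def field_simps power2_eq_square)
    moreover have "e / e' = e * cnj e'" "e' / e = e' * cnj e"
      using norm_1_cnj[OF e(1)] norm_1_cnj[OF e(2)] e0 by (auto simp: field_simps)
    ultimately have "s = - (of_real d2 * (e * cnj e') + of_real c2 * (e' * cnj e)) / 2" by simp
    then have "Im s = Im (- (of_real d2 * (e * cnj e') + of_real c2 * (e' * cnj e)) / 2)" by (rule arg_cong)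
    also have "\<dots> = K * (d2 - c2) / 2" by (simp add: K_def algebra_simps)
    finally have "Im s = K * (d2 - c2) / 2" .
    moreover have "K * (d2 - c2) > 0" using K c2 by simp
    ultimately show ?thesis by linarith
  qed
  \<comment> \<open>On \<open>Y\<close> the conic below is \<open>v^2\<close> times a number with
    imaginary part 2 Im (S t) U V. Keeping \<open>Im (S t)\<close> positive forces U = 0 or V = 0 at
    a zero and leaves a real quadratic equation. At t = 1 the value \<open>s\<close> is dictated by
    the constant term, and the sign of its imaginary part is that of \<open>d2 - c2\<close>.\<close>
  define S where "S t = of_real t * s + of_real (1 - t) * (\<i> * of_real c2)" for t :: real
  have ImS: "Im (S t) > 0" if "t \<in> {0..1}" for t
  proof (cases "t = 0")
    case False
    then have "t * Im s > 0" using that Ims by auto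
    moreover have "(1 - t) * c2 \<ge> 0" using that c2 by auto
    ultimately show ?thesis by (simp add: S_def)
  qed (use c2 in \<open>simp add: S_def\<close>)
  text \<open>At \<open>t = 1\<close> the real part is \<open>(N - U/a) (N + U/a') + (N - V/b) (N + V/b') - N^2\<close>, and \<open>s\<close> is
    chosen such that there is no constant term; at \<open>t = 0\<close> the conic is \<open>- c2 (U - i V)^2\<close>.\<close>
  define A where "A t q = of_real t * ((fst q * of_real (snd q))^2 - of_real c1 * (fst q * of_real (snd q)) * Uc 1 q
      - of_real d1 * (fst q * of_real (snd q)) * Vc 1 q - of_real d2 * (Vc 1 q)^2)
    - of_real c2 * (Uc 1 q)^2 + of_real ((1 - t) * c2) * (Vc 1 q)^2 + 2 * S t * Uc 1 q * Vc 1 q" for t q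
  have Anz: "A t (v, s') \<noteq> 0" if t: "t \<in> {0..1}" and Y: "(v, s') \<in> Y" for t v s'
  proof
    note v = YD[OF Y]
    define y where "y = v - of_real s' * n"
    define \<alpha> where "\<alpha> = U y"
    define \<beta> where "\<beta> = V y"
    have y: "v = s' *\<^sub>R n + \<alpha> *\<^sub>R e + \<beta> *\<^sub>R e'"
      using UV[of y] by (simp add: \<alpha>_def \<beta>_def y_def scaleR_conv_of_real algebra_simps)
    define R where "R = t * (s'^2 - c1 * s' * \<alpha> - d1 * s' * \<beta> - d2 * \<beta>^2) - c2 * \<alpha>^2 + (1 - t) * c2 * \<beta>^2"
    assume "A t (v, s') = 0"
    moreover have "A t (v, s') = v^2 * (of_real R + 2 * S t * of_real (\<alpha> * \<beta>))"
      by (simp add: A_def Uc[OF v(1)] Vc[OF v(1)] R_def \<alpha>_def \<beta>_def y_def algebra_simps power2_eq_square)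
    ultimately have eq: "of_real R + 2 * S t * of_real (\<alpha> * \<beta>) = 0" using v(2) by simp
    have "Im (of_real R + 2 * S t * of_real (\<alpha> * \<beta>)) = 2 * Im (S t) * (\<alpha> * \<beta>)" by simp
    then have "2 * Im (S t) * (\<alpha> * \<beta>) = 0" unfolding eq by simp
    moreover have "2 * Im (S t) \<noteq> 0" using ImS[OF t] by simp
    ultimately have ab0: "\<alpha> * \<beta> = 0" by (metis mult_eq_0_iff)
    then have "of_real R = (0::complex)" using eq by (simp only: ab0) simp
    then have R0: "R = 0" by simp
    consider "\<beta> = 0" | "\<alpha> = 0" "\<beta> \<noteq> 0" using ab0 by auto
    then show False
    proof cases
      case 1
      \<comment> \<open>Here the dual point \<open>v / s'\<close> is n + \<xi> e on the first chord.
        The equation confines \<xi> to the segment from \<open>- a'\<close> to \<open>a\<close>,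
        where by \<open>m\<close> the line misses \<open>D1\<close>.\<close>
      have q: "t * (s'^2 - c1 * s' * \<alpha>) = c2 * \<alpha>^2" using R0 1 by (simp add: R_def)
      have s0: "s' \<noteq> 0"
      proof
        assume "s' = 0" then have "\<alpha> = 0" using q c2 by simp
        then show False using y 1 \<open>s' = 0\<close> v(2) by simp
      qed
      define \<xi> where "\<xi> = \<alpha> / s'"
      have al: "\<alpha> = s' * \<xi>" using s0 by (simp add: \<xi>_def)
      have "s'^2 * (t * (1 - c1 * \<xi>)) = s'^2 * (c2 * \<xi>^2)" using q by (simp add: al power2_eq_square algebra_simps)
      then have q': "t * (1 - c1 * \<xi>) = c2 * \<xi>^2" using s0 by simp
      have f: "1 - c1 * \<xi> - c2 * \<xi>^2 = (1 - \<xi>/a) * (1 + \<xi>/a')"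
        using pos by (simp add: c1_def c2_def field_simps power2_eq_square)
      have "t * ((1 - \<xi>/a) * (1 + \<xi>/a')) = (1 - t) * (c2 * \<xi>^2)"
        unfolding f[symmetric] using q' by (simp add: algebra_simps)
      moreover have "(1 - t) * (c2 * \<xi>^2) \<ge> 0" using t c2 by simp
      ultimately have fn: "t * ((1 - \<xi>/a) * (1 + \<xi>/a')) \<ge> 0" by simp
      have range: "- a' \<le> \<xi> \<and> \<xi> \<le> a"
      proof (cases "t = 0")
        case True then have "\<xi> = 0" using q' c2 by simp
        then show ?thesis using pos by simp
      next
        case False
        then have "(1 - \<xi>/a) * (1 + \<xi>/a') \<ge> 0" using fn t by (simp add: zero_le_mult_iff)
        then have "((1 - \<xi>/a) * (1 + \<xi>/a')) * (a * a') \<ge> 0" using pos by simp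
        also have "((1 - \<xi>/a) * (1 + \<xi>/a')) * (a * a') = (a - \<xi>) * (a' + \<xi>)"
          using pos by (simp add: field_simps)
        finally show ?thesis using pos by (auto simp: zero_le_mult_iff)
      qed
      have vv: "v = s' *\<^sub>R (n + \<xi> *\<^sub>R e)" using y 1 by (simp add: al scaleR_add_right)
      obtain x where x: "x \<in> D1" "x \<bullet> v = s'" using v by blast
      then have "s' * (x \<bullet> (n + \<xi> *\<^sub>R e)) = s' * 1" by (simp add: vv)
      then have "x \<bullet> (n + \<xi> *\<^sub>R e) = 1" using s0 by (simp only: mult_cancel_left) auto
      then show False using m[of \<xi> x] range x by simp
    next
      case 2
      \<comment> \<open>Here the dual point is n + \<eta> e', and the equation keeps \<eta> off the
        open segment from \<open>- b'\<close> to \<open>b\<close>, so by \<open>l\<close> the line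
        meets \<open>D0\<close>. For \<open>s' = 0\<close> the dual point is at infinity, the case
        covered by \<open>l0\<close>.\<close>
      have q: "t * (s'^2 - d1 * s' * \<beta> - d2 * \<beta>^2) + (1 - t) * c2 * \<beta>^2 = 0" using R0 2 by (simp add: R_def)
      show False
      proof (cases "s' = 0")
        case True
        then have vb: "v = \<beta> *\<^sub>R e'" using y 2 by simp
        obtain x where "x \<in> D0" "x \<bullet> e' = 0" using l0 by blast
        then show False using v(4) True by (auto simp: vb)
      next
        case s0: False
        define \<eta> where "\<eta> = \<beta> / s'"
        have be: "\<beta> = s' * \<eta>" using s0 by (simp add: \<eta>_def)
        have et: "\<eta> \<noteq> 0" using 2 be by auto
        have "s'^2 * (t * (1 - d1 * \<eta> - d2 * \<eta>^2) + (1 - t) * c2 * \<eta>^2) = 0"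
          using q by (simp add: be power2_eq_square algebra_simps)
        then have q': "t * (1 - d1 * \<eta> - d2 * \<eta>^2) + (1 - t) * c2 * \<eta>^2 = 0" using s0 by simp
        have f: "1 - d1 * \<eta> - d2 * \<eta>^2 = (1 - \<eta>/b) * (1 + \<eta>/b')"
          using pos by (simp add: d1_def d2_def field_simps power2_eq_square)
        have range: "\<eta> \<ge> b \<or> \<eta> \<le> - b'"
        proof (rule ccontr)
          assume "\<not> ?thesis"
          then have "(1 - \<eta>/b) * (1 + \<eta>/b') > 0" using pos by (intro mult_pos_pos) (auto simp: field_simps)
          then have 1: "t * ((1 - \<eta>/b) * (1 + \<eta>/b')) \<ge> 0" using t by simp
          have 2: "(1 - t) * c2 * \<eta>^2 \<ge> 0" using t c2 by simp
          show False
          proof (cases "t = 0")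
            case True then show False using q' c2 et by simp
          next
            case False
            then have "t * ((1 - \<eta>/b) * (1 + \<eta>/b')) > 0" using t \<open>(1 - \<eta>/b) * (1 + \<eta>/b') > 0\<close> by simp
            then show False using q' 2 unfolding f by linarith
          qed
        qed
        have vv: "v = s' *\<^sub>R (n + \<eta> *\<^sub>R e')" using y 2 by (simp add: be scaleR_add_right)
        obtain x where "x \<in> D0" "x \<bullet> (n + \<eta> *\<^sub>R e') = 1" using l[OF range] by blast
        then have "x \<bullet> v = s'" by (simp add: vv)
        then show False using v(4) \<open>x \<in> D0\<close> by blast
      qed
    qed
  qed
  have AP: "(\<lambda>z. A t (om z, p z)) \<in> P" for t
    unfolding A_def fst_conv snd_conv by (intro algebra_intros UcP VcP fP)
  have A0: "(\<lambda>z. 1 / A 0 (om z, p z)) \<in> P"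
  proof -
    have "A 0 q = - of_real c2 * (G 1 q)^2" for q
      by (simp add: A_def S_def G_def power2_eq_square algebra_simps)
    then have "1 / A 0 (om z, p z) = (-1 / of_real c2) * ((1 / G 1 (om z, p z)) * (1 / G 1 (om z, p z)))" for z
      by (simp add: power2_eq_square)
    moreover have "(\<lambda>z. (-1 / of_real c2) * ((1 / G 1 (om z, p z)) * (1 / G 1 (om z, p z)))) \<in> P"
      by (intro cmult mult G1)
    ultimately show ?thesis by simp
  qed
  have A1: "(\<lambda>z. 1 / A 1 (om z, p z)) \<in> P"
  proof (rule homotopy[where a = A, OF _ _ AP A0])
    show "continuous_on ({0..1} \<times> Y) (\<lambda>(t, v). A t v)"
      unfolding A_def S_def case_prod_unfold by (intro continuous_intros Ucont)
    show "A t v \<noteq> 0" if "t \<in> {0..1}" "v \<in> Y" for t v using Anz[of t "fst v" "snd v"] that by simp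
  qed
  define uc where "uc z = Uc 1 (om z, p z)" for z
  define vc where "vc z = Vc 1 (om z, p z)" for z
  have ucP: "uc \<in> P" "vc \<in> P" using UcP VcP by (simp_all add: uc_def[abs_def] vc_def[abs_def])
  \<comment> \<open>With the constant terms cancelled, each remaining product splits off
    \<open>f\<close> or \<open>w\<close>, as in
    \<open>uc^2 - u0^2 = (u1 * w + u2 * f) * (uc + u0)\<close>. The cofactors are collected in
    \<open>G'\<close> and \<open>H'\<close>.\<close>
  define G' where "G' z = f z - of_real c1 * uc z - of_real d1 * vc z - of_real d2 * (v2 * (vc z + v0))
     - of_real c2 * (u2 * (uc z + u0)) + 2 * s * (u2 * vc z + u0 * v2)" for z
  define H' where "H' z = - (of_real d2 * (v1 * (vc z + v0))) - of_real c2 * (u1 * (uc z + u0))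
     + 2 * s * (u1 * vc z + u0 * v1)" for z
  have const0: "- of_real d2 * v0^2 - of_real c2 * u0^2 + 2 * s * u0 * v0 = 0"
  proof -
    have "u0 \<noteq> 0" "v0 \<noteq> 0" using e K0 by (auto simp: u0_def v0_def)
    then have "2 * s * u0 * v0 = of_real d2 * v0^2 + of_real c2 * u0^2" by (simp add: s_def)
    then show ?thesis by simp
  qed
  have decomp: "A 1 (om z, p z) = f z * G' z + w z * H' z" for z
  proof -
    have u: "uc z = u0 + u1 * w z + u2 * f z" and v: "vc z = v0 + v1 * w z + v2 * f z"
      by (simp_all add: uc_def vc_def Uc_def Vc_def)
    have "A 1 (om z, p z) = (f z)^2 - of_real c1 * f z * uc z - of_real d1 * f z * vc z - of_real d2 * (vc z)^2
        - of_real c2 * (uc z)^2 + 2 * s * uc z * vc z"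
      by (simp add: A_def S_def uc_def vc_def)
    also have "\<dots> = \<dots> - (- of_real d2 * v0^2 - of_real c2 * u0^2 + 2 * s * u0 * v0)" by (simp only: const0) simp
    also have "\<dots> = f z * G' z + w z * H' z" unfolding G'_def H'_def u v by algebra
    finally show ?thesis .
  qed
  show ?thesis unfolding regular_def
  proof (rule bexI[of _ "\<lambda>z. G' z * (1 / A 1 (om z, p z))"], rule bexI[of _ "\<lambda>z. H' z * (1 / A 1 (om z, p z))"], rule ballI)
    show "(\<lambda>z. G' z * (1 / A 1 (om z, p z))) \<in> P" "(\<lambda>z. H' z * (1 / A 1 (om z, p z))) \<in> P"
      unfolding G'_def H'_def by (intro algebra_intros A1 ucP fP)+
    fix z assume "z \<in> X"
    then have nz: "A 1 (om z, p z) \<noteq> 0" using Anz[OF _ in_Y] by simp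
    have "f z * (G' z * (1 / A 1 (om z, p z))) + w z * (H' z * (1 / A 1 (om z, p z)))
      = (f z * G' z + w z * H' z) * (1 / A 1 (om z, p z))" by (simp only: algebra_simps)
    also have "\<dots> = 1" using nz unfolding decomp[symmetric] by simp
    finally show "f z * (G' z * (1 / A 1 (om z, p z))) + w z * (H' z * (1 / A 1 (om z, p z))) = 1" .
  qed
qed

end

section \<open>Basic solutions of linear programs, dual sets, separation by a circle\<close>

text \<open>Move the coefficients along a linear dependence, in the direction in which the objective
  does not decrease, until one of them vanishes; then induct. Positivity of \<open>h\<close> on
  \<open>W\<close> forces every nontrivial dependence to have a negative coefficient, so the motion
  does stop.\<close>

lemma linear_program_basic_solution:
  fixes W :: "'a::euclidean_space set" and c obj :: "'a \<Rightarrow> real"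
  assumes "finite W" and "\<And>x. x \<in> W \<Longrightarrow> c x \<ge> 0" and "\<And>x. x \<in> W \<Longrightarrow> h \<bullet> x > 0"
  shows "\<exists>S c'. S \<subseteq> W \<and> independent S \<and> (\<forall>x\<in>S. c' x > 0) \<and>
    (\<Sum>x\<in>S. c' x *\<^sub>R x) = (\<Sum>x\<in>W. c x *\<^sub>R x) \<and> (\<Sum>x\<in>W. c x * obj x) \<le> (\<Sum>x\<in>S. c' x * obj x)"
  using assms
proof (induction "card W" arbitrary: W c rule: less_induct)
  case less
  have drop: ?case if d: "x0 \<in> W" "c1 x0 = 0" "\<And>x. x \<in> W \<Longrightarrow> c1 x \<ge> 0"
    "(\<Sum>x\<in>W. c1 x *\<^sub>R x) = (\<Sum>x\<in>W. c x *\<^sub>R x)" "(\<Sum>x\<in>W. c x * obj x) \<le> (\<Sum>x\<in>W. c1 x * obj x)" for x0 c1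
  proof -
    have "card (W - {x0}) < card W" using d(1) less.prems(1) by (meson card_Diff1_less)
    then have "\<exists>S c'. S \<subseteq> W - {x0} \<and> independent S \<and> (\<forall>x\<in>S. c' x > 0) \<and>
        (\<Sum>x\<in>S. c' x *\<^sub>R x) = (\<Sum>x\<in>W - {x0}. c1 x *\<^sub>R x) \<and>
        (\<Sum>x\<in>W - {x0}. c1 x * obj x) \<le> (\<Sum>x\<in>S. c' x * obj x)"
    proof (rule less.hyps)
      show "finite (W - {x0})" using less.prems(1) by simp
      show "c1 x \<ge> 0" if "x \<in> W - {x0}" for x using d(3) that by simp
      show "h \<bullet> x > 0" if "x \<in> W - {x0}" for x using less.prems(3) that by simp
    qed
    then obtain S c' where S: "S \<subseteq> W - {x0}" "independent S" "\<forall>x\<in>S. c' x > 0"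
      "(\<Sum>x\<in>S. c' x *\<^sub>R x) = (\<Sum>x\<in>W - {x0}. c1 x *\<^sub>R x)"
      "(\<Sum>x\<in>W - {x0}. c1 x * obj x) \<le> (\<Sum>x\<in>S. c' x * obj x)"
      by (elim exE conjE)
    have "(\<Sum>x\<in>W. c1 x *\<^sub>R x) = (\<Sum>x\<in>W - {x0}. c1 x *\<^sub>R x)" "(\<Sum>x\<in>W. c1 x * obj x) = (\<Sum>x\<in>W - {x0}. c1 x * obj x)"
      using d(2) by (simp_all add: sum.remove[OF less.prems(1) d(1)])
    then show ?thesis using S d by (intro exI[of _ S] exI[of _ c'] conjI) (blast, simp_all)
  qed
  have "(\<exists>x0\<in>W. c x0 = 0) \<or> (\<forall>x\<in>W. c x > 0)"
    using less.prems(2) by (force simp: less_le)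
  then consider "\<exists>x0\<in>W. c x0 = 0" | "\<forall>x\<in>W. c x > 0" "independent W" | "\<forall>x\<in>W. c x > 0" "dependent W"
    by blast
  then show ?case
  proof cases
    case 1
    then obtain x0 where "x0 \<in> W" "c x0 = 0" by blast
    then show ?thesis by (intro drop[of x0 c] less.prems(2)) auto
  next
    case 2 then show ?thesis by (intro exI[of _ W] exI[of _ c]) auto
  next
    case 3
    then obtain u0 where u0: "\<exists>v\<in>W. u0 v \<noteq> 0" "(\<Sum>v\<in>W. u0 v *\<^sub>R v) = 0"
      using dependent_finite[OF less.prems(1)] by auto
    define sg where "sg = (if (\<Sum>v\<in>W. u0 v * obj v) \<ge> 0 then 1 else (-1::real))"
    define u where "u v = sg * u0 v" for v
    have u: "\<exists>v\<in>W. u v \<noteq> 0" "(\<Sum>v\<in>W. u v *\<^sub>R v) = 0" "(\<Sum>v\<in>W. u v * obj v) \<ge> 0"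
    proof -
      show "\<exists>v\<in>W. u v \<noteq> 0" using u0(1) by (auto simp: u_def sg_def)
      have "(\<Sum>v\<in>W. u v *\<^sub>R v) = sg *\<^sub>R (\<Sum>v\<in>W. u0 v *\<^sub>R v)" by (simp add: u_def scaleR_sum_right)
      then show "(\<Sum>v\<in>W. u v *\<^sub>R v) = 0" using u0(2) by simp
      have "(\<Sum>v\<in>W. u v * obj v) = sg * (\<Sum>v\<in>W. u0 v * obj v)" by (simp add: u_def sum_distrib_left mult.assoc)
      then show "(\<Sum>v\<in>W. u v * obj v) \<ge> 0" by (auto simp: sg_def)
    qed
    define M where "M = {v\<in>W. u v < 0}"
    have "M \<noteq> {}"
    proof
      assume "M = {}"
      then have nn: "\<And>v. v \<in> W \<Longrightarrow> u v \<ge> 0" by (force simp: M_def)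
      have "(\<Sum>v\<in>W. u v * (h \<bullet> v)) = h \<bullet> (\<Sum>v\<in>W. u v *\<^sub>R v)" by (simp add: inner_sum_right)
      then have "(\<Sum>v\<in>W. u v * (h \<bullet> v)) = 0" using u(2) by simp
      moreover have "u v * (h \<bullet> v) \<ge> 0" if "v \<in> W" for v using nn less.prems(3) that by (simp add: less_imp_le)
      ultimately have "\<forall>v\<in>W. u v * (h \<bullet> v) = 0" using less.prems(1) by (simp add: sum_nonneg_eq_0_iff)
      moreover have "h \<bullet> v \<noteq> 0" if "v \<in> W" for v using less.prems(3)[OF that] by simp
      ultimately show False using u(1) by (metis mult_eq_0_iff)
    qed
    moreover have fM: "finite M" using less.prems(1) by (simp add: M_def)
    \<comment> \<open>The ratio test of the simplex method: \<open>x0\<close> is the first point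
      whose coefficient reaches zero.\<close>
    ultimately obtain x0 where "is_arg_min (\<lambda>v. c v / (- u v)) (\<lambda>v. v \<in> M) x0"
      using ex_is_arg_min_if_finite by blast
    then have x0: "x0 \<in> M" "\<And>v. v \<in> M \<Longrightarrow> c x0 / (- u x0) \<le> c v / (- u v)"
      unfolding is_arg_min_def by (blast, meson not_less)
    define t where "t = c x0 / (- u x0)"
    have xW: "x0 \<in> W" "u x0 < 0" using x0(1) by (auto simp: M_def)
    have t: "t \<ge> 0" using xW less.prems(2)[OF xW(1)] by (auto simp: t_def divide_nonneg_neg)
    show ?thesis
    proof (rule drop[of x0 "\<lambda>v. c v + t * u v"])
      show "c x0 + t * u x0 = 0" using xW by (simp add: t_def)
      show "c x + t * u x \<ge> 0" if "x \<in> W" for x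
      proof (cases "u x < 0")
        case True
        then have "t \<le> c x / (- u x)" using x0(2)[of x] that by (simp add: t_def M_def)
        then show ?thesis using True by (simp add: field_simps)
      next
        case False then show ?thesis using t less.prems(2)[OF that] by simp
      qed
      show "(\<Sum>x\<in>W. (c x + t * u x) *\<^sub>R x) = (\<Sum>x\<in>W. c x *\<^sub>R x)"
      proof -
        have "(\<Sum>x\<in>W. (c x + t * u x) *\<^sub>R x) = (\<Sum>x\<in>W. c x *\<^sub>R x) + t *\<^sub>R (\<Sum>x\<in>W. u x *\<^sub>R x)"
          by (simp add: scaleR_left_distrib sum.distrib scaleR_sum_right)
        then show ?thesis using u(2) by simp
      qed
      show "(\<Sum>x\<in>W. c x * obj x) \<le> (\<Sum>x\<in>W. (c x + t * u x) * obj x)"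
      proof -
        have "(\<Sum>x\<in>W. (c x + t * u x) * obj x) = (\<Sum>x\<in>W. c x * obj x) + t * (\<Sum>x\<in>W. u x * obj x)"
          by (simp add: distrib_right sum.distrib mult.assoc sum_distrib_left)
        then show ?thesis using u(3) t by simp
      qed
    qed (rule xW)
  qed
qed

text \<open>On the paraboloid two distributions with common mean \<open>n\<close> are compared by
  their second moments about 0, for chords by those about \<open>n\<close>. Both comparisons agree
  because the correction depends on \<open>n\<close> only.\<close>

lemma variance:
  fixes x :: "'i \<Rightarrow> 'a::real_inner"
  assumes "sum u S = 1" "(\<Sum>i\<in>S. u i *\<^sub>R x i) = n"
  shows "(\<Sum>i\<in>S. u i * (norm (x i - n))^2) = (\<Sum>i\<in>S. u i * (norm (x i))^2) - (norm n)^2"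
proof -
  have "(\<Sum>i\<in>S. u i * (norm (x i - n))^2) = (\<Sum>i\<in>S. u i * (norm (x i))^2 - 2 * ((u i *\<^sub>R x i) \<bullet> n) + u i * (norm n)^2)"
    by (intro sum.cong refl) (simp add: power2_norm_eq_inner inner_diff_left inner_diff_right inner_commute algebra_simps)
  also have "\<dots> = (\<Sum>i\<in>S. u i * (norm (x i))^2) - 2 * ((\<Sum>i\<in>S. u i *\<^sub>R x i) \<bullet> n) + sum u S * (norm n)^2"
    by (simp add: sum.distrib sum_subtractf sum_distrib_left sum_distrib_right inner_sum_left)
  finally show ?thesis using assms by (simp add: power2_norm_eq_inner)
qed

context line_algebra
begin

text \<open>A vector \<open>v\<close> stands for the line on which the inner product with
  \<open>v\<close> is 1, and 0 for the line at infinity. In this sense \<open>Pset\<close>, the open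
  polar of \<open>D1\<close>, consists of lines that miss \<open>D1\<close>.\<close>

definition Pset :: "complex set" where "Pset = {v. \<forall>x\<in>D1. x \<bullet> v < 1}"
definition Qset :: "complex set" where "Qset = {v. \<exists>x\<in>D0. x \<bullet> v = 1}"

lemma convex_Pset: "convex Pset"
  unfolding convex_def
proof (intro ballI allI impI)
  fix v v' u u' assume *: "v \<in> Pset" "v' \<in> Pset" "u \<ge> 0" "u' \<ge> 0" "u + u' = (1::real)"
  show "u *\<^sub>R v + u' *\<^sub>R v' \<in> Pset" unfolding Pset_def
  proof (intro CollectI ballI)
    fix x assume "x \<in> D1"
    then have "x \<bullet> v < 1" "x \<bullet> v' < 1" using * by (auto simp: Pset_def)
    then show "x \<bullet> (u *\<^sub>R v + u' *\<^sub>R v') < 1"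
      using convex_bound_lt[of "x \<bullet> v" 1 "x \<bullet> v'" u u'] * by (simp add: inner_add_right)
  qed
qed

lemma open_Pset: "open Pset"
proof -
  have "compact ((\<lambda>x. (x, 1::real)) ` D1)"
    by (intro compact_continuous_image continuous_intros D1)
  have *: "closed {v. \<exists>x. x \<in> D1 \<and> x \<bullet> v \<ge> 1}"
    unfolding closed_sequential_limits
  proof (intro allI impI, elim conjE)
    fix v :: "nat \<Rightarrow> complex" and l
    assume v: "\<forall>n. v n \<in> {v. \<exists>x. x \<in> D1 \<and> x \<bullet> v \<ge> 1}" and lim: "v \<longlonglongrightarrow> l"
    then obtain x where x: "\<And>n. x n \<in> D1" "\<And>n. x n \<bullet> v n \<ge> 1" by (auto, metis)
    obtain y r where y: "y \<in> D1" "strict_mono (r :: nat \<Rightarrow> nat)" "(x \<circ> r) \<longlonglongrightarrow> y"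
      using D1(1) x(1) unfolding compact_def by metis
    have "(\<lambda>n. (x \<circ> r) n \<bullet> (v \<circ> r) n) \<longlonglongrightarrow> y \<bullet> l"
      by (intro tendsto_inner y(3) LIMSEQ_subseq_LIMSEQ[OF lim y(2)])
    then have "y \<bullet> l \<ge> 1" by (rule LIMSEQ_le_const) (use x(2) in auto)
    then show "l \<in> {v. \<exists>x. x \<in> D1 \<and> x \<bullet> v \<ge> 1}" using y(1) by blast
  qed
  have "Pset = - {v. \<exists>x. x \<in> D1 \<and> x \<bullet> v \<ge> 1}" by (auto simp: Pset_def not_le)
  then show ?thesis using * by (simp add: open_closed)
qed

lemma zero_Pset: "0 \<in> Pset" by (simp add: Pset_def)

lemma disjoint_PQ: "D0 \<subseteq> D1 \<Longrightarrow> Pset \<inter> Qset = {}"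
  by (force simp: Pset_def Qset_def)

text \<open>Both pairs have the mean \<open>n\<close>, so \<open>n\<close> lies on both chords, and
  the quantities compared in \<open>ge\<close> are the products of the segments into which it cuts
  them. Exchanging \<open>l1\<close> and \<open>l2\<close> achieves the orientation that
  \<open>regular_conic\<close> needs.\<close>

lemma regular_four_points:
  assumes sub: "D0 \<subseteq> D1"
    and m: "m1 \<in> Pset" "m2 \<in> Pset" and l: "l1 \<in> Qset" "l2 \<in> Qset"
    and \<sigma>: "\<sigma>1 > 0" "\<sigma>2 > 0" "\<sigma>1 + \<sigma>2 = 1" and \<mu>: "\<mu>1 > 0" "\<mu>2 > 0" "\<mu>1 + \<mu>2 = 1"
    and n: "\<sigma>1 *\<^sub>R m1 + \<sigma>2 *\<^sub>R m2 = n" "\<mu>1 *\<^sub>R l1 + \<mu>2 *\<^sub>R l2 = n"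
    and ge: "\<sigma>1 * \<sigma>2 * (norm (m1 - m2))^2 \<ge> \<mu>1 * \<mu>2 * (norm (l1 - l2))^2"
  shows regular
proof -
  have nP: "n \<in> Pset" using convex_Pset m \<sigma> n(1) unfolding convex_def by (metis less_imp_le)
  have lne: "l1 \<noteq> l2"
  proof
    assume "l1 = l2"
    then have "n = l1" using n(2) \<mu>(3) by (metis scaleR_left_distrib scaleR_one)
    then show False using nP l disjoint_PQ[OF sub] by blast
  qed
  have "\<mu>1 * \<mu>2 * (norm (l1 - l2))^2 > 0" using lne \<mu> by simp
  then have mne: "m1 \<noteq> m2" using ge by auto
  define e where "e = (m1 - m2) /\<^sub>R norm (m1 - m2)"
  have e: "norm e = 1" using mne by (simp add: e_def)
  define a0 where "a0 = \<sigma>2 * norm (m1 - m2)"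
  define a' where "a' = \<sigma>1 * norm (m1 - m2)"
  have a: "a0 > 0" "a' > 0" using mne \<sigma> by (auto simp: a0_def a'_def)
  have s1: "\<sigma>1 = 1 - \<sigma>2" "\<mu>1 = 1 - \<mu>2" using \<sigma> \<mu> by auto
  have mm: "m1 = n + a0 *\<^sub>R e" "m2 = n - a' *\<^sub>R e"
    using mne by (simp_all add: a0_def a'_def e_def s1 n(1)[symmetric] algebra_simps)
  have main: regular
    if l: "l1 \<in> Qset" "l2 \<in> Qset" and \<mu>: "\<mu>1 > 0" "\<mu>2 > 0" "\<mu>1 + \<mu>2 = 1"
      and n2: "\<mu>1 *\<^sub>R l1 + \<mu>2 *\<^sub>R l2 = n" and lne: "l1 \<noteq> l2"
      and ge: "\<sigma>1 * \<sigma>2 * (norm (m1 - m2))^2 \<ge> \<mu>1 * \<mu>2 * (norm (l1 - l2))^2"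
      and cr: "Im (cnj e * (l1 - l2)) \<ge> 0" for l1 l2 \<mu>1 \<mu>2
  proof -
    have s1: "\<mu>1 = 1 - \<mu>2" using \<mu> by auto
    define e' where "e' = (l1 - l2) /\<^sub>R norm (l1 - l2)"
    have e': "norm e' = 1" using lne by (simp add: e'_def)
    define b where "b = \<mu>2 * norm (l1 - l2)"
    define b' where "b' = \<mu>1 * norm (l1 - l2)"
    have b: "b > 0" "b' > 0" using lne \<mu> by (auto simp: b_def b'_def)
    have ll: "l1 = n + b *\<^sub>R e'" "l2 = n - b' *\<^sub>R e'"
      using lne by (simp_all add: b_def b'_def e'_def s1 n2[symmetric] algebra_simps)
    have prod: "b * b' \<le> a0 * a'"
      using ge by (simp add: a0_def a'_def b_def b'_def power2_eq_square mult_ac)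
    have segP: "n + \<xi> *\<^sub>R e \<in> Pset" if "- a' \<le> \<xi>" "\<xi> \<le> a1" "n + a1 *\<^sub>R e \<in> Pset" "a1 > 0" for \<xi> a1
    proof -
      have eq: "n + \<xi> *\<^sub>R e = ((a' + \<xi>) / (a' + a1)) *\<^sub>R (n + a1 *\<^sub>R e) + ((a1 - \<xi>) / (a' + a1)) *\<^sub>R m2" (is "_ = ?u *\<^sub>R _ + ?v *\<^sub>R _")
      proof -
        have "?u + ?v = 1" using a that by (simp add: add_divide_distrib[symmetric])
        moreover have "?u * a1 - ?v * a' = \<xi>"
        proof -
          have "?u * a1 - ?v * a' = ((a' + \<xi>) * a1 - (a1 - \<xi>) * a') / (a' + a1)" by (simp only: diff_divide_distrib[of "(a' + \<xi>) * a1" "(a1 - \<xi>) * a'"] times_divide_eq_left)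
          also have "(a' + \<xi>) * a1 - (a1 - \<xi>) * a' = \<xi> * (a' + a1)" by algebra
          finally show ?thesis using a that by simp
        qed
        moreover have "?u *\<^sub>R (n + a1 *\<^sub>R e) + ?v *\<^sub>R m2 = (?u + ?v) *\<^sub>R n + (?u * a1 - ?v * a') *\<^sub>R e"
          unfolding mm(2) by (simp only: scaleR_add_right scaleR_diff_right scaleR_add_left scaleR_diff_left scaleR_scaleR) simp
        ultimately show ?thesis by simp
      qed
      have "?u + ?v = 1" "?u \<ge> 0" "?v \<ge> 0" using a that by (auto simp: add_divide_distrib[symmetric])
      then show ?thesis unfolding eq using convex_Pset m(2) that(3) unfolding convex_def by blast
    qed
    have seg0: "n + \<xi> *\<^sub>R e \<in> Pset" if "- a' \<le> \<xi>" "\<xi> \<le> a0" for \<xi>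
      using segP[of \<xi> a0] that m(1) mm a by simp
    \<comment> \<open>Parallel chords through \<open>n\<close> lie on one line. The inequality
      between the products then puts \<open>l1\<close> or \<open>l2\<close> on the chord from
      \<open>m1\<close> to \<open>m2\<close>, hence into \<open>Pset\<close>, which is disjoint from
      \<open>Qset\<close>.\<close>
    have cr0: "Im (cnj e * e') > 0"
    proof -
      have e'eq: "cnj e * e' = (1 / norm (l1 - l2)) *\<^sub>R (cnj e * (l1 - l2))" by (simp add: e'_def divide_inverse)
      have "Im (cnj e * e') \<ge> 0" unfolding e'eq scaleR_complex.sel using cr by (intro mult_nonneg_nonneg) auto
      moreover have "Im (cnj e * e') \<noteq> 0"
      proof
        assume "Im (cnj e * e') = 0"
        then obtain \<sigma> where \<sigma>: "\<bar>\<sigma>\<bar> = 1" "e' = of_real \<sigma> * e" using unit_cases[OF e' e] by blast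
        then have e'2: "e' = \<sigma> *\<^sub>R e" by (simp add: scaleR_conv_of_real)
        have "\<sigma> = 1 \<or> \<sigma> = -1" using \<sigma>(1) by linarith
        moreover have "b \<le> a0 \<or> b' \<le> a'" "b \<le> a' \<or> b' \<le> a0"
        proof -
          have "\<not> (b > a0 \<and> b' > a')" using prod mult_strict_mono[of a0 b a' b'] a b by linarith
          then show "b \<le> a0 \<or> b' \<le> a'" by linarith
          have "\<not> (b > a' \<and> b' > a0)" using prod mult_strict_mono[of a' b a0 b'] a b by (metis less_le_not_le mult.commute)
          then show "b \<le> a' \<or> b' \<le> a0" by linarith
        qed
        ultimately have "l1 \<in> Pset \<or> l2 \<in> Pset"
          using seg0[of b] seg0[of "- b"] seg0[of b'] seg0[of "- b'"] a b unfolding ll e'2 by auto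
        then show False using l disjoint_PQ[OF sub] by blast
      qed
      ultimately show ?thesis by simp
    qed
    \<comment> \<open>Since \<open>Pset\<close> is open, the chord can be prolonged beyond
      \<open>m1\<close>; this makes the weak inequality between the products strict.\<close>
    obtain a1 where a1: "a1 > a0" "n + a1 *\<^sub>R e \<in> Pset"
    proof -
      obtain \<epsilon> where \<epsilon>: "\<epsilon> > 0" "ball m1 \<epsilon> \<subseteq> Pset" using open_Pset m(1) open_contains_ball by blast
      have "n + (a0 + \<epsilon>/2) *\<^sub>R e = m1 + (\<epsilon>/2) *\<^sub>R e" by (simp add: mm(1) scaleR_add_left)
      moreover have "m1 + (\<epsilon>/2) *\<^sub>R e \<in> ball m1 \<epsilon>" using e \<epsilon>(1) by (simp add: dist_norm)
      ultimately show ?thesis using that[of "a0 + \<epsilon>/2"] \<epsilon> by auto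
    qed
    obtain x1 where x1: "x1 \<in> D0" "x1 \<bullet> l1 = 1" using l(1) by (auto simp: Qset_def)
    obtain x2 where x2: "x2 \<in> D0" "x2 \<bullet> l2 = 1" using l(2) by (auto simp: Qset_def)
    have nlt: "x \<bullet> n < 1" if "x \<in> D0" for x using nP that sub by (auto simp: Pset_def)
    have c1: "b * (x1 \<bullet> e') > 0" using x1 nlt[OF x1(1)] by (simp add: ll inner_add_right)
    have c2: "b' * (x2 \<bullet> e') < 0" using x2 nlt[OF x2(1)] by (simp add: ll inner_diff_right)
    have x1e: "x1 \<bullet> e' > 0" using c1 b by (simp add: zero_less_mult_iff)
    have x2e: "x2 \<bullet> e' < 0" using c2 b by (simp add: mult_less_0_iff)
    have conn: "connected D0" using D0(2) by (rule convex_connected)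
    \<comment> \<open>\<open>D0\<close> has points on both sides of the line through 0 orthogonal to
      \<open>e'\<close>, hence a point \<open>x3\<close> on it. There the inner product with n +
      \<eta> e' is below 1 for every \<eta>, while beyond \<open>l1\<close> or \<open>l2\<close> it
      is at least 1 at \<open>x1\<close> or \<open>x2\<close>. By connectedness it takes the value 1
      on \<open>D0\<close>.\<close>
    obtain x3 where x3: "x3 \<in> D0" "x3 \<bullet> e' = 0"
      using connected_ivt_hyperplane[OF conn x2(1) x1(1), of e' 0] x1e x2e by (auto simp: inner_commute)
    show ?thesis
    proof (rule regular_conic[OF e e' cr0, of a1 a' b b' n])
      show "a1 > 0" "a' > 0" "b > 0" "b' > 0" using a b a1 by auto
      have "a0 * a' < a1 * a'" using a1 a by simp
      then show "b * b' < a1 * a'" using prod by linarith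
      show "x \<bullet> (n + \<xi> *\<^sub>R e) < 1" if "- a' \<le> \<xi>" "\<xi> \<le> a1" "x \<in> D1" for \<xi> x
        using segP[of \<xi> a1] that a1 a by (auto simp: Pset_def)
      show "\<exists>x\<in>D0. x \<bullet> e' = 0" using x3 by blast
      fix \<eta> assume \<eta>: "b \<le> \<eta> \<or> \<eta> \<le> - b'"
      have lo: "(n + \<eta> *\<^sub>R e') \<bullet> x3 \<le> 1" using nlt[OF x3(1)] x3(2) by (simp add: inner_commute[of _ x3] inner_add_right)
      from \<eta> have "\<exists>x\<in>D0. (n + \<eta> *\<^sub>R e') \<bullet> x \<ge> 1"
      proof
        assume "b \<le> \<eta>"
        then have "b * (x1 \<bullet> e') \<le> \<eta> * (x1 \<bullet> e')" using x1e by simp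
        then have "(n + \<eta> *\<^sub>R e') \<bullet> x1 \<ge> 1" using x1(2) by (simp add: ll inner_commute[of _ x1] inner_add_right)
        then show ?thesis using x1(1) by blast
      next
        assume "\<eta> \<le> - b'"
        then have "\<eta> * (x2 \<bullet> e') \<ge> (- b') * (x2 \<bullet> e')" using x2e by (intro mult_right_mono_neg) auto
        then have "(n + \<eta> *\<^sub>R e') \<bullet> x2 \<ge> 1" using x2(2) by (simp add: ll inner_commute[of _ x2] inner_add_right inner_diff_right)
        then show ?thesis using x2(1) by blast
      qed
      then obtain x where x: "x \<in> D0" "(n + \<eta> *\<^sub>R e') \<bullet> x \<ge> 1" by blast
      show "\<exists>x\<in>D0. x \<bullet> (n + \<eta> *\<^sub>R e') = 1"
        using connected_ivt_hyperplane[OF conn x3(1) x(1) lo x(2)] by (auto simp: inner_commute)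
    qed
  qed
  show ?thesis
  proof (cases "Im (cnj e * (l1 - l2)) \<ge> 0")
    case True then show ?thesis using main[OF l \<mu> n(2) lne ge] by blast
  next
    case False
    have "Im (cnj e * (l2 - l1)) = - Im (cnj e * (l1 - l2))" by (simp add: algebra_simps)
    then have "Im (cnj e * (l2 - l1)) \<ge> 0" using False by simp
    moreover have "\<mu>2 + \<mu>1 = 1" "\<mu>2 *\<^sub>R l2 + \<mu>1 *\<^sub>R l1 = n" using \<mu>(3) n(2) by (simp_all add: add.commute)
    moreover have "\<mu>2 * \<mu>1 * (norm (l2 - l1))^2 \<le> \<sigma>1 * \<sigma>2 * (norm (m1 - m2))^2"
      using ge by (simp only: norm_minus_commute[of l2 l1] mult.commute[of \<mu>2 \<mu>1])
    ultimately show ?thesis using main[OF l(2,1) \<mu>(2,1)] lne by blast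
  qed
qed

lemma D0_nonzero: obtains x where "x \<in> D0" "x \<noteq> 0"
proof -
  obtain y where y: "y \<in> D0" using D0(3) by blast
  then obtain \<epsilon> where \<epsilon>: "\<epsilon> > 0" "ball y \<epsilon> \<subseteq> D0" using D0(1) open_contains_ball by blast
  have "y + of_real (\<epsilon>/2) \<in> ball y \<epsilon>" using \<epsilon>(1) by (simp add: dist_norm)
  then have "y + of_real (\<epsilon>/2) \<in> D0" using \<epsilon>(2) by blast
  then show thesis using that[of y] that[of "y + of_real (\<epsilon>/2)"] y \<epsilon>(1) by (cases "y = 0") auto
qed

lemma Qset_nonempty: "Qset \<noteq> {}"
proof -
  obtain x where x: "x \<in> D0" "x \<noteq> 0" by (rule D0_nonzero)
  then have "x /\<^sub>R (norm x)^2 \<in> Qset" unfolding Qset_def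
    by (auto intro!: bexI[of _ x] simp: power2_norm_eq_inner)
  then show ?thesis by blast
qed

definition lift :: "complex \<Rightarrow> complex \<times> real" where "lift v = (v, (norm v)^2)"

text \<open>If the paraboloid lifts of the two sets cannot be separated, a basic solution yields two
  points of each set as in \<open>regular_four_points\<close>: its support has at most four elements.\<close>

lemma regular_if_lifts_meet:
  assumes sub: "D0 \<subseteq> D1" and q: "q \<in> convex hull (lift ` Pset)" "q \<in> convex hull (lift ` Qset)"
  shows regular
proof -
  have hull: "\<exists>S u. finite S \<and> S \<subseteq> Z \<and> (\<forall>x\<in>S. 0 \<le> u x) \<and> sum u S = 1 \<and> (\<Sum>v\<in>S. u v *\<^sub>R v) = fst q
      \<and> (\<Sum>v\<in>S. u v * (norm v)^2) = snd q" if qz: "q \<in> convex hull (lift ` Z)" for Z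
  proof -
    obtain S u where S: "finite S" "S \<subseteq> lift ` Z" "\<forall>x\<in>S. 0 \<le> u x" "sum u S = 1" "(\<Sum>v\<in>S. u v *\<^sub>R v) = q"
      using qz unfolding convex_hull_explicit by blast
    have l: "lift (fst x) = x" if "x \<in> S" for x using S(2) that by (auto simp: lift_def)
    then have inj: "inj_on fst S" by (rule inj_on_inverseI)
    have "(\<Sum>v\<in>fst ` S. u (lift v) *\<^sub>R v) = (\<Sum>v\<in>S. u v *\<^sub>R fst v)"
      by (simp add: sum.reindex[OF inj] l)
    also have "\<dots> = fst q" unfolding S(5)[symmetric] by (simp add: fst_sum)
    finally have 1: "(\<Sum>v\<in>fst ` S. u (lift v) *\<^sub>R v) = fst q" .
    have "(\<Sum>v\<in>fst ` S. u (lift v) * (norm v)^2) = (\<Sum>v\<in>S. u v * (norm (fst v))^2)"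
      by (simp add: sum.reindex[OF inj] l)
    also have "\<dots> = (\<Sum>v\<in>S. u v * snd v)"
      by (intro sum.cong refl) (metis l lift_def snd_conv)
    also have "\<dots> = snd q" unfolding S(5)[symmetric] by (simp add: snd_sum)
    finally have 2: "(\<Sum>v\<in>fst ` S. u (lift v) * (norm v)^2) = snd q" .
    have 3: "sum (\<lambda>v. u (lift v)) (fst ` S) = 1" using S(4) by (simp add: sum.reindex[OF inj] l)
    have "fst ` S \<subseteq> Z" using S(2) by (auto simp: lift_def)
    then show ?thesis using 1 2 3 S(1,3) l
      by (intro exI[of _ "fst ` S"] exI[of _ "\<lambda>v. u (lift v)"]) auto
  qed
  obtain A u where A: "finite A" "A \<subseteq> Pset" "\<And>x. x \<in> A \<Longrightarrow> 0 \<le> u x" "sum u A = 1" "(\<Sum>v\<in>A. u v *\<^sub>R v) = fst q"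
      "(\<Sum>v\<in>A. u v * (norm v)^2) = snd q" using hull[OF q(1)] by blast
  obtain B t where B: "finite B" "B \<subseteq> Qset" "\<And>x. x \<in> B \<Longrightarrow> 0 \<le> t x" "sum t B = 1" "(\<Sum>v\<in>B. t v *\<^sub>R v) = fst q"
      "(\<Sum>v\<in>B. t v * (norm v)^2) = snd q" using hull[OF q(2)] by blast
  \<comment> \<open>One column per point: the first two entries record the total weights of the two
    convex combinations, the last one the difference of their means. The columns live in real
    dimension 4, which bounds the support of a basic solution. The objective \<open>obj\<close> is
    the difference of the second moments.\<close>
  define i1 where "i1 v = (1::real, 0::real, v)" for v :: complex
  define i2 where "i2 v = (0::real, 1::real, - v)" for v :: complex
  define W where "W = i1 ` A \<union> i2 ` B"
  define c where "c x = (if fst x = 1 then u (snd (snd x)) else t (- snd (snd x)))" for x :: "real \<times> real \<times> complex"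
  define obj where "obj x = (fst x - fst (snd x)) * (norm (snd (snd x)))^2" for x :: "real \<times> real \<times> complex"
  have inj: "inj i1" "inj i2" by (auto simp: inj_def i1_def i2_def)
  have split: "(\<Sum>x\<in>i1 ` A' \<union> i2 ` B'. g x) = (\<Sum>v\<in>A'. g (i1 v)) + (\<Sum>v\<in>B'. g (i2 v))"
    if "finite A'" "finite B'" for A' B' and g :: "real \<times> real \<times> complex \<Rightarrow> 'd::comm_monoid_add"
  proof -
    have "i1 ` A' \<inter> i2 ` B' = {}" by (auto simp: i1_def i2_def)
    then show ?thesis using that
      by (simp add: sum.union_disjoint sum.reindex[OF inj_on_subset[OF inj(1) subset_UNIV]]
          sum.reindex[OF inj_on_subset[OF inj(2) subset_UNIV]])
  qed
  have "finite W" "\<And>x. x \<in> W \<Longrightarrow> c x \<ge> 0" "\<And>x. x \<in> W \<Longrightarrow> (1, 1, 0) \<bullet> x > 0"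
    using A B by (auto simp: W_def c_def i1_def i2_def)
  then obtain S c' where S: "S \<subseteq> W" "independent S" "\<forall>x\<in>S. c' x > 0"
    "(\<Sum>x\<in>S. c' x *\<^sub>R x) = (\<Sum>x\<in>W. c x *\<^sub>R x)" "(\<Sum>x\<in>W. c x * obj x) \<le> (\<Sum>x\<in>S. c' x * obj x)"
    using linear_program_basic_solution[of W c "(1, 1, 0)" obj] by blast
  define Sm where "Sm = {v\<in>A. i1 v \<in> S}"
  define Sl where "Sl = {v\<in>B. i2 v \<in> S}"
  have Seq: "S = i1 ` Sm \<union> i2 ` Sl" using S(1) by (auto simp: Sm_def Sl_def W_def)
  have fin: "finite Sm" "finite Sl" using A(1) B(1) by (auto simp: Sm_def Sl_def)
  define \<sigma> where "\<sigma> v = c' (i1 v)" for v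
  define \<mu> where "\<mu> v = c' (i2 v)" for v
  have pos: "\<And>v. v \<in> Sm \<Longrightarrow> \<sigma> v > 0" "\<And>v. v \<in> Sl \<Longrightarrow> \<mu> v > 0"
    using S(3) by (auto simp: Sm_def Sl_def \<sigma>_def \<mu>_def)
  have "(\<Sum>x\<in>W. c x *\<^sub>R x) = (\<Sum>v\<in>A. u v *\<^sub>R i1 v) + (\<Sum>v\<in>B. t v *\<^sub>R i2 v)"
    unfolding W_def split[OF A(1) B(1)] by (simp add: c_def i1_def i2_def)
  also have "\<dots> = (sum u A, sum t B, (\<Sum>v\<in>A. u v *\<^sub>R v) - (\<Sum>v\<in>B. t v *\<^sub>R v))"
    by (simp add: i1_def i2_def prod_eq_iff fst_sum snd_sum sum_negf)
  finally have W1: "(\<Sum>x\<in>W. c x *\<^sub>R x) = (1, 1, 0)" using A B by simp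
  have "(\<Sum>x\<in>S. c' x *\<^sub>R x) = (\<Sum>v\<in>Sm. \<sigma> v *\<^sub>R i1 v) + (\<Sum>v\<in>Sl. \<mu> v *\<^sub>R i2 v)"
    unfolding Seq split[OF fin] by (simp add: \<sigma>_def \<mu>_def)
  also have "\<dots> = (sum \<sigma> Sm, sum \<mu> Sl, (\<Sum>v\<in>Sm. \<sigma> v *\<^sub>R v) - (\<Sum>v\<in>Sl. \<mu> v *\<^sub>R v))"
    by (simp add: i1_def i2_def prod_eq_iff fst_sum snd_sum sum_negf)
  finally have sums: "sum \<sigma> Sm = 1" "sum \<mu> Sl = 1" "(\<Sum>v\<in>Sm. \<sigma> v *\<^sub>R v) = (\<Sum>v\<in>Sl. \<mu> v *\<^sub>R v)"
    using S(4) W1 by auto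
  have "(\<Sum>x\<in>W. c x * obj x) = (\<Sum>v\<in>A. u v * (norm v)^2) - (\<Sum>v\<in>B. t v * (norm v)^2)"
    unfolding W_def split[OF A(1) B(1)] by (simp add: c_def i1_def i2_def obj_def sum_negf)
  then have "0 \<le> (\<Sum>x\<in>S. c' x * obj x)" using S(5) A B by simp
  also have "\<dots> = (\<Sum>v\<in>Sm. \<sigma> v * (norm v)^2) - (\<Sum>v\<in>Sl. \<mu> v * (norm v)^2)"
    unfolding Seq split[OF fin] by (simp add: \<sigma>_def \<mu>_def i1_def i2_def obj_def sum_negf)
  finally have sq: "(\<Sum>v\<in>Sl. \<mu> v * (norm v)^2) \<le> (\<Sum>v\<in>Sm. \<sigma> v * (norm v)^2)" by simp
  define n where "n = (\<Sum>v\<in>Sm. \<sigma> v *\<^sub>R v)"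
  have SmP: "Sm \<subseteq> Pset" "Sl \<subseteq> Qset" using A(2) B(2) by (auto simp: Sm_def Sl_def)
  have nP: "n \<in> Pset" unfolding n_def
    using SmP sums(1) pos(1) by (intro convex_sum[OF fin(1) convex_Pset]) (auto simp: less_imp_le)
  have var: "(\<Sum>v\<in>Sl. \<mu> v * (norm (v - n))^2) \<le> (\<Sum>v\<in>Sm. \<sigma> v * (norm (v - n))^2)"
    using variance[of \<sigma> Sm "\<lambda>v. v" n] variance[of \<mu> Sl "\<lambda>v. v" n] sums sq by (simp add: n_def)
  have disj: "v \<notin> Qset" if "v \<in> Pset" for v using disjoint_PQ[OF sub] that by blast
  have "card S \<le> 4" using independent_bound[OF S(2)] by simp
  moreover have "card S = card Sm + card Sl"
    using split[OF fin, of "\<lambda>_. 1::nat"] by (simp add: Seq)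
  ultimately have card: "card Sm + card Sl \<le> 4" by simp
  have c0: "card Sm \<noteq> 0" "card Sl \<noteq> 0" using sums fin by auto
  \<comment> \<open>A single point of \<open>Pset\<close> has no spread about \<open>n\<close>. Then
    the points of \<open>Qset\<close> have none either and would all equal \<open>n\<close>, which
    lies in \<open>Pset\<close>.\<close>
  have c1: "card Sm \<noteq> 1"
  proof
    assume "card Sm = 1"
    then obtain m where m: "Sm = {m}" by (auto simp: card_1_singleton_iff)
    then have "n = m" using sums(1) by (simp add: n_def)
    then have "(\<Sum>v\<in>Sl. \<mu> v * (norm (v - n))^2) \<le> 0" using var m by simp
    then have "(\<Sum>v\<in>Sl. \<mu> v * (norm (v - n))^2) = 0"
      using pos(2) by (intro antisym sum_nonneg) (auto simp: less_imp_le)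
    then have "\<forall>v\<in>Sl. \<mu> v * (norm (v - n))^2 = 0"
      using pos(2) fin by (subst (asm) sum_nonneg_eq_0_iff) (auto simp: less_imp_le)
    then have "\<forall>v\<in>Sl. v = n" using pos(2) by force
    then show False using c0(2) SmP(2) disj[OF nP] by (metis card.empty equals0I subsetD)
  qed
  have c2: "card Sl \<noteq> 1"
  proof
    assume "card Sl = 1"
    then obtain l where l: "Sl = {l}" by (auto simp: card_1_singleton_iff)
    then have "n = l" using sums by (simp add: n_def)
    then show False using SmP(2) l disj[OF nP] by auto
  qed
  have "card Sm = 2" "card Sl = 2" using card c0 c1 c2 by auto
  then obtain m1 m2 l1 l2 where ml: "Sm = {m1, m2}" "m1 \<noteq> m2" "Sl = {l1, l2}" "l1 \<noteq> l2"
    by (auto simp: card_2_iff)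
  \<comment> \<open>For two points the second moment about the mean is the product of the two
    segments of the chord, so \<open>var\<close> becomes the inequality of
    \<open>regular_four_points\<close>.\<close>
  have two: "s1 * (norm (x1 - n))^2 + s2 * (norm (x2 - n))^2 = s1 * s2 * (norm (x1 - x2))^2"
    if "s1 + s2 = 1" "s1 *\<^sub>R x1 + s2 *\<^sub>R x2 = n" for s1 s2 :: real and x1 x2
  proof -
    have s: "s1 = 1 - s2" using that(1) by simp
    have d: "x1 - n = s2 *\<^sub>R (x1 - x2)" "x2 - n = - (s1 *\<^sub>R (x1 - x2))"
      unfolding that(2)[symmetric] s by (simp_all add: algebra_simps)
    have "s1 * (norm (x1 - n))^2 + s2 * (norm (x2 - n))^2 = s1 * s2 * (s1 + s2) * (norm (x1 - x2))^2"
      unfolding d norm_minus_cancel norm_scaleR power_mult_distrib power2_abs by algebra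
    then show ?thesis using that(1) by simp
  qed
  have sg: "\<sigma> m1 + \<sigma> m2 = 1" "\<sigma> m1 *\<^sub>R m1 + \<sigma> m2 *\<^sub>R m2 = n" "\<mu> l1 + \<mu> l2 = 1" "\<mu> l1 *\<^sub>R l1 + \<mu> l2 *\<^sub>R l2 = n"
    using sums ml by (simp_all add: n_def)
  show ?thesis
  proof (rule regular_four_points[OF sub _ _ _ _ _ _ sg(1) _ _ sg(3,2,4)])
    show "\<mu> l1 * \<mu> l2 * (norm (l1 - l2))^2 \<le> \<sigma> m1 * \<sigma> m2 * (norm (m1 - m2))^2"
      using var two[OF sg(1,2)] two[OF sg(3,4)] ml by simp
  qed (use SmP pos ml in auto)
qed

text \<open>The ellipse is the polar of a disc, so it has a focus at the origin.\<close>

lemma ellipse_if_not_regular: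
  assumes nreg: "\<not> regular"
  shows "\<exists>v0 r. norm v0 < r \<and> D0 \<subseteq> {x. v0 \<bullet> x + r * norm x \<le> 1} \<and> {x. v0 \<bullet> x + r * norm x \<le> 1} \<subseteq> D1"
proof -
  have D1_0: "0 \<in> D1" using regular_if_0_notin nreg by blast
  have sub: "D0 \<subseteq> D1" using regular_if_not_subset nreg by blast
  have "convex hull (lift ` Pset) \<inter> convex hull (lift ` Qset) = {}"
    using regular_if_lifts_meet[OF sub] nreg by blast
  then obtain a \<alpha> where a: "a \<noteq> 0" "\<And>x. x \<in> convex hull (lift ` Pset) \<Longrightarrow> a \<bullet> x \<le> \<alpha>"
      "\<And>x. x \<in> convex hull (lift ` Qset) \<Longrightarrow> a \<bullet> x \<ge> \<alpha>"
  proof -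
    have "convex hull (lift ` Pset) \<noteq> {}" "convex hull (lift ` Qset) \<noteq> {}" using Qset_nonempty zero_Pset by auto
    from separating_hyperplane_sets[OF convex_convex_hull convex_convex_hull this
        \<open>convex hull (lift ` Pset) \<inter> convex hull (lift ` Qset) = {}\<close>]
    show ?thesis using that by blast
  qed
  define c where "c = fst a"
  define \<rho> where "\<rho> = snd a"
  have P: "c \<bullet> v + \<rho> * (norm v)^2 \<le> \<alpha>" if "v \<in> Pset" for v
    using a(2)[of "lift v"] that hull_inc[of "lift v" "lift ` Pset" convex]
    by (cases a) (auto simp: c_def \<rho>_def lift_def)
  have Q: "c \<bullet> v + \<rho> * (norm v)^2 \<ge> \<alpha>" if "v \<in> Qset" for v
    using a(3)[of "lift v"] that hull_inc[of "lift v" "lift ` Qset" convex]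
    by (cases a) (auto simp: c_def \<rho>_def lift_def)
  have \<alpha>0: "\<alpha> \<ge> 0" using P[OF zero_Pset] by simp
  have ortho: "x \<bullet> (\<i> * x) = 0" for x by (simp add: inner_complex_def)
  \<comment> \<open>The dual points of the lines through a nonzero \<open>x\<close> in
    \<open>D0\<close> fill a line. It is parametrized here from its point nearest to 0, and the
    separating function is bounded below along all of it.\<close>
  have line: "c \<bullet> (x /\<^sub>R (norm x)^2) + t * (c \<bullet> (\<i> * x)) + \<rho> * (inverse ((norm x)^2) + t^2 * (norm x)^2) \<ge> \<alpha>"
    if x: "x \<in> D0" "x \<noteq> 0" for x t
  proof -
    let ?v = "x /\<^sub>R (norm x)^2 + t *\<^sub>R (\<i> * x)"
    have "x \<bullet> ?v = 1" using x(2) by (simp add: inner_add_right ortho power2_norm_eq_inner)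
    then have 1: "?v \<in> Qset" using x(1) by (auto simp: Qset_def)
    have "(norm ?v)^2 = (norm (x /\<^sub>R (norm x)^2))^2 + (norm (t *\<^sub>R (\<i> * x)))^2"
      by (rule norm_add_Pythagorean) (simp add: orthogonal_def ortho)
    also have "\<dots> = inverse ((norm x)^2) + t^2 * (norm x)^2"
      using x(2) by (simp add: norm_mult power_mult_distrib power2_eq_square field_simps)
    finally show ?thesis using Q[OF 1] by (simp only: inner_add_right inner_scaleR_right add.assoc)
  qed
  obtain x0 where x0: "x0 \<in> D0" "x0 \<noteq> 0" by (rule D0_nonzero)
  \<comment> \<open>The separating plane is neither vertical nor upside down. For \<rho> < 0 the
    bound of \<open>line\<close> fails far out. For \<rho> = 0 the vector \<open>c\<close> would be
    orthogonal to i x for all \<open>x\<close> in the open set \<open>D0\<close>, so it would be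
    0.\<close>
  have \<rho>pos: "\<rho> > 0"
  proof (rule ccontr)
    assume "\<not> \<rho> > 0"
    then consider "\<rho> < 0" | "\<rho> = 0" by linarith
    then show False
    proof cases
      case 1
      define M where "M = c \<bullet> (x0 /\<^sub>R (norm x0)^2) + \<rho> * inverse ((norm x0)^2)"
      have "M + t^2 * (\<rho> * (norm x0)^2) \<ge> \<alpha>" for t
        using line[OF x0, of t] line[OF x0, of "- t"] by (simp add: M_def algebra_simps)
      moreover have k: "\<rho> * (norm x0)^2 < 0" using 1 x0 by (simp add: mult_neg_pos)
      moreover define t where "t = sqrt ((\<bar>M\<bar> + 1) / (- (\<rho> * (norm x0)^2)))"
      ultimately have "M + t^2 * (\<rho> * (norm x0)^2) \<ge> \<alpha>" by blast
      moreover have "(\<bar>M\<bar> + 1) / (- (\<rho> * (norm x0)^2)) \<ge> 0" using k by (intro divide_nonneg_pos) auto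
      then have "t^2 = (\<bar>M\<bar> + 1) / (- (\<rho> * (norm x0)^2))" by (simp add: t_def)
      then have "t^2 * (\<rho> * (norm x0)^2) = - (\<bar>M\<bar> + 1)" using k 1 x0(2) by (simp add: field_simps)
      ultimately show False using \<alpha>0 by linarith
    next
      case 2
      have perp: "c \<bullet> (\<i> * x) = 0" if x: "x \<in> D0" for x
      proof (cases "x = 0")
        case False
        define M where "M = c \<bullet> (x /\<^sub>R (norm x)^2)"
        show ?thesis
        proof (rule ccontr)
          assume ne: "c \<bullet> (\<i> * x) \<noteq> 0"
          have "M + s * (c \<bullet> (\<i> * x)) \<ge> \<alpha>" for s
            using line[OF x False, of s] 2 by (simp add: M_def)
          from this[of "- (\<bar>M\<bar> + 1) / (c \<bullet> (\<i> * x))"]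
          have "M - (\<bar>M\<bar> + 1) \<ge> \<alpha>" using ne by simp
          then show False using \<alpha>0 by linarith
        qed
      qed simp
      obtain \<epsilon> where \<epsilon>: "\<epsilon> > 0" "ball x0 \<epsilon> \<subseteq> D0" using D0(1) x0 open_contains_ball by blast
      have "c = 0"
      proof (rule ccontr)
        assume c: "c \<noteq> 0"
        define \<delta> where "\<delta> = \<epsilon> / (2 * norm c)"
        have \<delta>: "\<delta> > 0" using c \<epsilon> by (simp add: \<delta>_def)
        have "x0 + \<delta> *\<^sub>R (- \<i> * c) \<in> ball x0 \<epsilon>" using \<epsilon>(1) c by (simp add: dist_norm norm_mult \<delta>_def)
        then have "c \<bullet> (\<i> * (x0 + \<delta> *\<^sub>R (- \<i> * c))) = 0" using perp \<epsilon>(2) by blast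
        moreover have "\<i> * (x0 + \<delta> *\<^sub>R (- \<i> * c)) = \<i> * x0 + \<delta> *\<^sub>R c" by (simp add: algebra_simps)
        ultimately have "\<delta> * (c \<bullet> c) = 0" using perp[OF x0(1)] by (simp add: inner_add_right)
        then show False using \<delta> c by simp
      qed
      then show False using a(1) 2 by (simp add: c_def \<rho>_def prod_eq_iff)
    qed
  qed
  have \<alpha>pos: "\<alpha> > 0"
  proof -
    obtain \<epsilon> where \<epsilon>: "\<epsilon> > 0" "ball 0 \<epsilon> \<subseteq> Pset" using open_Pset zero_Pset open_contains_ball by blast
    have v: "of_real (\<epsilon>/2) \<in> Pset" "- of_real (\<epsilon>/2) \<in> Pset" using \<epsilon> by (auto simp: subset_iff)
    have "2 * (\<rho> * (\<epsilon>/2)^2) \<le> 2 * \<alpha>" using P[OF v(1)] P[OF v(2)] \<epsilon>(1) by simp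
    moreover have "\<rho> * (\<epsilon>/2)^2 > 0" using \<rho>pos \<epsilon>(1) by simp
    ultimately show ?thesis by linarith
  qed
  \<comment> \<open>Completing the square turns the separating function into the disc with centre
    \<open>v0\<close> and radius \<open>r\<close>. Since \<alpha> > 0, the origin is interior to the
    disc, which is \<open>norm v0 < r\<close>.\<close>
  define v0 where "v0 = - (c /\<^sub>R (2 * \<rho>))"
  define r where "r = sqrt (\<alpha> / \<rho> + (norm v0)^2)"
  have r2: "r^2 = \<alpha> / \<rho> + (norm v0)^2" using \<alpha>pos \<rho>pos by (simp add: r_def)
  have r0: "r \<ge> 0" by (simp add: r_def \<alpha>pos \<rho>pos less_imp_le)
  have "(norm v0)^2 < r^2" using r2 \<alpha>pos \<rho>pos by simp
  then have rv: "norm v0 < r" using r0 by (rule power2_less_imp_less)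
  have sq: "\<rho> * (norm (v - v0))^2 = c \<bullet> v + \<rho> * (norm v)^2 + \<rho> * (norm v0)^2" for v
  proof -
    have N: "(norm (v - v0))^2 = (norm v)^2 - 2 * (v0 \<bullet> v) + (norm v0)^2"
      by (simp add: power2_norm_eq_inner inner_diff_left inner_diff_right inner_commute)
    moreover have "\<rho> * (2 * (v0 \<bullet> v)) = - (c \<bullet> v)" using \<rho>pos by (simp add: v0_def field_simps)
    moreover have "\<rho> * (norm (v - v0))^2 = \<rho> * (norm v)^2 - \<rho> * (2 * (v0 \<bullet> v)) + \<rho> * (norm v0)^2"
      unfolding N by (simp only: distrib_left right_diff_distrib)
    ultimately show ?thesis by linarith
  qed
  have r2': "\<rho> * r^2 = \<alpha> + \<rho> * (norm v0)^2" using r2 \<rho>pos by (simp add: field_simps)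
  have Pd: "norm (v - v0) \<le> r" if "v \<in> Pset" for v
  proof -
    have "\<rho> * (norm (v - v0))^2 \<le> \<rho> * r^2" using P[OF that] unfolding sq r2' by simp
    then have "(norm (v - v0))^2 \<le> r^2" using \<rho>pos by simp
    then show ?thesis using r0 by (rule power2_le_imp_le)
  qed
  have Qd: "norm (v - v0) \<ge> r" if "v \<in> Qset" for v
  proof -
    have "\<rho> * (norm (v - v0))^2 \<ge> \<rho> * r^2" using Q[OF that] unfolding sq r2' by simp
    then have "r^2 \<le> (norm (v - v0))^2" using \<rho>pos by simp
    then show ?thesis by (rule power2_le_imp_le) simp
  qed
  have "D0 \<subseteq> {x. v0 \<bullet> x + r * norm x \<le> 1}"
  proof (intro subsetI CollectI)
    fix x assume x: "x \<in> D0"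
    show "v0 \<bullet> x + r * norm x \<le> 1"
    proof (cases "x = 0")
      case False
      \<comment> \<open>Among the dual points of the lines through \<open>x\<close> this is the one
        closest to the centre \<open>v0\<close>; being in \<open>Qset\<close>, it is not interior to
        the disc.\<close>
      define v where "v = v0 + ((1 - v0 \<bullet> x) / (norm x)^2) *\<^sub>R x"
      have "x \<bullet> v = 1" using False by (simp add: v_def inner_add_right power2_norm_eq_inner inner_commute)
      then have "r \<le> norm (v - v0)" using Qd x by (auto simp: Qset_def)
      also have "norm (v - v0) = \<bar>1 - v0 \<bullet> x\<bar> / norm x"
        using False by (simp add: v_def power2_eq_square)
      finally have h: "r * norm x \<le> \<bar>1 - v0 \<bullet> x\<bar>" using False by (simp add: field_simps)
      show ?thesis
      proof (cases "1 - v0 \<bullet> x \<ge> 0")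
        case True then show ?thesis using h by simp
      next
        case neg: False
        have "v0 \<bullet> x \<le> norm v0 * norm x" by (rule norm_cauchy_schwarz)
        also have "\<dots> \<le> r * norm x" using rv by (intro mult_right_mono) auto
        finally show ?thesis using h neg by simp
      qed
    qed simp
  qed
  \<comment> \<open>A bipolar argument: a point outside \<open>D1\<close> is cut off by some
    \<open>v\<close> in \<open>Pset\<close>, hence in the disc. The normalization to level 1 uses
    that 0 is in \<open>D1\<close>, so that \<beta> is negative.\<close>
  moreover have "{x. v0 \<bullet> x + r * norm x \<le> 1} \<subseteq> D1"
  proof (rule subsetI, rule ccontr)
    fix x assume x: "x \<in> {x. v0 \<bullet> x + r * norm x \<le> 1}" "x \<notin> D1"
    obtain b \<beta> where b: "b \<bullet> x < \<beta>" "\<And>y. y \<in> D1 \<Longrightarrow> b \<bullet> y > \<beta>"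
      using separating_hyperplane_closed_point[OF D1(2) compact_imp_closed[OF D1(1)] x(2)] by metis
    have \<beta>: "\<beta> < 0" using b(2)[OF D1_0] by simp
    define v where "v = b /\<^sub>R \<beta>"
    have "y \<bullet> v < 1" if "y \<in> D1" for y
      using b(2)[OF that] \<beta> by (simp add: v_def inner_commute divide_inverse[symmetric] mult.commute[of "inverse _"] divide_less_eq)
    then have "v \<in> Pset" by (simp add: Pset_def)
    then have "norm (v - v0) \<le> r" by (rule Pd)
    have "x \<bullet> v > 1"
      using b(1) \<beta> by (simp add: v_def inner_commute divide_inverse[symmetric] mult.commute[of "inverse _"] less_divide_eq)
    moreover have "x \<bullet> v = v0 \<bullet> x + (v - v0) \<bullet> x" by (simp add: inner_diff_left inner_commute[of x])
    moreover have "(v - v0) \<bullet> x \<le> norm (v - v0) * norm x" by (rule norm_cauchy_schwarz)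
    moreover have "norm (v - v0) * norm x \<le> r * norm x" using \<open>norm (v - v0) \<le> r\<close> by (intro mult_right_mono) auto
    ultimately show False using x(1) by simp
  qed
  ultimately show ?thesis using rv by blast
qed

end

section \<open>The functional of a function with vanishing Radon transform\<close>

text \<open>A pair \<open>(t, s)\<close> stands for the line with normal \<open>cis t\<close> at
  signed distance \<open>s\<close>. The rules multiply by \<open>w\<close> or \<open>f\<close> only,
  so that inductions can accumulate these factors in a monomial; closure under products is
  derived.\<close>

inductive_set trig_poly :: "(real \<times> real \<Rightarrow> complex) set" where
  const: "(\<lambda>_. c) \<in> trig_poly"
| w: "q \<in> trig_poly \<Longrightarrow> (\<lambda>z. cis (fst z) ^ 2 * q z) \<in> trig_poly"
| f: "q \<in> trig_poly \<Longrightarrow> (\<lambda>z. cis (fst z) * of_real (snd z) * q z) \<in> trig_poly"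
| add: "\<lbrakk>q \<in> trig_poly; r \<in> trig_poly\<rbrakk> \<Longrightarrow> (\<lambda>z. q z + r z) \<in> trig_poly"

lemma trig_poly_cmult: "q \<in> trig_poly \<Longrightarrow> (\<lambda>z. c * q z) \<in> trig_poly"
proof (induction rule: trig_poly.induct)
  case (const c') show ?case by (rule trig_poly.const)
next
  case (w q) then show ?case using trig_poly.w[OF w.IH] by (simp add: mult.left_commute)
next
  case (f q) then show ?case using trig_poly.f[OF f.IH] by (simp add: mult_ac)
next
  case (add q r) then show ?case using trig_poly.add[OF add.IH] by (simp add: distrib_left)
qed

lemma trig_poly_mult: "\<lbrakk>q \<in> trig_poly; r \<in> trig_poly\<rbrakk> \<Longrightarrow> (\<lambda>z. q z * r z) \<in> trig_poly"
proof (induction rule: trig_poly.induct)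
  case (const c) then show ?case by (rule trig_poly_cmult)
next
  case (w q) then show ?case using trig_poly.w[OF w.IH] by (simp add: mult.assoc)
next
  case (f q) then show ?case using trig_poly.f[OF f.IH] by (simp add: mult.assoc)
next
  case (add q s) then show ?case using trig_poly.add[OF add.IH] by (simp add: distrib_right)
qed

lemma trig_poly_bounded:
  assumes "q \<in> trig_poly" and X: "\<And>z. z \<in> X \<Longrightarrow> \<bar>snd z\<bar> \<le> R" and "R \<ge> 0"
  shows "\<exists>B. \<forall>z\<in>X. norm (q z) \<le> B"
  using assms(1)
proof (induction rule: trig_poly.induct)
  case (f q)
  then obtain B where B: "\<forall>z\<in>X. norm (q z) \<le> B" by blast
  have "norm (cis (fst z) * of_real (snd z) * q z) \<le> R * B" if "z \<in> X" for z
    using X[OF that] B that assms(3) by (auto simp: norm_mult intro!: mult_mono)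
  then show ?case by blast
next
  case (add q r)
  then obtain B B' where "\<forall>z\<in>X. norm (q z) \<le> B" "\<forall>z\<in>X. norm (r z) \<le> B'" by blast
  then have "\<forall>z\<in>X. norm (q z + r z) \<le> B + B'" by (auto intro: norm_triangle_mono)
  then show ?case by blast
qed (auto simp: norm_mult norm_power)

definition closure_alg :: "(real \<times> real) set \<Rightarrow> (real \<times> real \<Rightarrow> complex) set" where
  "closure_alg X = {h. \<forall>e>0. \<exists>q\<in>trig_poly. \<forall>z\<in>X. norm (h z - q z) \<le> e}"

lemma closure_algD: "\<lbrakk>h \<in> closure_alg X; e > 0\<rbrakk> \<Longrightarrow> \<exists>q\<in>trig_poly. \<forall>z\<in>X. norm (h z - q z) \<le> e"
  by (simp add: closure_alg_def)

lemma trig_poly_closure: "q \<in> trig_poly \<Longrightarrow> q \<in> closure_alg X"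
  by (auto simp: closure_alg_def intro!: bexI[of _ q])

lemma uniform_algebra_closure:
  assumes X: "\<And>z. z \<in> X \<Longrightarrow> \<bar>snd z\<bar> \<le> R" and R: "R \<ge> 0"
  shows "uniform_algebra X (closure_alg X)"
proof -
  have bdd: "\<exists>B\<ge>1. \<forall>z\<in>X. norm (h z) \<le> B" if h: "h \<in> closure_alg X" for h
  proof -
    obtain q where q: "q \<in> trig_poly" "\<forall>z\<in>X. norm (h z - q z) \<le> 1"
      using closure_algD[OF h zero_less_one] by blast
    obtain B where B: "\<forall>z\<in>X. norm (q z) \<le> B" using trig_poly_bounded[OF q(1) X R] by blast
    have "norm (h z) \<le> max (1 + B) 1" if "z \<in> X" for z
    proof -
      have "norm (h z) \<le> norm (h z - q z) + norm (q z)" using norm_triangle_ineq[of "h z - q z" "q z"] by simp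
      moreover have "norm (h z - q z) \<le> 1" "norm (q z) \<le> B" using q(2) B that by auto
      ultimately show ?thesis by linarith
    qed
    then show ?thesis by (intro exI[of _ "max (1 + B) 1"]) auto
  qed
  show ?thesis
  proof
    show "(\<lambda>_. c) \<in> closure_alg X" for c by (intro trig_poly_closure trig_poly.const)
    show "\<exists>B. \<forall>z\<in>X. norm (h z) \<le> B" if "h \<in> closure_alg X" for h using bdd[OF that] by blast
    show "h \<in> closure_alg X" if h: "\<And>e. e > 0 \<Longrightarrow> \<exists>q\<in>closure_alg X. \<forall>z\<in>X. norm (h z - q z) \<le> e" for h
      unfolding closure_alg_def
    proof (intro CollectI allI impI)
      fix e :: real assume e: "e > 0"
      obtain g where g: "g \<in> closure_alg X" "\<forall>z\<in>X. norm (h z - g z) \<le> e/2" using h[of "e/2"] e by auto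
      obtain q where q: "q \<in> trig_poly" "\<forall>z\<in>X. norm (g z - q z) \<le> e/2"
        using closure_algD[OF g(1), of "e/2"] e by auto
      have "norm (h z - q z) \<le> e" if "z \<in> X" for z
        using norm_triangle_mono[OF bspec[OF g(2) that] bspec[OF q(2) that]] by simp
      then show "\<exists>q\<in>trig_poly. \<forall>z\<in>X. norm (h z - q z) \<le> e" using q(1) by blast
    qed
    fix g h assume gh: "g \<in> closure_alg X" "h \<in> closure_alg X"
    show "(\<lambda>z. g z + h z) \<in> closure_alg X" unfolding closure_alg_def
    proof (intro CollectI allI impI)
      fix e :: real assume e: "e > 0"
      then have e2: "e/2 > 0" by simp
      obtain q r where q: "q \<in> trig_poly" "\<forall>z\<in>X. norm (g z - q z) \<le> e/2" "r \<in> trig_poly" "\<forall>z\<in>X. norm (h z - r z) \<le> e/2"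
        using closure_algD[OF gh(1) e2] closure_algD[OF gh(2) e2] by blast
      have "norm (g z + h z - (q z + r z)) \<le> e" if "z \<in> X" for z
        unfolding add_diff_add using norm_triangle_mono[OF bspec[OF q(2) that] bspec[OF q(4) that]] by simp
      then show "\<exists>q\<in>trig_poly. \<forall>z\<in>X. norm (g z + h z - q z) \<le> e" by (intro bexI[OF _ trig_poly.add[OF q(1,3)]] ballI)
    qed
    show "(\<lambda>z. g z * h z) \<in> closure_alg X" unfolding closure_alg_def
    proof (intro CollectI allI impI)
      fix e :: real assume e: "e > 0"
      obtain G where G: "G \<ge> 1" "\<forall>z\<in>X. norm (g z) \<le> G" using bdd[OF gh(1)] by blast
      obtain H where H: "H \<ge> 1" "\<forall>z\<in>X. norm (h z) \<le> H" using bdd[OF gh(2)] by blast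
      define d where "d = min 1 (e / (2 * (G + H)))"
      have d: "d > 0" "d \<le> 1" using e G H unfolding d_def by auto
      have de: "2 * (G + H) * d \<le> e" 
      proof -
        have "d \<le> e / (2 * (G + H))" by (simp add: d_def)
        then show ?thesis using G H by (simp add: field_simps)
      qed
      obtain q r where q: "q \<in> trig_poly" "\<forall>z\<in>X. norm (g z - q z) \<le> d" "r \<in> trig_poly" "\<forall>z\<in>X. norm (h z - r z) \<le> d"
        using closure_algD[OF gh(1) d(1)] closure_algD[OF gh(2) d(1)] by blast
      have "norm (g z * h z - q z * r z) \<le> e" if z: "z \<in> X" for z
      proof -
        have "norm (q z) \<le> norm (g z) + norm (g z - q z)"
          using norm_triangle_ineq4[of "g z" "g z - q z"] by simp
        moreover have "norm (g z) \<le> G" "norm (g z - q z) \<le> d" using G q(2) z by auto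
        ultimately have "norm (q z) \<le> 2 * G" using G(1) d(2) by linarith
        have "g z * h z - q z * r z = (g z - q z) * h z + q z * (h z - r z)" by (simp add: algebra_simps)
        also have "norm \<dots> \<le> d * H + 2 * G * d"
          unfolding norm_mult[symmetric] using G H q(2,4) z d \<open>norm (q z) \<le> 2 * G\<close>
          by (intro norm_triangle_mono) (auto simp: norm_mult intro!: mult_mono)
        also have "\<dots> \<le> 2 * (G + H) * d" using G H d by (simp add: algebra_simps)
        finally show ?thesis using de by linarith
      qed
      then show "\<exists>q\<in>trig_poly. \<forall>z\<in>X. norm (g z * h z - q z) \<le> e" by (intro bexI[OF _ trig_poly_mult[OF q(1,3)]] ballI)
    qed
  qed
qed

text \<open>Extension by continuity. That \<open>T q\<close> depends only on the values of
  \<open>q\<close> on \<open>X\<close> is not assumed but follows from the bound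
  \<open>Tb\<close>.\<close>

lemma extend_functional:
  fixes T :: "(real \<times> real \<Rightarrow> complex) \<Rightarrow> complex"
  assumes X: "\<And>z. z \<in> X \<Longrightarrow> \<bar>snd z\<bar> \<le> R" and R: "R \<ge> 0"
    and Tadd: "\<And>g h. \<lbrakk>g \<in> trig_poly; h \<in> trig_poly\<rbrakk> \<Longrightarrow> T (\<lambda>z. g z + h z) = T g + T h"
    and Tcm: "\<And>c g. g \<in> trig_poly \<Longrightarrow> T (\<lambda>z. c * g z) = c * T g"
    and Tb: "\<And>g B. \<lbrakk>g \<in> trig_poly; B \<ge> 0; \<And>z. z \<in> X \<Longrightarrow> norm (g z) \<le> B\<rbrakk> \<Longrightarrow> norm (T g) \<le> C * B"
    and C: "C \<ge> 0"
  obtains T' where "\<And>q. q \<in> trig_poly \<Longrightarrow> T' q = T q"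
    "\<And>g h. \<lbrakk>g \<in> closure_alg X; h \<in> closure_alg X\<rbrakk> \<Longrightarrow> T' (\<lambda>z. g z + h z) = T' g + T' h"
    "\<And>c g. g \<in> closure_alg X \<Longrightarrow> T' (\<lambda>z. c * g z) = c * T' g"
    "\<And>g B. \<lbrakk>g \<in> closure_alg X; B \<ge> 0; \<And>z. z \<in> X \<Longrightarrow> norm (g z) \<le> B\<rbrakk> \<Longrightarrow> norm (T' g) \<le> C * B"
proof -
  interpret uniform_algebra X "closure_alg X" by (rule uniform_algebra_closure[OF X R])
  have Tdiff: "T (\<lambda>z. g z - h z) = T g - T h" if "g \<in> trig_poly" "h \<in> trig_poly" for g h
    using Tadd[OF that(1) trig_poly_cmult[OF that(2), of "-1"]] Tcm[OF that(2), of "-1"] by simp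
  have pd: "(\<lambda>z. g z - h z) \<in> trig_poly" if "g \<in> trig_poly" "h \<in> trig_poly" for g h
    using trig_poly.add[OF that(1) trig_poly_cmult[OF that(2), of "-1"]] by simp
  \<comment> \<open>A value \<open>t\<close> for \<open>h\<close> that respects the bound against
    all polynomials. Uniform approximation leaves at most one such value, so linearity can be
    checked without reference to a chosen sequence.\<close>
  define good where "good h t \<longleftrightarrow> (\<forall>q\<in>trig_poly. \<forall>B. (\<forall>z\<in>X. norm (h z - q z) \<le> B) \<longrightarrow> B \<ge> 0 \<longrightarrow> norm (t - T q) \<le> C * B)" for h t
  have ex: "\<exists>t. good h t" if h: "h \<in> closure_alg X" for h
  proof -
    have "\<exists>q. \<forall>n::nat. q n \<in> trig_poly \<and> (\<forall>z\<in>X. norm (h z - q n z) \<le> 1 / real (Suc n))"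
    proof (rule choice, intro allI)
      fix n :: nat
      have "1 / real (Suc n) > 0" by simp
      then show "\<exists>y. y \<in> trig_poly \<and> (\<forall>z\<in>X. norm (h z - y z) \<le> 1 / real (Suc n))"
        using closure_algD[OF h] by blast
    qed
    then obtain q where q: "\<And>n::nat. q n \<in> trig_poly" "\<And>n z. z \<in> X \<Longrightarrow> norm (h z - q n z) \<le> 1 / real (Suc n)"
      by blast
    have est: "norm (T q' - T (q n)) \<le> C * (B + 1 / real (Suc n))"
      if "q' \<in> trig_poly" "\<forall>z\<in>X. norm (h z - q' z) \<le> B" "B \<ge> 0" for q' B n
    proof -
      have "norm (T (\<lambda>z. q' z - q n z)) \<le> C * (B + 1 / real (Suc n))"
      proof (rule Tb[OF pd[OF that(1) q(1)]])
        fix z assume z: "z \<in> X"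
        have "norm (q' z - q n z) = norm ((h z - q n z) - (h z - q' z))" by simp
        also have "\<dots> \<le> norm (h z - q n z) + norm (h z - q' z)" by (rule norm_triangle_ineq4)
        finally have "norm (q' z - q n z) \<le> norm (h z - q n z) + norm (h z - q' z)" .
        then show "norm (q' z - q n z) \<le> B + 1 / real (Suc n)" using q(2)[OF z, of n] bspec[OF that(2) z] by linarith
      qed (use that in auto)
      then show ?thesis using Tdiff[OF that(1) q(1)] by simp
    qed
    have "Cauchy (\<lambda>n. T (q n))"
    proof (rule metric_CauchyI)
      fix e :: real assume e: "e > 0"
      obtain N :: nat where N: "2 * C / e < real N" using reals_Archimedean2 by blast
      have "dist (T (q m)) (T (q n)) < e" if mn: "m \<ge> N" "n \<ge> N" for m n
      proof -
        have N0: "real (Suc N) > 0" by simp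
        have "norm (T (q m) - T (q n)) \<le> C * (1 / real (Suc m) + 1 / real (Suc n))"
          using est[OF q(1), of m "1 / real (Suc m)" n] q(2) by auto
        also have "\<dots> \<le> C * (1 / real (Suc N) + 1 / real (Suc N))"
          using mn C by (intro mult_left_mono add_mono divide_left_mono) auto
        also have "\<dots> = 2 * C / real (Suc N)" by simp
        also have "\<dots> < e"
        proof -
          have "2 * C < e * real N" using N e by (simp add: field_simps)
          also have "\<dots> \<le> e * real (Suc N)" using e by simp
          finally show ?thesis by (simp add: divide_less_eq)
        qed
        finally show ?thesis by (simp add: dist_norm)
      qed
      then show "\<exists>M. \<forall>m\<ge>M. \<forall>n\<ge>M. dist (T (q m)) (T (q n)) < e" by blast
    qed
    then obtain t where t: "(\<lambda>n. T (q n)) \<longlonglongrightarrow> t" using Cauchy_convergent convergent_def by blast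
    have "good h t" unfolding good_def
    proof (intro ballI allI impI)
      fix q' B assume q': "q' \<in> trig_poly" "\<forall>z\<in>X. norm (h z - q' z) \<le> B" "(B::real) \<ge> 0"
      have "(\<lambda>n. norm (T q' - T (q n))) \<longlonglongrightarrow> norm (T q' - t)" by (intro tendsto_intros t)
      moreover have "(\<lambda>n. C * (B + 1 / real (Suc n))) \<longlonglongrightarrow> C * (B + 0)"
        by (intro tendsto_intros) (use LIMSEQ_inverse_real_of_nat in \<open>simp add: inverse_eq_divide\<close>)
      ultimately have "norm (T q' - t) \<le> C * (B + 0)"
        by (rule LIMSEQ_le) (use est[OF q'] in blast)
      then show "norm (t - T q') \<le> C * B" by (simp add: norm_minus_commute)
    qed
    then show ?thesis by blast
  qed
  define T' where "T' h = (SOME t. good h t)" for h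
  have T': "norm (T' h - T q) \<le> C * B" if "h \<in> closure_alg X" "q \<in> trig_poly" "\<And>z. z \<in> X \<Longrightarrow> norm (h z - q z) \<le> B" "B \<ge> 0" for h q B
  proof -
    have "good h (T' h)" unfolding T'_def by (rule someI_ex[OF ex[OF that(1)]])
    then have "(\<forall>z\<in>X. norm (h z - q z) \<le> B) \<longrightarrow> B \<ge> 0 \<longrightarrow> norm (T' h - T q) \<le> C * B"
      using that(2) unfolding good_def by blast
    then show ?thesis using that(3,4) by blast
  qed
  have approx: "\<exists>q\<in>trig_poly. \<forall>z\<in>X. norm (h z - q z) \<le> e" if "h \<in> closure_alg X" "e > 0" for h e
    by (rule closure_algD[OF that])
  have zero: "a = b" if zz: "\<And>e. e > 0 \<Longrightarrow> norm (a - b) \<le> K * e" for a b :: complex and K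
  proof -
    have "norm (a - b) \<le> 0 + e" if e: "e > 0" for e
    proof -
      have "e / (\<bar>K\<bar> + 1) > 0" using e by (intro divide_pos_pos) auto
      then have "norm (a - b) \<le> K * (e / (\<bar>K\<bar> + 1))" by (rule zz)
      also have "\<dots> \<le> (\<bar>K\<bar> + 1) * (e / (\<bar>K\<bar> + 1))" using e by (intro mult_right_mono) auto
      also have "\<dots> = 0 + e"
      proof -
        have "\<bar>K\<bar> + 1 \<noteq> 0" by linarith
        then show ?thesis by simp
      qed
      finally show ?thesis .
    qed
    then have "norm (a - b) \<le> 0" by (rule field_le_epsilon)
    then show ?thesis by simp
  qed
  show thesis
  proof (rule that[of T'])
    show "T' q = T q" if "q \<in> trig_poly" for q
    proof (rule zero)
      fix e :: real assume "e > 0"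
      then show "norm (T' q - T q) \<le> C * e" by (intro T' trig_poly_closure that) auto
    qed
    show "T' (\<lambda>z. g z + h z) = T' g + T' h" if gh: "g \<in> closure_alg X" "h \<in> closure_alg X" for g h
    proof (rule zero)
      fix e :: real assume e: "e > 0"
      obtain q where q: "q \<in> trig_poly" "\<forall>z\<in>X. norm (g z - q z) \<le> e" using approx[OF gh(1) e] by blast
      obtain r where r: "r \<in> trig_poly" "\<forall>z\<in>X. norm (h z - r z) \<le> e" using approx[OF gh(2) e] by blast
      have 1: "norm (T' g - T q) \<le> C * e" "norm (T' h - T r) \<le> C * e" using q r e gh by (auto intro!: T')
      have 2: "norm (T' (\<lambda>z. g z + h z) - T (\<lambda>z. q z + r z)) \<le> C * (e + e)"
      proof (rule T')
        fix z assume z: "z \<in> X"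
        show "norm (g z + h z - (q z + r z)) \<le> e + e"
          unfolding add_diff_add by (rule norm_triangle_mono[OF bspec[OF q(2) z] bspec[OF r(2) z]])
      qed (use gh q r e in \<open>auto intro: add trig_poly.add\<close>)
      have "T' (\<lambda>z. g z + h z) - (T' g + T' h) = (T' (\<lambda>z. g z + h z) - T (\<lambda>z. q z + r z)) - ((T' g - T q) + (T' h - T r))"
        using Tadd[OF q(1) r(1)] by simp
      also have "norm \<dots> \<le> C * (e + e) + (C * e + C * e)"
        by (rule order_trans[OF norm_triangle_ineq4 add_mono[OF 2 norm_triangle_mono[OF 1]]])
      finally show "norm (T' (\<lambda>z. g z + h z) - (T' g + T' h)) \<le> 4 * C * e" by (simp add: algebra_simps)
    qed
    show "T' (\<lambda>z. c * g z) = c * T' g" if g: "g \<in> closure_alg X" for c g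
    proof (rule zero)
      fix e :: real assume e: "e > 0"
      obtain q where q: "q \<in> trig_poly" "\<forall>z\<in>X. norm (g z - q z) \<le> e" using approx[OF g e] by blast
      have 1: "norm (T' g - T q) \<le> C * e" using q e g by (auto intro!: T')
      have 2: "norm (T' (\<lambda>z. c * g z) - T (\<lambda>z. c * q z)) \<le> C * (norm c * e)"
      proof (rule T')
        fix z assume "z \<in> X"
        then have "norm (c * (g z - q z)) \<le> norm c * e" unfolding norm_mult using q by (intro mult_left_mono) auto
        then show "norm (c * g z - c * q z) \<le> norm c * e" by (simp add: right_diff_distrib)
      qed (use g q e in \<open>auto intro: cmult trig_poly_cmult\<close>)
      have "T' (\<lambda>z. c * g z) - c * T' g = (T' (\<lambda>z. c * g z) - T (\<lambda>z. c * q z)) - c * (T' g - T q)"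
        using Tcm[OF q(1)] by (simp add: algebra_simps)
      also have "norm \<dots> \<le> C * (norm c * e) + norm c * (C * e)"
        by (rule order_trans[OF norm_triangle_ineq4 add_mono[OF 2]]) (use 1 in \<open>simp add: norm_mult mult_left_mono\<close>)
      finally show "norm (T' (\<lambda>z. c * g z) - c * T' g) \<le> (2 * C * norm c) * e" by (simp add: algebra_simps)
    qed
    show "norm (T' g) \<le> C * B" if g: "g \<in> closure_alg X" "B \<ge> 0" "\<And>z. z \<in> X \<Longrightarrow> norm (g z) \<le> B" for g B
    proof -
      have T0: "T (\<lambda>_. 0) = 0" using Tcm[OF trig_poly.const[of 0], of 0] by simp
      show ?thesis using T'[OF g(1) trig_poly.const[of 0], of B] g T0 by simp
    qed
  qed
qed

lemma integral_cis_power: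
  "integral {0..2*pi} (\<lambda>t. cis t ^ (2 * m)) = (if m = 0 then of_real (2 * pi) else 0)"
proof (cases "m = 0")
  case False
  define c where "c = \<i> * of_nat (2 * m)"
  have c: "c \<noteq> 0" using False by (simp add: c_def)
  have "((\<lambda>z. exp (c * z) / c) has_field_derivative exp (c * z)) (at z within S)" for z S
    using c by (auto intro!: derivative_eq_intros)
  then have "((\<lambda>t. exp (c * of_real t) / c) has_vector_derivative exp (c * of_real t)) (at t within S)" for t S
    using has_vector_derivative_real_field[where f = "\<lambda>z. exp (c * z) / c"] by blast
  then have "((\<lambda>t. exp (c * of_real t)) has_integral exp (c * of_real (2*pi)) / c - exp (c * of_real 0) / c) {0..2*pi}"
    by (intro fundamental_theorem_of_calculus) auto
  moreover have "exp (c * of_real (2*pi)) = 1"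
  proof -
    have "exp (c * of_real (2*pi)) = exp (\<i> * of_real (2 * pi)) ^ (2 * m)"
      unfolding exp_of_nat_mult[symmetric] by (simp add: c_def mult_ac)
    then show ?thesis by (simp only: cis_conv_exp[symmetric] cis_2pi power_one)
  qed
  moreover have "exp (c * of_real t) = cis t ^ (2 * m)" for t
    unfolding cis_conv_exp exp_of_nat_mult[symmetric] by (simp add: c_def mult_ac)
  ultimately show ?thesis using False by (simp add: integral_unique)
qed (simp add: scaleR_conv_of_real)

text \<open>The union of the lines with normal \<omega> that meet \<open>D0\<close>: a strip when
  \<open>D0\<close> is bounded.\<close>

definition gap :: "(real^2) set \<Rightarrow> real^2 \<Rightarrow> (real^2) set" where
  "gap D0 \<omega> = {x. \<exists>y\<in>D0. y \<bullet> \<omega> = x \<bullet> \<omega>}"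

lemma open_gap: assumes D0: "open D0" shows "open (gap D0 \<omega>)"
proof -
  have eq: "gap D0 \<omega> = (\<lambda>x. x \<bullet> \<omega>) -` ((\<lambda>x. x \<bullet> \<omega>) ` D0)"
    by (rule set_eqI) (simp add: gap_def image_iff, metis)
  show ?thesis
  proof (cases "\<omega> = 0")
    case True
    then have "gap D0 \<omega> = {} \<or> gap D0 \<omega> = UNIV" by (auto simp: gap_def)
    then show ?thesis by auto
  next
    case False
    have "open ((\<lambda>x. x \<bullet> \<omega>) ` D0)"
    proof (rule open_surjective_linear_image[OF D0])
      show "linear (\<lambda>x. x \<bullet> \<omega>)" by (intro linearI) (auto simp: inner_add_left)
      show "surj (\<lambda>x. x \<bullet> \<omega>)"
        using False by (intro surjI[where f = "\<lambda>r. (r / (\<omega> \<bullet> \<omega>)) *\<^sub>R \<omega>"]) simp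
    qed
    then show ?thesis unfolding eq by (intro open_vimage continuous_intros)
  qed
qed

text \<open>\<open>V\<close> is the weak form of the vanishing of the Radon transform: the lines
  with a given normal that meet \<open>D0\<close> carry nothing, even when weighted by \<psi>. It is
  stated for every direction and for normals of any length, since the normals (cos t, \<tau> sin t)
  used below are not unit vectors.\<close>

locale radon_data =
  fixes u :: "real^2 \<Rightarrow> complex" and D0 D1 :: "(real^2) set"
  assumes int: "integrable lebesgue u"
    and D0: "open D0" "convex D0" "D0 \<noteq> {}" and D1: "compact D1" "convex D1" "D1 \<noteq> {}"
    and out: "AE x in lebesgue. x \<notin> D1 \<longrightarrow> u x = 0"
    and V: "\<And>\<omega> \<psi>. \<lbrakk>\<omega> \<noteq> 0; continuous_on UNIV \<psi>\<rbrakk> \<Longrightarrow>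
      (LINT x:gap D0 \<omega>|lebesgue. u x * \<psi> (x \<bullet> \<omega>)) = 0"
begin

lemma integrable_mult_continuous:
  assumes g: "continuous_on UNIV g" shows "integrable lebesgue (\<lambda>x. u x * g x)"
proof -
  have "bounded (g ` D1)"
    by (intro compact_imp_bounded compact_continuous_image D1 continuous_on_subset[OF g]) auto
  then obtain B where B: "\<And>x. x \<in> D1 \<Longrightarrow> norm (g x) \<le> B" by (auto simp: bounded_iff)
  show ?thesis
  proof (rule Bochner_Integration.integrable_bound)
    show "integrable lebesgue (\<lambda>x. of_real B * u x)" using int by (rule integrable_mult_right)
    have "g \<in> borel_measurable lborel" using borel_measurable_continuous_onI[OF g] by simp
    then have "g \<in> borel_measurable lebesgue" by (rule measurable_completion)
    then show "(\<lambda>x. u x * g x) \<in> borel_measurable lebesgue"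
      using borel_measurable_integrable[OF int] by (intro borel_measurable_times) auto
    show "AE x in lebesgue. norm (u x * g x) \<le> norm (of_real B * u x)"
      using out
    proof eventually_elim
      case (elim x)
      show ?case
      proof (cases "x \<in> D1")
        case True
        then have "norm (g x) \<le> \<bar>B\<bar>" using B by fastforce
        then show ?thesis by (simp add: norm_mult mult.commute[of "norm (u x)"] mult_right_mono)
      qed (use elim in simp)
    qed
  qed
qed

context
  fixes \<tau> :: real
  assumes \<tau>: "\<tau> > 0"
begin

definition y :: "real^2 \<Rightarrow> complex" where "y x = Complex (x $ 1) (\<tau> * x $ 2)"

lemma y_linear: "linear y"
  by (intro linearI) (auto simp: y_def complex_eq_iff algebra_simps)

lemma y_continuous [continuous_intros]: "continuous_on S y"
  using y_linear by (rule linear_continuous_on_compose[OF continuous_on_id, simplified])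

lemma y_inj: "inj y"
  using \<tau> by (auto simp: inj_def y_def vec_eq_iff forall_2)

lemma y_surj: "surj y"
proof (rule surjI[where f = "\<lambda>z. vector [Re z, Im z / \<tau>]"])
  show "y (vector [Re z, Im z / \<tau>]) = z" for z using \<tau> by (simp add: y_def)
qed

lemma y_inner: "y x \<bullet> cis t = x \<bullet> vector [cos t, \<tau> * sin t]"
  by (simp add: y_def inner_complex_def inner_vec_def sum_2)

definition moment :: "nat \<Rightarrow> nat \<Rightarrow> complex" where
  "moment a b = (LINT x|lebesgue. u x * (y x ^ a * cnj (y x) ^ b))"

definition X :: "(real \<times> real) set" where
  "X = {(t, s). (\<forall>x\<in>D0. y x \<bullet> cis t \<noteq> s) \<and> (\<exists>x\<in>D1. y x \<bullet> cis t = s)}"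

definition I :: "(real \<times> real \<Rightarrow> complex) \<Rightarrow> real \<Rightarrow> complex" where
  "I q t = (LINT x|lebesgue. u x * q (t, y x \<bullet> cis t))"

definition T :: "(real \<times> real \<Rightarrow> complex) \<Rightarrow> complex" where
  "T q = integral {0..2*pi} (I q)"

lemma trig_poly_continuous: "q \<in> trig_poly \<Longrightarrow> continuous_on S q"
  by (induction rule: trig_poly.induct) (auto intro!: continuous_intros simp: split_beta)

lemma trig_poly_comp_continuous:
  assumes "q \<in> trig_poly" "continuous_on S g" "continuous_on S h"
  shows "continuous_on S (\<lambda>x. q (g x, h x))"
  using continuous_on_compose2[OF trig_poly_continuous[OF assms(1), of UNIV] continuous_on_Pair[OF assms(2,3)]] by simp

lemma integrable_trig_poly: "q \<in> trig_poly \<Longrightarrow> integrable lebesgue (\<lambda>x. u x * q (t, y x \<bullet> cis t))"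
  by (intro integrable_mult_continuous trig_poly_comp_continuous continuous_intros)

abbreviation mono :: "nat \<Rightarrow> nat \<Rightarrow> real \<times> real \<Rightarrow> complex" where
  "mono n k \<equiv> \<lambda>z. (cis (fst z) ^ 2) ^ n * (cis (fst z) * of_real (snd z)) ^ k"

lemma mono_trig_poly: "q \<in> trig_poly \<Longrightarrow> (\<lambda>z. mono n k z * q z) \<in> trig_poly"
proof (induction n)
  case 0
  have "(\<lambda>z. (cis (fst z) * of_real (snd z)) ^ k * q z) \<in> trig_poly"
  proof (induction k)
    case (Suc k) from trig_poly.f[OF this] show ?case by (simp add: mult_ac)
  qed (use 0 in simp)
  then show ?case by simp
next
  case (Suc n) from trig_poly.w[OF Suc.IH[OF Suc.prems]] show ?case by (simp add: mult_ac)
qed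

text \<open>On a line through z with normal \<open>cis t\<close>, f = (cnj z w + z) / 2. The
  binomial expansion sorts by powers of \<open>w\<close>; the later integration over
  \<open>t\<close> keeps only the power 0, which is the holomorphic part.\<close>

lemma I_mono:
  "I (\<lambda>z. mono n k z * c) t = (\<Sum>j\<le>k. c * (of_nat (k choose j) * moment (k - j) j / 2 ^ k) * cis t ^ (2 * (n + j)))"
proof -
  have f: "cis t * of_real (z \<bullet> cis t) = (cnj z * cis t ^ 2 + z) / 2" for z
  proof -
    have "of_real (z \<bullet> cis t) = (cnj z * cis t + z * cnj (cis t)) / 2"
      by (simp add: complex_eq_iff inner_complex_def)
    moreover have "cis t * cnj (cis t) = 1" by (simp add: cis_cnj cis_mult)
    ultimately show ?thesis by (simp add: power2_eq_square field_simps)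
  qed
  have "u x * (mono n k (t, y x \<bullet> cis t) * c) =
     (\<Sum>j\<le>k. (c * (of_nat (k choose j) / 2 ^ k) * cis t ^ (2 * (n + j))) * (u x * (y x ^ (k - j) * cnj (y x) ^ j)))" for x
  proof -
    have "(cis t * of_real (y x \<bullet> cis t)) ^ k = (\<Sum>j\<le>k. of_nat (k choose j) * (cnj (y x) * cis t ^ 2) ^ j * y x ^ (k - j)) / 2 ^ k"
      unfolding f power_divide binomial_ring by simp
    then have "u x * (mono n k (t, y x \<bullet> cis t) * c) = (\<Sum>j\<le>k. u x * ((cis t ^ 2) ^ n * (of_nat (k choose j) * (cnj (y x) * cis t ^ 2) ^ j * y x ^ (k - j) / 2 ^ k) * c))"
      by (simp add: sum_distrib_left sum_distrib_right sum_divide_distrib mult_ac)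
    also have "\<dots> = (\<Sum>j\<le>k. (c * (of_nat (k choose j) / 2 ^ k) * cis t ^ (2 * (n + j))) * (u x * (y x ^ (k - j) * cnj (y x) ^ j)))"
    proof (intro sum.cong refl)
      fix j
      have E: "cis t ^ (2 * (n + j)) = (cis t ^ 2) ^ n * (cis t ^ 2) ^ j" by (simp only: power_mult power_add)
      show "u x * ((cis t ^ 2) ^ n * (of_nat (k choose j) * (cnj (y x) * cis t ^ 2) ^ j * y x ^ (k - j) / 2 ^ k) * c) =
        (c * (of_nat (k choose j) / 2 ^ k) * cis t ^ (2 * (n + j))) * (u x * (y x ^ (k - j) * cnj (y x) ^ j))"
        unfolding E power_mult_distrib by simp
    qed
    finally show ?thesis .
  qed
  then have "I (\<lambda>z. mono n k z * c) t = (LINT x|lebesgue. (\<Sum>j\<le>k. (c * (of_nat (k choose j) / 2 ^ k) * cis t ^ (2 * (n + j))) * (u x * (y x ^ (k - j) * cnj (y x) ^ j))))"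
    by (simp add: I_def)
  also have "\<dots> = (\<Sum>j\<le>k. (c * (of_nat (k choose j) / 2 ^ k) * cis t ^ (2 * (n + j))) * moment (k - j) j)"
    unfolding moment_def
    by (subst Bochner_Integration.integral_sum)
      (auto intro!: integrable_mult_right integrable_mult_continuous continuous_intros)
  finally show ?thesis by (simp add: mult_ac)
qed

lemma I_add:
  assumes "q \<in> trig_poly" "r \<in> trig_poly" shows "I (\<lambda>z. q z + r z) t = I q t + I r t"
  unfolding I_def distrib_left
  by (intro Bochner_Integration.integral_add integrable_trig_poly assms)

text \<open>The monomial in front is the generalization that the induction needs: each generator is
  absorbed into it until only a constant remains, where \<open>I_mono\<close> applies. The proof of
  \<open>T_w\<close> follows the same pattern.\<close>

lemma I_continuous_mono: "q \<in> trig_poly \<Longrightarrow> continuous_on S (I (\<lambda>z. mono n k z * q z))"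
proof (induction arbitrary: n k rule: trig_poly.induct)
  case (const c)
  then show ?case unfolding I_mono[abs_def] by (intro continuous_intros)
next
  case (w q) then show ?case using w.IH[of "Suc n" k] by (simp add: mult_ac)
next
  case (f q) then show ?case using f.IH[of n "Suc k"] by (simp add: mult_ac)
next
  case (add q r)
  have "I (\<lambda>z. mono n k z * (q z + r z)) t = I (\<lambda>z. mono n k z * q z) t + I (\<lambda>z. mono n k z * r z) t" for t
    unfolding distrib_left by (intro I_add mono_trig_poly add)
  then have "I (\<lambda>z. mono n k z * (q z + r z)) = (\<lambda>t. I (\<lambda>z. mono n k z * q z) t + I (\<lambda>z. mono n k z * r z) t)" by blast
  then show ?case using continuous_on_add[OF add.IH(1) add.IH(2)] by simp
qed

lemma I_continuous: "q \<in> trig_poly \<Longrightarrow> continuous_on S (I q)"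
  using I_continuous_mono[of q S 0 0] by simp

lemma I_integrable: "q \<in> trig_poly \<Longrightarrow> I q integrable_on {0..2*pi}"
  by (intro integrable_continuous_real I_continuous)

lemma T_add: "\<lbrakk>q \<in> trig_poly; r \<in> trig_poly\<rbrakk> \<Longrightarrow> T (\<lambda>z. q z + r z) = T q + T r"
proof -
  assume qr: "q \<in> trig_poly" "r \<in> trig_poly"
  have "I (\<lambda>z. q z + r z) = (\<lambda>t. I q t + I r t)" by (rule ext, rule I_add[OF qr])
  then show ?thesis
    using qr by (simp add: T_def I_integrable Henstock_Kurzweil_Integration.integral_add)
qed

lemma T_cmult: "q \<in> trig_poly \<Longrightarrow> T (\<lambda>z. c * q z) = c * T q"
proof -
  have "I (\<lambda>z. c * q z) = (\<lambda>t. c * I q t)"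
    by (simp add: I_def[abs_def] mult.left_commute[of _ c])
  then show ?thesis by (simp add: T_def)
qed

lemma T_mono: "T (\<lambda>z. mono n k z * c) = (if n = 0 then c * moment k 0 / 2 ^ k * of_real (2 * pi) else 0)"
proof -
  have "T (\<lambda>z. mono n k z * c) = (\<Sum>j\<le>k. integral {0..2*pi} (\<lambda>t. c * (of_nat (k choose j) * moment (k - j) j / 2 ^ k) * cis t ^ (2 * (n + j))))"
    unfolding T_def I_mono[abs_def]
    by (intro Henstock_Kurzweil_Integration.integral_sum integrable_continuous_real continuous_intros) auto
  also have "\<dots> = (\<Sum>j\<le>k. c * (of_nat (k choose j) * moment (k - j) j / 2 ^ k) * (if n + j = 0 then of_real (2*pi) else 0))"
    unfolding Henstock_Kurzweil_Integration.integral_mult_right integral_cis_power by simp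
  also have "\<dots> = (\<Sum>j\<le>k. if j = 0 then (if n = 0 then c * moment k 0 / 2 ^ k * of_real (2 * pi) else 0) else 0)"
    by (intro sum.cong refl) auto
  finally show ?thesis by simp
qed

lemma T_w: "q \<in> trig_poly \<Longrightarrow> T (\<lambda>z. mono (Suc n) k z * q z) = 0"
proof (induction arbitrary: n k rule: trig_poly.induct)
  case (const c) show ?case unfolding T_mono by simp
next
  case (w q) then show ?case using w.IH[of "Suc n" k] by (simp add: mult_ac)
next
  case (f q) then show ?case using f.IH[of n "Suc k"] by (simp add: mult_ac)
next
  case (add q r)
  show ?case unfolding distrib_left using add.IH by (subst T_add) (auto intro!: mono_trig_poly add simp del: power_Suc)
qed

lemma y_norm_bounded: "\<exists>R\<ge>0. \<forall>x\<in>D1. norm (y x) \<le> R"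
proof -
  have "bounded (y ` D1)" by (intro compact_imp_bounded compact_continuous_image continuous_intros D1)
  then obtain R where "\<forall>x\<in>D1. norm (y x) \<le> R" by (auto simp: bounded_iff)
  then show ?thesis by (intro exI[of _ "max R 0"]) auto
qed

lemma X_bounded: obtains R where "R \<ge> 0" "\<And>z. z \<in> X \<Longrightarrow> \<bar>snd z\<bar> \<le> R"
proof -
  obtain R where R: "R \<ge> 0" "\<And>x. x \<in> D1 \<Longrightarrow> norm (y x) \<le> R" using y_norm_bounded by blast
  have "\<bar>snd z\<bar> \<le> R" if z: "z \<in> X" for z
  proof -
    obtain x where x: "x \<in> D1" "y x \<bullet> cis (fst z) = snd z" using z by (auto simp: X_def)
    have "\<bar>y x \<bullet> cis (fst z)\<bar> \<le> norm (y x) * norm (cis (fst z))" by (rule Cauchy_Schwarz_ineq2)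
    then show ?thesis using R(2)[OF x(1)] x(2) by simp
  qed
  then show thesis using that R(1) by blast
qed

text \<open>Values of \<open>q\<close> on lines that meet \<open>D0\<close> do not enter:
  \<open>V\<close> removes the strip \<open>G\<close>, and for almost every other \<open>x\<close>
  either \<open>u\<close> vanishes or the line through \<open>x\<close> belongs to \<open>X\<close>.
  This makes \<open>T\<close> bounded for the uniform norm over \<open>X\<close>.\<close>

lemma I_bound:
  assumes q: "q \<in> trig_poly" and B: "B \<ge> 0" "\<And>z. z \<in> X \<Longrightarrow> norm (q z) \<le> B"
  shows "norm (I q t) \<le> (LINT x|lebesgue. norm (u x)) * B"
proof -
  define \<omega> :: "real^2" where "\<omega> = vector [cos t, \<tau> * sin t]"
  define G where "G = gap D0 \<omega>"
  let ?g = "\<lambda>x. u x * q (t, y x \<bullet> cis t)"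
  have \<omega>0: "\<omega> \<noteq> 0"
  proof
    assume "\<omega> = 0"
    then have "\<omega> $ 1 = 0" "\<omega> $ 2 = 0" by simp_all
    then have "cos t = 0" "sin t = 0" using \<tau> by (simp_all add: \<omega>_def)
    then show False using sin_cos_squared_add[of t] by simp
  qed
  have G: "G \<in> sets lebesgue" using open_gap[OF D0(1)] by (simp add: G_def)
  have gi: "integrable lebesgue ?g" by (rule integrable_trig_poly[OF q])
  have i1: "integrable lebesgue (\<lambda>x. indicator G x *\<^sub>R ?g x)"
    using gi G by (intro integrable_mult_indicator)
  have i2: "integrable lebesgue (\<lambda>x. indicator (- G) x *\<^sub>R ?g x)"
    using gi G by (intro integrable_mult_indicator) (auto simp: Compl_in_sets_lebesgue)
  have "I q t = (LINT x|lebesgue. indicator G x *\<^sub>R ?g x + indicator (- G) x *\<^sub>R ?g x)"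
    unfolding I_def by (intro Bochner_Integration.integral_cong refl) (auto simp: indicator_def)
  also have "\<dots> = (LINT x|lebesgue. indicator G x *\<^sub>R ?g x) + (LINT x|lebesgue. indicator (- G) x *\<^sub>R ?g x)"
    by (rule Bochner_Integration.integral_add[OF i1 i2])
  also have "(LINT x|lebesgue. indicator G x *\<^sub>R ?g x) = 0"
    using V[OF \<omega>0, of "\<lambda>s. q (t, s)"] trig_poly_comp_continuous[OF q, of UNIV "\<lambda>_. t" "\<lambda>s. s"]
    by (simp add: G_def set_lebesgue_integral_def y_inner \<omega>_def continuous_on_id continuous_on_const)
  finally have "I q t = (LINT x|lebesgue. indicator (- G) x *\<^sub>R ?g x)" by simp
  also have "norm \<dots> \<le> (LINT x|lebesgue. norm (indicator (- G) x *\<^sub>R ?g x))"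
    by (rule integral_norm_bound)
  also have "\<dots> \<le> (LINT x|lebesgue. norm (u x) * B)"
  proof (rule integral_mono_AE)
    show "integrable lebesgue (\<lambda>x. norm (indicator (- G) x *\<^sub>R ?g x))" using i2 by (rule integrable_norm)
    show "integrable lebesgue (\<lambda>x. norm (u x) * B)" using int by (intro integrable_mult_left integrable_norm)
    show "AE x in lebesgue. norm (indicator (- G) x *\<^sub>R ?g x) \<le> norm (u x) * B"
      using out
    proof eventually_elim
      case (elim x)
      show ?case
      proof (cases "x \<in> G \<or> x \<notin> D1")
        case True then show ?thesis using elim B(1) by auto
      next
        case False
        then have "(t, y x \<bullet> cis t) \<in> X" by (auto simp: X_def G_def gap_def y_inner \<omega>_def)
        then have "norm (q (t, y x \<bullet> cis t)) \<le> B" by (rule B(2))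
        then show ?thesis using False by (simp add: norm_mult mult_left_mono)
      qed
    qed
  qed
  finally show ?thesis by simp
qed

lemma T_bound:
  assumes q: "q \<in> trig_poly" and B: "B \<ge> 0" "\<And>z. z \<in> X \<Longrightarrow> norm (q z) \<le> B"
  shows "norm (T q) \<le> (2 * pi * (LINT x|lebesgue. norm (u x))) * B"
proof -
  have "norm (T q) \<le> ((LINT x|lebesgue. norm (u x)) * B) * (2 * pi - 0)"
    unfolding T_def by (intro integral_bound I_continuous q I_bound B) auto
  then show ?thesis by (simp add: mult_ac)
qed

lemma ellipse_or_moments_eq_0:
  "(\<forall>k. moment k 0 = 0) \<or>
   (\<exists>x0 v0 r. norm v0 < r \<and> (\<forall>x\<in>D0. v0 \<bullet> (y x - x0) + r * norm (y x - x0) \<le> 1) \<and>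
      (\<forall>x. v0 \<bullet> (y x - x0) + r * norm (y x - x0) \<le> 1 \<longrightarrow> x \<in> D1))"
proof -
  obtain R where R: "R \<ge> 0" "\<And>z. z \<in> X \<Longrightarrow> \<bar>snd z\<bar> \<le> R" using X_bounded by blast
  interpret uniform_algebra X "closure_alg X" by (rule uniform_algebra_closure[OF R(2,1)])
  have C: "2 * pi * (LINT x|lebesgue. norm (u x)) \<ge> 0" by simp
  let ?f = "\<lambda>z::real \<times> real. cis (fst z) * of_real (snd z)" and ?w = "\<lambda>z::real \<times> real. cis (fst z) ^ 2"
  have fP0: "?f \<in> trig_poly" using trig_poly.f[OF trig_poly.const[of 1]] by simp
  have wP0: "?w \<in> trig_poly" using trig_poly.w[OF trig_poly.const[of 1]] by simp
  have fP: "?f \<in> closure_alg X" and wP: "?w \<in> closure_alg X" using fP0 wP0 trig_poly_closure by auto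
  show ?thesis
  proof (cases "\<forall>b. \<exists>G\<in>closure_alg X. \<exists>H\<in>closure_alg X. \<forall>z\<in>X. (?f z - b) * G z + ?w z * H z = 1")
    case True
    obtain T' where T': "\<And>q. q \<in> trig_poly \<Longrightarrow> T' q = T q"
      "\<And>g h. \<lbrakk>g \<in> closure_alg X; h \<in> closure_alg X\<rbrakk> \<Longrightarrow> T' (\<lambda>z. g z + h z) = T' g + T' h"
      "\<And>c g. g \<in> closure_alg X \<Longrightarrow> T' (\<lambda>z. c * g z) = c * T' g"
      "\<And>g B. \<lbrakk>g \<in> closure_alg X; B \<ge> 0; \<And>z. z \<in> X \<Longrightarrow> norm (g z) \<le> B\<rbrakk> \<Longrightarrow> norm (T' g) \<le> (2 * pi * (LINT x|lebesgue. norm (u x))) * B"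
      using extend_functional[of X R T, OF R(2,1) T_add T_cmult T_bound C] by blast
    have Tw': "T' (\<lambda>z. ?w z * g z) = 0" if g: "g \<in> closure_alg X" for g
    proof -
      have "norm (T' (\<lambda>z. ?w z * g z)) \<le> 0 + (2 * pi * (LINT x|lebesgue. norm (u x))) * e" if e: "e > 0" for e
      proof -
        obtain q where q: "q \<in> trig_poly" "\<forall>z\<in>X. norm (g z - q z) \<le> e" using closure_algD[OF g e] by blast
        have "T' (\<lambda>z. ?w z * q z) = 0" using T_w[OF q(1), of 0 0] T'(1)[OF trig_poly.w[OF q(1)]] by simp
        moreover have m: "(\<lambda>z. ?w z * (g z - q z)) \<in> closure_alg X" "(\<lambda>z. ?w z * q z) \<in> closure_alg X"
          using q g wP trig_poly_closure by (auto intro!: mult diff)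
        moreover have "T' (\<lambda>z. ?w z * g z) = T' (\<lambda>z. ?w z * (g z - q z) + ?w z * q z)" by (simp add: algebra_simps)
        ultimately have "T' (\<lambda>z. ?w z * g z) = T' (\<lambda>z. ?w z * (g z - q z))" using T'(2)[OF m] by simp
        also have "norm \<dots> \<le> (2 * pi * (LINT x|lebesgue. norm (u x))) * e"
          using q(2) e by (intro T'(4) m) (auto simp: norm_mult norm_power)
        finally show ?thesis by simp
      qed
      then have "norm (T' (\<lambda>z. ?w z * g z)) \<le> 0 + e" if e: "e > 0" for e
      proof -
        let ?K = "2 * pi * (LINT x|lebesgue. norm (u x))"
        have "?K + 1 > 0" using C by linarith
        then have "e / (?K + 1) > 0" using e by (rule divide_pos_pos[rotated])
        then have "norm (T' (\<lambda>z. ?w z * g z)) \<le> 0 + ?K * (e / (?K + 1))" using \<open>\<And>e. e > 0 \<Longrightarrow> norm (T' (\<lambda>z. ?w z * g z)) \<le> 0 + ?K * e\<close> by blast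
        also have "\<dots> \<le> (?K + 1) * (e / (?K + 1))" using \<open>e / (?K + 1) > 0\<close> unfolding add_0_left by (intro mult_right_mono) auto
        also have "\<dots> = 0 + e"
        proof -
          have "?K + 1 \<noteq> 0" using C by linarith
          then show ?thesis by simp
        qed
        finally show ?thesis .
      qed
      then have "norm (T' (\<lambda>z. ?w z * g z)) \<le> 0" by (rule field_le_epsilon)
      then show ?thesis by simp
    qed
    have zero: "T' h = 0" if "h \<in> closure_alg X" for h
    proof (rule functional_eq_0[OF fP wP T'(2,3,4)])
      show "T' (\<lambda>z. ?w z * g z) = 0" if "g \<in> closure_alg X" for g by (rule Tw'[OF that])
      show "\<exists>G\<in>closure_alg X. \<exists>H\<in>closure_alg X. \<forall>z\<in>X. (?f z - b) * G z + ?w z * H z = 1" for b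
        using True by (rule spec)
    qed (use that in blast)+
    have "moment k 0 = 0" for k
    proof -
      have m: "(\<lambda>z. mono 0 k z * 1) \<in> trig_poly" by (rule mono_trig_poly[OF trig_poly.const])
      have "T (\<lambda>z. mono 0 k z * 1) = 0"
        unfolding T'(1)[OF m, symmetric] by (rule zero[OF trig_poly_closure[OF m]])
      then show ?thesis unfolding T_mono by simp
    qed
    then show ?thesis by blast
  next
    case False
    then obtain b where b: "\<not> (\<exists>G\<in>closure_alg X. \<exists>H\<in>closure_alg X. \<forall>z\<in>X. (?f z - b) * G z + ?w z * H z = 1)" by blast
    \<comment> \<open>Since f = (cnj z w + z) / 2 on the lines through z, subtracting
      \<open>b\<close> amounts to moving the origin to \<open>2 * b\<close>; the rest of the change
      is a multiple of \<open>w\<close>, which is absorbed by \<open>H\<close>.\<close>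
    define x0 where "x0 = 2 * b"
    define p where "p z = snd z - x0 \<bullet> cis (fst z)" for z :: "real \<times> real"
    define E0 where "E0 = (\<lambda>x. y x - x0) ` D0"
    define E1 where "E1 = (\<lambda>x. y x - x0) ` D1"
    have feq: "cis (fst z) * of_real (p z) = ?f z - b - (cnj x0 / 2) * ?w z" for z
    proof -
      define c where "c = cis (fst z)"
      have cc: "c * cnj c = 1" by (simp add: c_def cis_cnj cis_mult)
      have "of_real (x0 \<bullet> c) = (cnj x0 * c + x0 * cnj c) / 2"
        by (simp add: complex_eq_iff inner_complex_def)
      then have "c * of_real (p z) = c * of_real (snd z) - c * (cnj x0 * c + x0 * cnj c) / 2"
        by (simp add: p_def c_def right_diff_distrib)
      also have "c * (cnj x0 * c + x0 * cnj c) = cnj x0 * c^2 + x0" using cc by algebra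
      finally show ?thesis by (simp add: c_def x0_def add_divide_distrib)
    qed
    have im: "(\<lambda>x. y x - x0) ` S = (\<lambda>z. - x0 + z) ` (y ` S)" for S by (simp add: image_image)
    interpret line_algebra X "closure_alg X" "\<lambda>z. cis (fst z)" p E0 E1
    proof
      show "norm (cis (fst z)) = 1" for z :: "real \<times> real" by simp
      show "?w \<in> closure_alg X" by (rule wP)
      show "(\<lambda>z. cis (fst z) * of_real (p z)) \<in> closure_alg X"
        unfolding feq by (intro algebra_intros fP wP)
      show "open E0" unfolding E0_def im
        by (intro open_translation open_surjective_linear_image D0 y_linear y_surj)
      show "convex E0" unfolding E0_def im by (intro convex_translation convex_linear_image D0 y_linear)
      show "E0 \<noteq> {}" using D0 by (simp add: E0_def)
      show "compact E1" unfolding E1_def by (intro compact_continuous_image continuous_intros D1)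
      show "convex E1" unfolding E1_def im by (intro convex_translation convex_linear_image D1 y_linear)
      show "E1 \<noteq> {}" using D1 by (simp add: E1_def)
      show "x \<bullet> cis (fst z) \<noteq> p z" if "z \<in> X" "x \<in> E0" for z x
        using that by (auto simp: X_def E0_def p_def inner_diff_left)
      show "\<exists>x\<in>E1. x \<bullet> cis (fst z) = p z" if "z \<in> X" for z
        using that by (auto simp: X_def E1_def p_def inner_diff_left)
    qed
    have "\<not> regular"
    proof
      assume regular
      then obtain G H where G: "G \<in> closure_alg X" "H \<in> closure_alg X"
        "\<forall>z\<in>X. cis (fst z) * of_real (p z) * G z + ?w z * H z = 1" unfolding regular_def by blast
      have "(\<lambda>z. H z - (cnj x0 / 2) * G z) \<in> closure_alg X" by (intro algebra_intros G)
      moreover have "\<forall>z\<in>X. (?f z - b) * G z + ?w z * (H z - (cnj x0 / 2) * G z) = 1"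
        using G(3) unfolding feq by (simp add: algebra_simps)
      ultimately have "\<exists>H\<in>closure_alg X. \<forall>z\<in>X. (?f z - b) * G z + ?w z * H z = 1"
        by (intro bexI[of _ "\<lambda>z. H z - (cnj x0 / 2) * G z"])
      then have "\<exists>G\<in>closure_alg X. \<exists>H\<in>closure_alg X. \<forall>z\<in>X. (?f z - b) * G z + ?w z * H z = 1"
        using G(1) by (rule bexI)
      with b show False by (rule notE)
    qed
    then obtain v0 r where r: "norm v0 < r" "E0 \<subseteq> {x. v0 \<bullet> x + r * norm x \<le> 1}" "{x. v0 \<bullet> x + r * norm x \<le> 1} \<subseteq> E1"
      using ellipse_if_not_regular by blast
    have "x \<in> D1" if "v0 \<bullet> (y x - x0) + r * norm (y x - x0) \<le> 1" for x
    proof -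
      have "y x - x0 \<in> E1" using r(3) that by blast
      then obtain x' where "x' \<in> D1" "y x = y x'" by (auto simp: E1_def)
      then show ?thesis using y_inj by (auto simp: inj_def)
    qed
    moreover have "\<forall>x\<in>D0. v0 \<bullet> (y x - x0) + r * norm (y x - x0) \<le> 1" using r(2) by (auto simp: E0_def)
    ultimately show ?thesis using r(1) by blast
  qed
qed

end

end

section \<open>Moments determine an integrable function\<close>

lemma lebesgue_ex_borel_complex:
  fixes u :: "'a::euclidean_space \<Rightarrow> complex"
  assumes "u \<in> borel_measurable lebesgue"
  obtains v where "v \<in> borel_measurable lborel" "AE x in lborel. u x = v x"
proof -
  have "(\<lambda>x. Re (u x)) \<in> borel_measurable lebesgue" "(\<lambda>x. Im (u x)) \<in> borel_measurable lebesgue"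
    using assms by measurable
  then obtain a b where ab: "a \<in> borel_measurable lborel" "AE x in lborel. Re (u x) = a x"
    "b \<in> borel_measurable lborel" "AE x in lborel. Im (u x) = b x"
    using completion_ex_borel_measurable_real by metis
  show thesis
  proof (rule that[of "\<lambda>x. Complex (a x) (b x)"])
    have "(\<lambda>x. of_real (a x) + \<i> * of_real (b x)) \<in> borel_measurable lborel" using ab by measurable
    then show "(\<lambda>x. Complex (a x) (b x)) \<in> borel_measurable lborel" by (simp add: Complex_eq)
    show "AE x in lborel. u x = Complex (a x) (b x)" using ab(2,4) by eventually_elim (simp add: complex_eq_iff)
  qed
qed

text \<open>Cutoff functions approximate the indicator of a closed set, and the closed sets form an
  intersection-stable generator of the Borel sets.\<close>

lemma AE_eq_0_if_continuous_integrals_eq_0: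
  fixes v :: "'a::euclidean_space \<Rightarrow> complex"
  assumes v: "integrable lborel v"
    and zero: "\<And>\<psi> :: 'a \<Rightarrow> real. continuous_on UNIV \<psi> \<Longrightarrow> (\<And>x. 0 \<le> \<psi> x \<and> \<psi> x \<le> 1) \<Longrightarrow>
      (LINT x|lborel. \<psi> x *\<^sub>R v x) = 0"
  shows "AE x in lborel. v x = 0"
proof (rule sigma_finite_measure.density_zero[OF sigma_finite_lborel v])
  have closed: "(LINT x:C|lborel. v x) = 0" if C: "closed C" for C
  proof (cases "C = {}")
    case False
    define \<psi> where "\<psi> n x = max 0 (1 - real n * infdist x C)" for n x
    have lim: "(\<lambda>n. LINT x|lborel. \<psi> n x *\<^sub>R v x) \<longlonglongrightarrow> (LINT x|lborel. indicator C x *\<^sub>R v x)"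
    proof (rule integral_dominated_convergence)
      have [measurable]: "v \<in> borel_measurable borel" using borel_measurable_integrable[OF v] by simp
      have [measurable]: "C \<in> sets borel" using C by simp
      show "(\<lambda>x. indicator C x *\<^sub>R v x) \<in> borel_measurable lborel" by simp
      have [measurable]: "\<psi> n \<in> borel_measurable borel" for n
        unfolding \<psi>_def[abs_def] by (intro borel_measurable_continuous_onI continuous_intros)
      show "(\<lambda>x. \<psi> n x *\<^sub>R v x) \<in> borel_measurable lborel" for n by simp
      show "integrable lborel (\<lambda>x. norm (v x))" using v by (rule integrable_norm)
      show "AE x in lborel. norm (\<psi> n x *\<^sub>R v x) \<le> norm (v x)" for n
        by (intro AE_I2) (auto simp: \<psi>_def infdist_nonneg intro!: mult_left_le_one_le)
      show "AE x in lborel. (\<lambda>n. \<psi> n x *\<^sub>R v x) \<longlonglongrightarrow> indicator C x *\<^sub>R v x"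
      proof (intro AE_I2 tendsto_scaleR tendsto_const)
        fix x
        show "(\<lambda>n. \<psi> n x) \<longlonglongrightarrow> indicator C x"
        proof (cases "x \<in> C")
          case True then show ?thesis by (simp add: \<psi>_def)
        next
          case x: False
          then have pos: "infdist x C > 0"
            using in_closed_iff_infdist_zero[OF C False] infdist_nonneg[of x C] by (simp add: less_le)
          obtain N :: nat where N: "1 / infdist x C < real N" using reals_Archimedean2 by blast
          have "\<psi> n x = 0" if "n \<ge> N" for n
          proof -
            have "1 / infdist x C < real n" using N that by linarith
            then have "1 < real n * infdist x C" using pos by (simp add: field_simps)
            then show ?thesis by (simp add: \<psi>_def)
          qed
          then have "eventually (\<lambda>n. \<psi> n x = indicator C x) sequentially"
            using x by (auto simp: eventually_sequentially)
          then show ?thesis by (rule tendsto_eventually)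
        qed
      qed
    qed
    have "(LINT x|lborel. \<psi> n x *\<^sub>R v x) = 0" for n
      by (rule zero) (auto simp: \<psi>_def infdist_nonneg intro!: continuous_intros)
    then have "(\<lambda>n. 0) \<longlonglongrightarrow> (LINT x|lborel. indicator C x *\<^sub>R v x)" using lim by simp
    then show ?thesis by (simp add: set_lebesgue_integral_def LIMSEQ_const_iff)
  qed (simp add: set_lebesgue_integral_def)
  have si: "set_integrable lborel A v" if "A \<in> sets borel" for A
    using v that unfolding set_integrable_def by (intro integrable_mult_indicator) auto
  fix A :: "'a set" assume "A \<in> sets lborel"
  then have sA: "A \<in> sigma_sets UNIV (Collect closed)" using borel_eq_closed by (metis sets_lborel sets_measure_of top_greatest Pow_UNIV)
  have "Int_stable (Collect closed :: 'a set set)" by (auto simp: Int_stable_def)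
  moreover have "Collect closed \<subseteq> Pow (UNIV :: 'a set)" by simp
  moreover note sA
  ultimately show "(LINT x:A|lborel. v x) = 0"
  proof (induction rule: sigma_sets_induct_disjoint[consumes 3, case_names basic empty compl union])
    case (basic A) then show ?case using closed by simp
  next
    case empty then show ?case by (simp add: set_lebesgue_integral_def)
  next
    case (compl A)
    then have A: "A \<in> sets borel" using borel_eq_closed by (metis sets_measure_of top_greatest Pow_UNIV)
    have "(LINT x:UNIV|lborel. v x) = (LINT x:A \<union> (UNIV - A)|lborel. v x)" by simp
    also have "\<dots> = (LINT x:A|lborel. v x) + (LINT x:UNIV - A|lborel. v x)"
      using A by (intro set_integral_Un si) auto
    finally show ?case using compl closed[of UNIV] by simp
  next
    case (union A)
    then have A: "\<And>i. A i \<in> sets borel" using borel_eq_closed by (metis sets_measure_of top_greatest Pow_UNIV rangeI subset_iff)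
    then have U: "(\<Union>i. A i) \<in> sets borel" by blast
    have "(LINT x:(\<Union>i. A i)|lborel. v x) = (\<Sum>i. (LINT x:A i|lborel. v x))"
      using union.hyps(1) A si[OF U] by (intro lebesgue_integral_countable_add) (auto simp: disjoint_family_on_def)
    then show ?case using union by simp
  qed
qed

context radon_data
begin

text \<open>The holomorphic moment of order \<open>a + b\<close> is a polynomial in \<tau> whose
  coefficient of degree \<open>b\<close> is a nonzero multiple of the integral in question. It has
  all positive \<tau> as roots, so every coefficient is 0.\<close>

lemma integral_monomial_eq_0:
  assumes zero: "\<And>\<tau> k. \<tau> > 0 \<Longrightarrow> moment \<tau> k 0 = 0"
  shows "(LINT x|lebesgue. u x * of_real (x $ 1 ^ a * x $ 2 ^ b)) = 0"
proof -
  define M where "M j = (LINT x|lebesgue. u x * of_real (x $ 1 ^ (a + b - j) * x $ 2 ^ j))" for j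
  define c where "c j = of_nat ((a + b) choose j) * \<i> ^ j * M j" for j
  have cont: "continuous_on UNIV (\<lambda>x::real^2. complex_of_real (x $ 1 ^ i * x $ 2 ^ j))" for i j
    by (intro continuous_intros)
  have "(\<Sum>j\<le>a + b. c j * of_real \<tau> ^ j) = 0" if \<tau>: "\<tau> > 0" for \<tau> :: real
  proof -
    have "u x * (y \<tau> x ^ (a + b) * cnj (y \<tau> x) ^ 0) =
      (\<Sum>j\<le>a + b. (of_nat ((a + b) choose j) * \<i> ^ j * of_real \<tau> ^ j) * (u x * of_real (x $ 1 ^ (a + b - j) * x $ 2 ^ j)))" for x
    proof -
      have "y \<tau> x = \<i> * of_real \<tau> * of_real (x $ 2) + of_real (x $ 1)" by (simp add: y_def[OF \<tau>] Complex_eq)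
      then have "y \<tau> x ^ (a + b) = (\<Sum>j\<le>a + b. of_nat ((a + b) choose j) * (\<i> * of_real \<tau> * of_real (x $ 2)) ^ j * of_real (x $ 1) ^ (a + b - j))"
        by (simp only: binomial_ring)
      then show ?thesis by (simp add: sum_distrib_left power_mult_distrib mult_ac)
    qed
    then have "moment \<tau> (a + b) 0 = (LINT x|lebesgue. (\<Sum>j\<le>a + b. (of_nat ((a + b) choose j) * \<i> ^ j * of_real \<tau> ^ j) * (u x * of_real (x $ 1 ^ (a + b - j) * x $ 2 ^ j))))"
      by (simp only: moment_def[OF \<tau>])
    also have "\<dots> = (\<Sum>j\<le>a + b. (of_nat ((a + b) choose j) * \<i> ^ j * of_real \<tau> ^ j) * M j)"
      unfolding M_def
      by (subst Bochner_Integration.integral_sum) (intro integrable_mult_right integrable_mult_continuous cont, simp)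
    finally show ?thesis using zero[OF \<tau>] by (simp add: c_def mult_ac)
  qed
  then have "complex_of_real ` {0<..} \<subseteq> {z. (\<Sum>j\<le>a + b. c j * z ^ j) = 0}" by auto
  moreover have "infinite (complex_of_real ` {0<..})"
    by (subst finite_image_iff) (auto simp: inj_on_def infinite_Ioi)
  ultimately have "infinite {z. (\<Sum>j\<le>a + b. c j * z ^ j) = 0}" using finite_subset by blast
  then have "\<forall>j\<le>a + b. c j = 0" using polyfun_finite_roots[where n = "a + b" and c = c] by blast
  then have "c b = 0" by simp
  then show ?thesis by (simp add: c_def M_def)
qed

lemma AE_eq_0_if_moments_eq_0:
  assumes zero: "\<And>\<tau> k. \<tau> > 0 \<Longrightarrow> moment \<tau> k 0 = 0"
  shows "AE x in lebesgue. u x = 0"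
proof -
  \<comment> \<open>Functions that integrate to 0 against \<open>u\<close> even after multiplication
    by any monomial. This stronger property survives multiplication by a coordinate, hence by a
    polynomial.\<close>
  define \<G> :: "((real^2) \<Rightarrow> real) set" where
    "\<G> = {g. continuous_on UNIV g \<and> (\<forall>a b. (LINT x|lebesgue. u x * of_real (x $ 1 ^ a * x $ 2 ^ b * g x)) = 0)}"
  have cont: "continuous_on UNIV (\<lambda>x::real^2. complex_of_real (x $ 1 ^ i * x $ 2 ^ j * g x))" if "continuous_on UNIV g" for i j g
    by (intro continuous_intros that)
  have Gadd: "(\<lambda>x. g x + h x) \<in> \<G>" if gh: "g \<in> \<G>" "h \<in> \<G>" for g h
  proof -
    have "(LINT x|lebesgue. u x * of_real (x $ 1 ^ a * x $ 2 ^ b * (g x + h x))) = 0" for a b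
    proof -
      have "(LINT x|lebesgue. u x * of_real (x $ 1 ^ a * x $ 2 ^ b * (g x + h x))) =
        (LINT x|lebesgue. u x * of_real (x $ 1 ^ a * x $ 2 ^ b * g x) + u x * of_real (x $ 1 ^ a * x $ 2 ^ b * h x))"
        by (simp add: algebra_simps)
      also have "\<dots> = 0"
        using gh by (subst Bochner_Integration.integral_add) (auto simp: \<G>_def simp del: of_real_mult intro!: integrable_mult_continuous cont)
      finally show ?thesis .
    qed
    then show ?thesis using gh by (auto simp: \<G>_def intro: continuous_on_add)
  qed
  have Gc: "(\<lambda>x. g x * c) \<in> \<G>" if g: "g \<in> \<G>" for g c
  proof -
    have "(LINT x|lebesgue. u x * of_real (x $ 1 ^ a * x $ 2 ^ b * (g x * c))) =
      of_real c * (LINT x|lebesgue. u x * of_real (x $ 1 ^ a * x $ 2 ^ b * g x))" for a b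
      by (subst Bochner_Integration.integral_mult_right_zero[symmetric]) (simp add: mult_ac)
    then show ?thesis using g by (auto simp: \<G>_def intro: continuous_intros)
  qed
  have G1: "(\<lambda>x. g x * x $ 1) \<in> \<G>" and G2: "(\<lambda>x. g x * x $ 2) \<in> \<G>" if g: "g \<in> \<G>" for g
  proof -
    have z: "(LINT x|lebesgue. u x * of_real (x $ 1 ^ a * x $ 2 ^ b * g x)) = 0" for a b
      using g unfolding \<G>_def by blast
    have "(LINT x|lebesgue. u x * of_real (x $ 1 ^ a * x $ 2 ^ b * (g x * x $ 1))) = 0" for a b
      using z[of "Suc a" b] by (simp add: mult_ac)
    moreover have "(LINT x|lebesgue. u x * of_real (x $ 1 ^ a * x $ 2 ^ b * (g x * x $ 2))) = 0" for a b
      using z[of a "Suc b"] by (simp add: mult_ac)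
    ultimately show "(\<lambda>x. g x * x $ 1) \<in> \<G>" "(\<lambda>x. g x * x $ 2) \<in> \<G>"
      using g by (auto simp: \<G>_def simp del: of_real_mult intro!: continuous_intros)
  qed
  have poly: "\<forall>g\<in>\<G>. (\<lambda>x. g x * h x) \<in> \<G>" if "real_polynomial_function h" for h
    using that
  proof (induction rule: real_polynomial_function.induct)
    case (linear f)
    have fx: "f x = x $ 1 * f (axis 1 1) + x $ 2 * f (axis 2 1)" for x
    proof -
      have "x = x $ 1 *\<^sub>R axis 1 1 + x $ 2 *\<^sub>R axis 2 1"
        by (simp add: vec_eq_iff forall_2 axis_def)
      then have "f x = f (x $ 1 *\<^sub>R axis 1 1 + x $ 2 *\<^sub>R axis 2 1)" by simp
      then show ?thesis using linear by (simp add: bounded_linear.linear linear_add linear_scale)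
    qed
    show ?case
    proof
      fix g assume "g \<in> \<G>"
      then have "(\<lambda>x. g x * x $ 1 * f (axis 1 1) + g x * x $ 2 * f (axis 2 1)) \<in> \<G>"
        by (intro Gadd Gc G1 G2)
      moreover have "g x * f x = g x * x $ 1 * f (axis 1 1) + g x * x $ 2 * f (axis 2 1)" for x
        by (simp only: fx[of x] distrib_left mult.assoc)
      ultimately show "(\<lambda>x. g x * f x) \<in> \<G>" by presburger
    qed
  next
    case (const c) then show ?case using Gc by blast
  next
    case (add f g) then show ?case using Gadd by (simp add: distrib_left)
  next
    case (mult f g) then show ?case by (simp add: mult.assoc[symmetric])
  qed
  have one: "(\<lambda>_. 1) \<in> \<G>"
    using integral_monomial_eq_0[OF zero] by (simp add: \<G>_def continuous_on_const)
  have poly0: "(LINT x|lebesgue. u x * of_real (h x)) = 0" "continuous_on UNIV h" if "real_polynomial_function h" for h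
  proof -
    have "(\<lambda>x. 1 * h x) \<in> \<G>" by (rule bspec[OF poly[OF that] one])
    then have h: "continuous_on UNIV h" "\<And>a b. (LINT x|lebesgue. u x * of_real (x $ 1 ^ a * x $ 2 ^ b * h x)) = 0"
      by (auto simp: \<G>_def simp del: of_real_mult)
    from h(2)[of 0 0] h(1) show "(LINT x|lebesgue. u x * of_real (h x)) = 0" "continuous_on UNIV h" by simp_all
  qed
  have cont0: "(LINT x|lebesgue. u x * of_real (\<psi> x)) = 0" if \<psi>: "continuous_on UNIV \<psi>" for \<psi> :: "real^2 \<Rightarrow> real"
  proof -
    let ?K = "LINT x|lebesgue. norm (u x)"
    have "norm (LINT x|lebesgue. u x * of_real (\<psi> x)) \<le> 0 + e" if e: "e > 0" for e
    proof -
      have K: "?K \<ge> 0" by simp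
      then have e': "e / (?K + 1) > 0" using e by (intro divide_pos_pos) linarith+
      obtain h where h: "real_polynomial_function h" "\<And>x. x \<in> D1 \<Longrightarrow> \<bar>\<psi> x - h x\<bar> < e / (?K + 1)"
        using Stone_Weierstrass_real_polynomial_function[OF D1(1) continuous_on_subset[OF \<psi> subset_UNIV] e'] by blast
      have ih: "integrable lebesgue (\<lambda>x. u x * of_real (h x))" "integrable lebesgue (\<lambda>x. u x * of_real (\<psi> x))"
        by (intro integrable_mult_continuous continuous_intros poly0(2)[OF h(1)] \<psi>)+
      have "(LINT x|lebesgue. u x * of_real (\<psi> x)) = (LINT x|lebesgue. u x * of_real (\<psi> x) - u x * of_real (h x))"
        using poly0(1)[OF h(1)] by (simp add: Bochner_Integration.integral_diff[OF ih(2,1)])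
      also have "norm \<dots> \<le> (LINT x|lebesgue. norm (u x * of_real (\<psi> x) - u x * of_real (h x)))"
        by (rule integral_norm_bound)
      also have "\<dots> \<le> (LINT x|lebesgue. norm (u x) * (e / (?K + 1)))"
      proof (rule integral_mono_AE)
        show "integrable lebesgue (\<lambda>x. norm (u x * of_real (\<psi> x) - u x * of_real (h x)))"
          using ih by (intro integrable_norm Bochner_Integration.integrable_diff)
        show "integrable lebesgue (\<lambda>x. norm (u x) * (e / (?K + 1)))" using int by (intro integrable_mult_left integrable_norm)
        show "AE x in lebesgue. norm (u x * of_real (\<psi> x) - u x * of_real (h x)) \<le> norm (u x) * (e / (?K + 1))"
          using out
        proof eventually_elim
          case (elim x)
          have eq: "norm (u x * of_real (\<psi> x) - u x * of_real (h x)) = norm (u x) * \<bar>\<psi> x - h x\<bar>"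
            by (simp only: right_diff_distrib[symmetric] of_real_diff[symmetric] norm_mult norm_of_real)
          show ?case
          proof (cases "x \<in> D1")
            case True
            then show ?thesis unfolding eq by (intro mult_left_mono less_imp_le[OF h(2)] norm_ge_zero)
          qed (use elim in simp)
        qed
      qed
      also have "\<dots> = ?K * (e / (?K + 1))" by (rule integral_mult_left_zero)
      also have "\<dots> \<le> (?K + 1) * (e / (?K + 1))" using e' by (intro mult_right_mono) auto
      also have "\<dots> = 0 + e"
      proof -
        have "?K + 1 \<noteq> 0" using K by linarith
        then show ?thesis by simp
      qed
      finally show ?thesis .
    qed
    then have "norm (LINT x|lebesgue. u x * of_real (\<psi> x)) \<le> 0" by (rule field_le_epsilon)
    then show ?thesis by simp
  qed
  obtain v where v: "v \<in> borel_measurable lborel" "AE x in lborel. u x = v x"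
    using lebesgue_ex_borel_complex[OF borel_measurable_integrable[OF int]] by blast
  have uv: "AE x in lebesgue. u x = v x" using v(2) by (rule AE_completion)
  have vm: "v \<in> borel_measurable lebesgue" using v(1) by (rule measurable_completion)
  have um: "u \<in> borel_measurable lebesgue" by (rule borel_measurable_integrable[OF int])
  have "integrable lebesgue v" using int integrable_cong_AE[OF um vm uv] by simp
  then have vi: "integrable lborel v" using integrable_completion[OF v(1)] by simp
  have "AE x in lborel. v x = 0"
  proof (rule AE_eq_0_if_continuous_integrals_eq_0[OF vi])
    fix \<psi> :: "real^2 \<Rightarrow> real" assume \<psi>: "continuous_on UNIV \<psi>"
    have pm: "\<psi> \<in> borel_measurable lborel" using borel_measurable_continuous_onI[OF \<psi>] by simp
    then have pm': "\<psi> \<in> borel_measurable lebesgue" by (rule measurable_completion)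
    have "(LINT x|lborel. \<psi> x *\<^sub>R v x) = (LINT x|lebesgue. \<psi> x *\<^sub>R v x)"
      by (intro integral_completion[symmetric] borel_measurable_scaleR pm v(1))
    also have "\<dots> = (LINT x|lebesgue. u x * of_real (\<psi> x))"
    proof (rule integral_cong_AE)
      show "(\<lambda>x. \<psi> x *\<^sub>R v x) \<in> borel_measurable lebesgue" "(\<lambda>x. u x * of_real (\<psi> x)) \<in> borel_measurable lebesgue"
        using pm' by (intro borel_measurable_scaleR borel_measurable_times vm um, measurable)+
      show "AE x in lebesgue. \<psi> x *\<^sub>R v x = u x * of_real (\<psi> x)"
        using uv by eventually_elim (simp add: scaleR_conv_of_real)
    qed
    also have "\<dots> = 0" by (rule cont0[OF \<psi>])
    finally show "(LINT x|lborel. \<psi> x *\<^sub>R v x) = 0" .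
  qed
  then have "AE x in lebesgue. v x = 0" by (rule AE_completion)
  with uv show ?thesis by eventually_elim simp
qed

end

section \<open>Lines and the Radon transform\<close>

lemma norm_vec2: "norm (x :: real^2) ^ 2 = x $ 1 ^ 2 + x $ 2 ^ 2"
  unfolding power2_norm_eq_inner by (simp add: inner_vec_def sum_2 power2_eq_square)

lemma distr_vector_lborel:
  "distr (lborel \<Otimes>\<^sub>M lborel) borel (\<lambda>(p, t). vector [p, t] :: real^2) = lborel"
proof (rule lborel_eqI[symmetric])
  have c: "continuous_on UNIV (\<lambda>(p, t). vector [p, t] :: real^2)"
  proof -
    have "(\<lambda>(p, t). vector [p, t] :: real^2) = (\<lambda>q. fst q *\<^sub>R axis 1 1 + snd q *\<^sub>R axis 2 1)"
      by (auto simp: vec_eq_iff forall_2 axis_def)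
    then show ?thesis by (auto intro!: continuous_intros)
  qed
  then have m[measurable]: "(\<lambda>(p, t). vector [p, t] :: real^2) \<in> lborel \<Otimes>\<^sub>M lborel \<rightarrow>\<^sub>M borel"
    unfolding lborel_prod using borel_measurable_continuous_onI[OF c] by simp
  fix l u :: "real^2" assume le: "\<And>b. b \<in> Basis \<Longrightarrow> l \<bullet> b \<le> u \<bullet> b"
  have lu: "l $ i \<le> u $ i" for i using le[of "axis i 1"] by (simp add: inner_axis axis_in_Basis_iff)
  have "(\<lambda>(p, t). vector [p, t] :: real^2) -` box l u = {l $ 1 <..< u $ 1} \<times> {l $ 2 <..< u $ 2}"
    by (auto simp: mem_box_cart forall_2)
  then have "emeasure (distr (lborel \<Otimes>\<^sub>M lborel) borel (\<lambda>(p, t). vector [p, t] :: real^2)) (box l u)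
    = emeasure (lborel \<Otimes>\<^sub>M lborel) ({l $ 1 <..< u $ 1} \<times> {l $ 2 <..< u $ 2})"
    by (subst emeasure_distr[OF m]) (auto simp: space_pair_measure)
  also have "\<dots> = ennreal (u $ 1 - l $ 1) * ennreal (u $ 2 - l $ 2)"
    using lu by (subst lborel.emeasure_pair_measure_Times) auto
  also have "\<dots> = ennreal (\<Prod>b\<in>Basis. (u - l) \<bullet> b)"
  proof -
    have "(\<Prod>b\<in>Basis. (u - l) \<bullet> b) = (\<Prod>i\<in>UNIV. (u - l) $ i)"
    proof -
      have B: "(Basis :: (real^2) set) = range (\<lambda>i. axis i 1)" by (auto simp: Basis_vec_def)
      have "inj (\<lambda>i::2. axis i (1::real))" by (auto simp: inj_def axis_eq_axis)
      then show ?thesis unfolding B by (simp add: prod.reindex inner_axis)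
    qed
    also have "\<dots> = (u $ 1 - l $ 1) * (u $ 2 - l $ 2)" by (simp add: UNIV_2)
    finally show ?thesis using lu by (simp add: ennreal_mult)
  qed
  finally show "emeasure (distr (lborel \<Otimes>\<^sub>M lborel) borel (\<lambda>(p, t). vector [p, t] :: real^2)) (box l u) = ennreal (\<Prod>b\<in>Basis. (u - l) \<bullet> b)" .
qed simp

lemma distr_orthogonal_lborel:
  fixes A :: "real^2 \<Rightarrow> real^2"
  assumes A: "orthogonal_transformation A"
  shows "distr lborel borel A = lborel"
proof (rule lborel_eqI[symmetric])
  have m[measurable]: "A \<in> lborel \<rightarrow>\<^sub>M borel"
    using borel_measurable_continuous_onI[OF linear_continuous_on[OF linear_conv_bounded_linear[THEN iffD1, OF orthogonal_transformation_linear[OF A]]]]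
    by simp
  obtain B where B: "orthogonal_transformation B" "A \<circ> B = id" "B \<circ> A = id"
    using orthogonal_transformation_inv[OF A] orthogonal_transformation_bij[OF A]
    by (metis bij_is_inj bij_is_surj inv_o_cancel surj_iff)
  fix l u :: "real^2" assume le: "\<And>b. b \<in> Basis \<Longrightarrow> l \<bullet> b \<le> u \<bullet> b"
  have vim: "A -` box l u = B ` box l u"
    using B(2,3) by (auto simp: fun_eq_iff image_iff) metis
  have bx: "box l u \<in> lmeasurable" by simp
  have "emeasure (distr lborel borel A) (box l u) = emeasure lborel (A -` box l u)"
    by (subst emeasure_distr[OF m]) auto
  also have "\<dots> = emeasure lebesgue (B ` box l u)"
  proof -
    have "A -` box l u \<in> sets lborel" using measurable_sets[OF m, of "box l u"] by simp
    then show ?thesis unfolding vim by simp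
  qed
  also have "\<dots> = ennreal (measure lebesgue (B ` box l u))"
    using measurable_orthogonal_image[OF B(1) bx] by (simp add: emeasure_eq_measure2 fmeasurableD)
  also have "\<dots> = ennreal (measure lebesgue (box l u))" using measure_orthogonal_image[OF B(1) bx] by simp
  also have "\<dots> = ennreal (\<Prod>b\<in>Basis. (u - l) \<bullet> b)" using le by (simp add: measure_lborel_box)
  finally show "emeasure (distr lborel borel A) (box l u) = ennreal (\<Prod>b\<in>Basis. (u - l) \<bullet> b)" .
qed simp

lemma perp_simps: "perp \<omega> $ 1 = - (\<omega> $ 2)" "perp \<omega> $ 2 = \<omega> $ 1"
  by (simp_all add: perp_def)

lemma line_param_continuous: "continuous_on S (\<lambda>q. fst q *\<^sub>R \<omega> + snd q *\<^sub>R perp \<omega>)"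
  by (intro continuous_intros)

lemma line_param_measurable:
  "(\<lambda>q. fst q *\<^sub>R \<omega> + snd q *\<^sub>R perp \<omega>) \<in> lborel \<Otimes>\<^sub>M lborel \<rightarrow>\<^sub>M borel"
  unfolding lborel_prod using borel_measurable_continuous_onI[OF line_param_continuous] by simp

text \<open>Coordinates adapted to the direction are rotated Cartesian coordinates, so Fubini's
  theorem in them produces the line integrals of \<open>radon\<close>.\<close>

lemma distr_line_param:
  assumes \<omega>: "norm \<omega> = 1"
  shows "distr (lborel \<Otimes>\<^sub>M lborel) borel (\<lambda>q. fst q *\<^sub>R \<omega> + snd q *\<^sub>R perp \<omega>) = lborel"
proof -
  define A :: "real^2 \<Rightarrow> real^2" where "A x = x $ 1 *\<^sub>R \<omega> + x $ 2 *\<^sub>R perp \<omega>" for x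
  have w: "\<omega> $ 1 ^ 2 + \<omega> $ 2 ^ 2 = 1" using norm_vec2[of \<omega>] \<omega> by simp
  have "linear A" unfolding A_def by (intro linearI) (auto simp: algebra_simps)
  moreover have "norm (A x) = norm x" for x
  proof -
    have "(norm (A x))^2 = (x $ 1 ^ 2 + x $ 2 ^ 2) * (\<omega> $ 1 ^ 2 + \<omega> $ 2 ^ 2)"
      unfolding norm_vec2 by (simp add: A_def perp_simps) algebra
    then have "(norm (A x))^2 = (norm x)^2" unfolding w norm_vec2 by simp
    then show ?thesis by simp
  qed
  ultimately have A: "orthogonal_transformation A" by (simp add: orthogonal_transformation)
  have mA: "A \<in> borel_measurable borel"
    using borel_measurable_continuous_onI[OF linear_continuous_on[OF linear_conv_bounded_linear[THEN iffD1, OF \<open>linear A\<close>]]] .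
  have mv: "(\<lambda>(p, t). vector [p, t] :: real^2) \<in> lborel \<Otimes>\<^sub>M lborel \<rightarrow>\<^sub>M borel"
  proof -
    have "(\<lambda>(p, t). vector [p, t] :: real^2) = (\<lambda>q. fst q *\<^sub>R axis 1 1 + snd q *\<^sub>R axis 2 1)"
      by (auto simp: vec_eq_iff forall_2 axis_def)
    then have "continuous_on UNIV (\<lambda>(p, t). vector [p, t] :: real^2)" by (auto intro!: continuous_intros)
    then show ?thesis unfolding lborel_prod using borel_measurable_continuous_onI by fastforce
  qed
  have "distr (lborel \<Otimes>\<^sub>M lborel) borel (\<lambda>q. fst q *\<^sub>R \<omega> + snd q *\<^sub>R perp \<omega>)
     = distr (distr (lborel \<Otimes>\<^sub>M lborel) borel (\<lambda>(p, t). vector [p, t] :: real^2)) borel A"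
    by (subst distr_distr[OF mA mv]) (auto intro!: distr_cong simp: A_def)
  also have "\<dots> = lborel" unfolding distr_vector_lborel by (rule distr_orthogonal_lborel[OF A])
  finally show ?thesis .
qed

text \<open>Fubini with the position on the line as inner variable: along each line the indicator of
  the strip and \<psi> are constant, which leaves the Radon transform. Measurability forces the
  detour through a Borel version \<open>v\<close>; almost every line of the given direction meets
  the exceptional null set in a null set.\<close>

lemma integral_gap_eq_0_if_radon:
  fixes u :: "real^2 \<Rightarrow> complex"
  assumes int: "integrable lebesgue u" and D0: "open D0" and \<omega>: "norm \<omega> = 1"
    and \<psi>: "continuous_on UNIV \<psi>" "\<And>s. norm (\<psi> s) \<le> B"
    and rad: "AE p in lborel. line \<omega> p \<inter> D0 \<noteq> {} \<longrightarrow> radon u \<omega> p = 0"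
  shows "(LINT x:gap D0 \<omega>|lebesgue. u x * \<psi> (x \<bullet> \<omega>)) = 0"
proof -
  obtain v where v: "v \<in> borel_measurable lborel" "AE x in lborel. u x = v x"
    using lebesgue_ex_borel_complex[OF borel_measurable_integrable[OF int]] by blast
  have uv: "AE x in lebesgue. u x = v x" using v(2) by (rule AE_completion)
  have vm: "v \<in> borel_measurable lebesgue" using v(1) by (rule measurable_completion)
  have um: "u \<in> borel_measurable lebesgue" by (rule borel_measurable_integrable[OF int])
  have "integrable lebesgue v" using int integrable_cong_AE[OF um vm uv] by simp
  then have vi: "integrable lborel v" using integrable_completion[OF v(1)] by simp
  let ?\<Phi> = "\<lambda>q. fst q *\<^sub>R \<omega> + snd q *\<^sub>R perp \<omega>"
  have ww: "\<omega> \<bullet> \<omega> = 1" using \<omega> by (simp add: dot_square_norm)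
  have pw: "perp \<omega> \<bullet> \<omega> = 0" by (simp add: inner_vec_def sum_2 perp_simps)
  have \<Phi>w: "?\<Phi> q \<bullet> \<omega> = fst q" for q by (simp add: inner_add_left ww pw)
  have G: "gap D0 \<omega> \<in> sets borel" using open_gap[OF D0] by simp
  define h where "h x = indicator (gap D0 \<omega>) x *\<^sub>R (v x * \<psi> (x \<bullet> \<omega>))" for x
  have [measurable]: "v \<in> borel_measurable borel" using v(1) by simp
  have [measurable]: "(\<lambda>x::real^2. \<psi> (x \<bullet> \<omega>)) \<in> borel_measurable borel"
    by (intro borel_measurable_continuous_onI continuous_on_compose2[OF \<psi>(1)] continuous_intros) auto
  have [measurable]: "gap D0 \<omega> \<in> sets borel" by (rule G)
  have hm: "h \<in> borel_measurable borel" unfolding h_def[abs_def] by measurable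
  have hi: "integrable lborel h"
  proof (rule Bochner_Integration.integrable_bound)
    show "integrable lborel (\<lambda>x. of_real B * v x)" using vi by (rule integrable_mult_right)
    show "h \<in> borel_measurable lborel" using hm by simp
    show "AE x in lborel. norm (h x) \<le> norm (of_real B * v x)"
    proof (intro AE_I2)
      fix x
      have "norm (\<psi> (x \<bullet> \<omega>)) \<le> \<bar>B\<bar>" using \<psi>(2)[of "x \<bullet> \<omega>"] by linarith
      then have "norm (v x) * norm (\<psi> (x \<bullet> \<omega>)) \<le> norm (v x) * \<bar>B\<bar>" by (intro mult_left_mono) auto
      then show "norm (h x) \<le> norm (of_real B * v x)"
        by (auto simp: h_def norm_mult indicator_def mult.commute)
    qed
  qed
  have "(LINT x:gap D0 \<omega>|lebesgue. u x * \<psi> (x \<bullet> \<omega>)) = (LINT x|lebesgue. h x)"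
    unfolding set_lebesgue_integral_def
  proof (rule integral_cong_AE)
    have "(\<lambda>x::real^2. \<psi> (x \<bullet> \<omega>)) \<in> borel_measurable lborel" by simp
    then have "(\<lambda>x::real^2. \<psi> (x \<bullet> \<omega>)) \<in> borel_measurable lebesgue" by (rule measurable_completion)
    moreover have "gap D0 \<omega> \<in> sets lebesgue" using G by simp
    ultimately show "(\<lambda>x. indicator (gap D0 \<omega>) x *\<^sub>R (u x * \<psi> (x \<bullet> \<omega>))) \<in> borel_measurable lebesgue"
      by (intro borel_measurable_scaleR borel_measurable_indicator borel_measurable_times um)
    have "h \<in> borel_measurable lborel" using hm by simp
    then show "h \<in> borel_measurable lebesgue" by (rule measurable_completion)
    show "AE x in lebesgue. indicator (gap D0 \<omega>) x *\<^sub>R (u x * \<psi> (x \<bullet> \<omega>)) = h x"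
      using uv by eventually_elim (simp add: h_def)
  qed
  also have "\<dots> = (LINT x|lborel. h x)" using hm by (intro integral_completion) simp
  also have "\<dots> = (LINT x|distr (lborel \<Otimes>\<^sub>M lborel) borel ?\<Phi>. h x)" by (simp add: distr_line_param[OF \<omega>])
  also have "\<dots> = (LINT q|(lborel \<Otimes>\<^sub>M lborel). h (?\<Phi> q))"
    by (rule integral_distr[OF line_param_measurable hm])
  also have "\<dots> = (LINT p|lborel. (LINT t|lborel. h (?\<Phi> (p, t))))"
  proof (rule lborel_pair.integral_fst'[symmetric])
    have "integrable (distr (lborel \<Otimes>\<^sub>M lborel) borel ?\<Phi>) h" using hi by (simp add: distr_line_param[OF \<omega>])
    then show "integrable (lborel \<Otimes>\<^sub>M lborel) (\<lambda>q. h (?\<Phi> q))"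
      using integrable_distr_eq[OF line_param_measurable hm] by simp
  qed
  also have "\<dots> = 0"
  proof (rule integral_eq_zero_AE)
    have "AE x in distr (lborel \<Otimes>\<^sub>M lborel) borel ?\<Phi>. u x = v x"
      unfolding distr_line_param[OF \<omega>] by (rule v(2))
    then have "AE q in lborel \<Otimes>\<^sub>M lborel. u (?\<Phi> q) = v (?\<Phi> q)"
      by (rule AE_distrD[OF line_param_measurable])
    then have "AE p in lborel. AE t in lborel. u (?\<Phi> (p, t)) = v (?\<Phi> (p, t))"
      by (rule lborel_pair.AE_pair)
    then show "AE p in lborel. (LINT t|lborel. h (?\<Phi> (p, t))) = 0"
      using rad
    proof eventually_elim
      case (elim p)
      have "h (?\<Phi> (p, t)) = (indicator {p. line \<omega> p \<inter> D0 \<noteq> {}} p *\<^sub>R \<psi> p) * v (?\<Phi> (p, t))" for t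
      proof -
        have "?\<Phi> (p, t) \<in> gap D0 \<omega> \<longleftrightarrow> line \<omega> p \<inter> D0 \<noteq> {}"
          using \<Phi>w[of "(p, t)"] by (auto simp: gap_def line_def)
        then show ?thesis using \<Phi>w[of "(p, t)"] by (auto simp: h_def indicator_def)
      qed
      then have eq: "(LINT t|lborel. h (?\<Phi> (p, t))) = (indicator {p. line \<omega> p \<inter> D0 \<noteq> {}} p *\<^sub>R \<psi> p) * (LINT t|lborel. v (?\<Phi> (p, t)))"
        by simp
      have "(LINT t|lborel. v (?\<Phi> (p, t))) = radon u \<omega> p"
      proof -
        have "(\<lambda>t. ?\<Phi> (p, t)) \<in> borel_measurable borel"
          by (intro borel_measurable_continuous_onI) (auto intro!: continuous_intros)
        then have vpm: "(\<lambda>t. v (?\<Phi> (p, t))) \<in> borel_measurable lborel" by simp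
        then have vpl: "(\<lambda>t. v (?\<Phi> (p, t))) \<in> borel_measurable lebesgue" by (rule measurable_completion)
        have ae: "AE t in lebesgue. v (?\<Phi> (p, t)) = u (?\<Phi> (p, t))"
          using AE_completion[OF elim(1)] by eventually_elim simp
        have "(LINT t|lborel. v (?\<Phi> (p, t))) = (LINT t|lebesgue. v (?\<Phi> (p, t)))"
          by (rule integral_completion[OF vpm, symmetric])
        also have "\<dots> = (LINT t|lebesgue. u (?\<Phi> (p, t)))"
          by (rule integral_cong_AE[OF vpl borel_measurable_AE[OF vpl ae] ae])
        finally show ?thesis by (simp add: radon_def)
      qed
      then show ?case unfolding eq using elim(2) by (auto simp: indicator_def)
    qed
  qed
  finally show ?thesis .
qed

section \<open>From almost every direction to every direction\<close>

lemma measurable_circle: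
  "(\<lambda>\<theta>. vector [cos \<theta>, sin \<theta>] :: real^2) \<in> restrict_space lborel {0..<2*pi} \<rightarrow>\<^sub>M restrict_space borel (sphere 0 1)"
proof (rule measurable_restrict_space2)
  have "(\<lambda>\<theta>. vector [cos \<theta>, sin \<theta>] :: real^2) = (\<lambda>\<theta>. cos \<theta> *\<^sub>R axis 1 1 + sin \<theta> *\<^sub>R axis 2 1)"
    by (auto simp: vec_eq_iff forall_2 axis_def)
  moreover have "continuous_on UNIV (\<lambda>\<theta>. cos \<theta> *\<^sub>R axis 1 1 + sin \<theta> *\<^sub>R axis 2 1 :: real^2)"
    by (intro continuous_intros)
  ultimately have "(\<lambda>\<theta>. vector [cos \<theta>, sin \<theta>] :: real^2) \<in> lborel \<rightarrow>\<^sub>M borel"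
    using borel_measurable_continuous_onI by fastforce
  then show "(\<lambda>\<theta>. vector [cos \<theta>, sin \<theta>] :: real^2) \<in> restrict_space lborel {0..<2*pi} \<rightarrow>\<^sub>M borel"
    by (rule measurable_restrict_space1)
  have "norm (vector [cos \<theta>, sin \<theta>] :: real^2) = 1" for \<theta>
    by (rule power2_eq_imp_eq) (auto simp: norm_vec2)
  then show "(\<lambda>\<theta>. vector [cos \<theta>, sin \<theta>] :: real^2) \<in> space (restrict_space lborel {0..<2*pi}) \<rightarrow> sphere 0 1"
    by simp
qed

lemma finite_arc_length: "finite_measure arc_length"
  unfolding arc_length_def
proof (rule finite_measure.finite_measure_distr[OF _ measurable_circle])
  show "finite_measure (restrict_space lborel {0..<2*pi})"
    by (rule finite_measureI) (simp add: emeasure_restrict_space space_restrict_space)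
qed

lemma AE_supp: "AE x in lebesgue. x \<notin> supp u \<longrightarrow> u x = 0"
proof -
  define F where "F = {U. open U \<and> (AE x in lebesgue. x \<in> U \<longrightarrow> u x = 0)}"
  obtain F' where F': "F' \<subseteq> F" "countable F'" "\<Union>F' = \<Union>F"
    using Lindelof[of F] by (auto simp: F_def)
  have "AE x in lebesgue. \<forall>U\<in>F'. x \<in> U \<longrightarrow> u x = 0"
    using F'(1,2) by (subst AE_ball_countable) (auto simp: F_def)
  then show ?thesis
  proof eventually_elim
    case (elim x)
    show ?case
    proof
      assume "x \<notin> supp u"
      then have "x \<in> \<Union>F'" unfolding supp_def F'(3) F_def by blast
      then show "u x = 0" using elim by blast
    qed
  qed
qed

lemma closed_supp: "closed (supp u)"
  unfolding supp_def by (intro closed_Compl open_Union) auto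

lemma convex_gap: assumes "convex D0" shows "convex (gap D0 \<omega>)"
proof -
  have eq: "gap D0 \<omega> = (\<lambda>x. x \<bullet> \<omega>) -` ((\<lambda>x. x \<bullet> \<omega>) ` D0)"
    by (rule set_eqI) (simp add: gap_def image_iff, metis)
  have l: "linear (\<lambda>x. x \<bullet> \<omega>)" by (intro linearI) (auto simp: inner_add_left)
  show ?thesis unfolding eq by (intro convex_linear_vimage convex_linear_image l assms)
qed

lemma eventually_in_gap:
  assumes D0: "open D0" and \<omega>: "\<omega> \<noteq> 0" and lim: "W \<longlonglongrightarrow> \<omega>" and x: "x \<in> gap D0 \<omega>"
  shows "eventually (\<lambda>n. x \<in> gap D0 (W n)) sequentially"
proof -
  obtain y where y: "y \<in> D0" "y \<bullet> \<omega> = x \<bullet> \<omega>" using x by (auto simp: gap_def)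
  \<comment> \<open>The projection of \<open>y\<close> to the line through \<open>x\<close> with
    normal \<open>W n\<close>. It tends to \<open>y\<close>, so it ends up in
    \<open>D0\<close>.\<close>
  define z where "z n = y + (((x - y) \<bullet> W n) / (W n \<bullet> W n)) *\<^sub>R W n" for n
  have "z \<longlonglongrightarrow> y + (((x - y) \<bullet> \<omega>) / (\<omega> \<bullet> \<omega>)) *\<^sub>R \<omega>"
    unfolding z_def using \<omega> by (intro tendsto_intros lim) auto
  then have "z \<longlonglongrightarrow> y" using y(2) by (simp add: inner_diff_left)
  then have "eventually (\<lambda>n. z n \<in> D0) sequentially" using D0 y(1) topological_tendstoD by blast
  moreover have "eventually (\<lambda>n. W n \<noteq> 0) sequentially" using tendsto_imp_eventually_ne[OF lim \<omega>] .
  ultimately show ?thesis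
  proof eventually_elim
    case (elim n)
    have "z n \<bullet> W n = x \<bullet> W n" using elim(2) by (simp add: z_def inner_add_left inner_diff_left)
    then show ?case using elim(1) by (auto simp: gap_def)
  qed
qed

text \<open>Boundedness of \<open>D0\<close> enters here. If \<open>x\<close> were in infinitely
  many strips, points of \<open>D0\<close> on the corresponding lines would accumulate at a point of
  the closure of \<open>D0\<close> on the limit line, and \<open>x\<close> would be in the closure
  of the limit strip.\<close>

lemma eventually_notin_gap:
  assumes D0: "bounded D0" and lim: "W \<longlonglongrightarrow> \<omega>" and x: "x \<notin> closure (gap D0 \<omega>)"
  shows "eventually (\<lambda>n. x \<notin> gap D0 (W n)) sequentially"
proof (rule ccontr)
  assume "\<not> ?thesis"
  then have "\<exists>\<^sub>F n in sequentially. x \<in> gap D0 (W n)" by (simp add: not_eventually)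
  then have "infinite {n. x \<in> gap D0 (W n)}" by (simp add: frequently_cofinite flip: cofinite_eq_sequentially)
  then obtain s :: "nat \<Rightarrow> nat" where s: "strict_mono s" "\<And>n. x \<in> gap D0 (W (s n))"
    using infinite_enumerate by blast
  then obtain y where y: "\<And>n. y n \<in> D0" "\<And>n. y n \<bullet> W (s n) = x \<bullet> W (s n)" by (auto simp: gap_def) metis
  have "compact (closure D0)" using D0 by simp
  then obtain y0 r where r: "y0 \<in> closure D0" "strict_mono (r :: nat \<Rightarrow> nat)" "(y \<circ> r) \<longlonglongrightarrow> y0"
    using y(1) closure_subset[of D0] unfolding compact_def by (metis subsetD)
  have W: "(\<lambda>n. W (s (r n))) \<longlonglongrightarrow> \<omega>"
    using LIMSEQ_subseq_LIMSEQ[OF lim strict_mono_o[OF s(1) r(2)]] by (simp add: o_def)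
  have "(\<lambda>n. (y \<circ> r) n \<bullet> W (s (r n))) \<longlonglongrightarrow> y0 \<bullet> \<omega>" by (intro tendsto_inner r(3) W)
  moreover have "(\<lambda>n. x \<bullet> W (s (r n))) \<longlonglongrightarrow> x \<bullet> \<omega>" by (intro tendsto_inner tendsto_const W)
  moreover have "(\<lambda>n. (y \<circ> r) n \<bullet> W (s (r n))) = (\<lambda>n. x \<bullet> W (s (r n)))" using y(2) by simp
  ultimately have y0: "y0 \<bullet> \<omega> = x \<bullet> \<omega>" using LIMSEQ_unique by metis
  obtain c where c: "\<And>n::nat. c n \<in> D0" "c \<longlonglongrightarrow> y0" using r(1) closure_sequential by blast
  have "x + (c n - y0) \<in> gap D0 \<omega>" for n
    using c(1)[of n] y0 by (auto simp: gap_def inner_add_left inner_diff_left)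
  moreover have "(\<lambda>n. x + (c n - y0)) \<longlonglongrightarrow> x + (y0 - y0)" by (intro tendsto_intros c(2))
  ultimately have "x \<in> closure (gap D0 \<omega>)" unfolding closure_sequential by (auto intro!: exI[of _ "\<lambda>n. x + (c n - y0)"])
  then show False using x by simp
qed

text \<open>Dominated convergence in the direction: the indicators of the strips converge off the
  frontier of the limit strip, a null set because the strip is convex.\<close>

lemma integral_gap_limit:
  fixes u :: "real^2 \<Rightarrow> complex"
  assumes int: "integrable lebesgue u" and D0: "open D0" "convex D0" "bounded D0"
    and \<omega>: "\<omega> \<noteq> 0" and lim: "W \<longlonglongrightarrow> \<omega>"
    and \<psi>: "continuous_on UNIV \<psi>" "\<And>s. norm (\<psi> s) \<le> B"
    and zero: "\<And>n. (LINT x:gap D0 (W n)|lebesgue. u x * \<psi> (x \<bullet> W n)) = 0"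
  shows "(LINT x:gap D0 \<omega>|lebesgue. u x * \<psi> (x \<bullet> \<omega>)) = 0"
proof -
  have meas: "(\<lambda>x. indicator (gap D0 \<omega>) x *\<^sub>R (u x * \<psi> (x \<bullet> \<omega>))) \<in> borel_measurable lebesgue" for \<omega>
  proof -
    have "(\<lambda>x::real^2. \<psi> (x \<bullet> \<omega>)) \<in> borel_measurable lborel"
      using borel_measurable_continuous_onI[OF continuous_on_compose2[OF \<psi>(1), of UNIV "\<lambda>x::real^2. x \<bullet> \<omega>"]]
      by (simp add: continuous_intros)
    then have "(\<lambda>x::real^2. \<psi> (x \<bullet> \<omega>)) \<in> borel_measurable lebesgue" by (rule measurable_completion)
    moreover have "gap D0 \<omega> \<in> sets lebesgue" using open_gap[OF D0(1)] by simp
    ultimately show ?thesis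
      by (intro borel_measurable_scaleR borel_measurable_indicator borel_measurable_times borel_measurable_integrable[OF int])
  qed
  have "(\<lambda>n. LINT x|lebesgue. indicator (gap D0 (W n)) x *\<^sub>R (u x * \<psi> (x \<bullet> W n)))
    \<longlonglongrightarrow> (LINT x|lebesgue. indicator (gap D0 \<omega>) x *\<^sub>R (u x * \<psi> (x \<bullet> \<omega>)))"
  proof (rule integral_dominated_convergence[OF meas meas])
    show "integrable lebesgue (\<lambda>x. norm (u x) * B)" using int by (intro integrable_mult_left integrable_norm)
    have B: "B \<ge> 0" using \<psi>(2)[of 0] norm_ge_zero order_trans by blast
    show "AE x in lebesgue. norm (indicator (gap D0 (W n)) x *\<^sub>R (u x * \<psi> (x \<bullet> W n))) \<le> norm (u x) * B" for n
      using \<psi>(2) B by (intro AE_I2) (auto simp: norm_mult indicator_def intro!: mult_left_mono)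
    have "negligible (frontier (gap D0 \<omega>))" by (intro negligible_convex_frontier convex_gap D0)
    then have "AE x in lebesgue. x \<notin> frontier (gap D0 \<omega>)"
      by (intro AE_not_in) (simp add: negligible_iff_null_sets)
    then show "AE x in lebesgue. (\<lambda>n. indicator (gap D0 (W n)) x *\<^sub>R (u x * \<psi> (x \<bullet> W n)))
        \<longlonglongrightarrow> indicator (gap D0 \<omega>) x *\<^sub>R (u x * \<psi> (x \<bullet> \<omega>))"
    proof eventually_elim
      case (elim x)
      have "(\<lambda>n. indicator (gap D0 (W n)) x :: real) \<longlonglongrightarrow> indicator (gap D0 \<omega>) x"
      proof (cases "x \<in> gap D0 \<omega>")
        case True
        then have "eventually (\<lambda>n. x \<in> gap D0 (W n)) sequentially" by (rule eventually_in_gap[OF D0(1) \<omega> lim])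
        then have "eventually (\<lambda>n. indicator (gap D0 (W n)) x = (indicator (gap D0 \<omega>) x :: real)) sequentially"
          by eventually_elim (use True in simp)
        then show ?thesis by (rule tendsto_eventually)
      next
        case False
        then have "x \<notin> closure (gap D0 \<omega>)" using elim open_gap[OF D0(1)] by (simp add: frontier_def interior_open)
        then have "eventually (\<lambda>n. x \<notin> gap D0 (W n)) sequentially" by (rule eventually_notin_gap[OF D0(3) lim])
        then have "eventually (\<lambda>n. indicator (gap D0 (W n)) x = (indicator (gap D0 \<omega>) x :: real)) sequentially"
          by eventually_elim (use False in simp)
        then show ?thesis by (rule tendsto_eventually)
      qed
      moreover have "(\<lambda>n. \<psi> (x \<bullet> W n)) \<longlonglongrightarrow> \<psi> (x \<bullet> \<omega>)"
        by (intro continuous_on_tendsto_compose[OF \<psi>(1)] tendsto_intros lim) auto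
      ultimately show ?case by (intro tendsto_intros)
    qed
  qed
  then show ?thesis using zero by (simp add: set_lebesgue_integral_def LIMSEQ_const_iff)
qed

text \<open>The hypothesis gives only almost every direction, but a set of angles of full measure is
  dense, and vanishing strip integrals pass to the limit.\<close>

lemma integral_gap_eq_0_all:
  fixes u :: "real^2 \<Rightarrow> complex"
  assumes int: "integrable lebesgue u" and D0: "open D0" "convex D0" "bounded D0"
    and rad: "AE (\<omega>, p) in arc_length \<Otimes>\<^sub>M lborel. line \<omega> p \<inter> D0 \<noteq> {} \<longrightarrow> radon u \<omega> p = 0"
    and \<omega>: "norm \<omega> = 1" and \<psi>: "continuous_on UNIV \<psi>" "\<And>s. norm (\<psi> s) \<le> B"
  shows "(LINT x:gap D0 \<omega>|lebesgue. u x * \<psi> (x \<bullet> \<omega>)) = 0"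
proof -
  define e :: "real \<Rightarrow> real^2" where "e \<theta> = vector [cos \<theta>, sin \<theta>]" for \<theta>
  have ne: "norm (e \<theta>) = 1" for \<theta> by (rule power2_eq_imp_eq) (auto simp: norm_vec2 e_def)
  have ce: "continuous_on UNIV e"
  proof -
    have "e = (\<lambda>\<theta>. cos \<theta> *\<^sub>R axis 1 1 + sin \<theta> *\<^sub>R axis 2 1)"
      by (auto simp: e_def vec_eq_iff forall_2 axis_def)
    then show ?thesis by (auto intro!: continuous_intros)
  qed
  define good where "good \<theta> \<longleftrightarrow> (AE p in lborel. line (e \<theta>) p \<inter> D0 \<noteq> {} \<longrightarrow> radon u (e \<theta>) p = 0)" for \<theta>
  interpret A: finite_measure arc_length by (rule finite_arc_length)
  interpret AL: pair_sigma_finite arc_length "lborel :: real measure" ..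
  have "AE \<omega> in arc_length. AE p in lborel. line \<omega> p \<inter> D0 \<noteq> {} \<longrightarrow> radon u \<omega> p = 0"
    using AL.AE_pair[OF rad] by simp
  then have "AE \<theta> in restrict_space lborel {0..<2*pi}. good \<theta>"
    unfolding arc_length_def good_def e_def by (rule AE_distrD[OF measurable_circle])
  then have ae: "AE \<theta> in lborel. \<theta> \<in> {0..<2*pi} \<longrightarrow> good \<theta>"
    by (subst (asm) AE_restrict_space_iff) auto
  obtain \<theta>0 where \<theta>0: "0 \<le> \<theta>0" "\<theta>0 < 2 * pi" "\<omega> = e \<theta>0"
  proof -
    have "(\<omega> $ 1)^2 + (\<omega> $ 2)^2 = 1" using norm_vec2[of \<omega>] \<omega> by simp
    then obtain t where "0 \<le> t" "t < 2 * pi" "\<omega> $ 1 = cos t" "\<omega> $ 2 = sin t" by (rule sincos_total_2pi)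
    then show thesis using that[of t] by (simp add: e_def vec_eq_iff forall_2)
  qed
  have "\<exists>\<theta>. good \<theta> \<and> \<bar>\<theta> - \<theta>0\<bar> < 1 / real (Suc n)" for n
  proof (rule ccontr)
    assume none: "\<not> ?thesis"
    \<comment> \<open>The interval extends to the right of \<open>\<theta>0\<close> and is cut off
      at \<open>2 * pi\<close>, so it stays in the range of the angle.\<close>
    define b where "b = min (2 * pi) (\<theta>0 + 1 / real (Suc n))"
    have b: "\<theta>0 < b" using \<theta>0 by (simp add: b_def)
    have "AE \<theta> in lborel. \<theta> \<notin> {\<theta>0<..<b}"
      using ae
    proof eventually_elim
      case (elim \<theta>)
      show ?case
      proof
        assume "\<theta> \<in> {\<theta>0<..<b}"
        then have "\<theta> \<in> {0..<2*pi}" "\<bar>\<theta> - \<theta>0\<bar> < 1 / real (Suc n)" using \<theta>0 by (auto simp: b_def)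
        then show False using elim none by blast
      qed
    qed
    then have "{\<theta>0<..<b} \<in> null_sets lborel" by (subst AE_iff_null_sets) auto
    then have "emeasure lborel {\<theta>0<..<b} = 0" by (rule null_setsD1)
    then show False using b by simp
  qed
  then obtain t where t: "\<And>n. good (t n)" "\<And>n. \<bar>t n - \<theta>0\<bar> < 1 / real (Suc n)" by metis
  have "t \<longlonglongrightarrow> \<theta>0"
  proof (rule LIM_zero_cancel, rule Lim_null_comparison)
    show "(\<lambda>n. 1 / real (Suc n)) \<longlonglongrightarrow> 0" using LIMSEQ_inverse_real_of_nat by (simp add: inverse_eq_divide)
    show "eventually (\<lambda>n. norm (t n - \<theta>0) \<le> 1 / real (Suc n)) sequentially"
      using t(2) by (intro always_eventually allI) (simp add: less_imp_le)
  qed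
  then have lim: "(\<lambda>n. e (t n)) \<longlonglongrightarrow> \<omega>" unfolding \<theta>0(3)
    by (intro continuous_on_tendsto_compose[OF ce]) auto
  show ?thesis
  proof (rule integral_gap_limit[OF int D0 _ lim \<psi>])
    show "\<omega> \<noteq> 0" using \<omega> by auto
    show "(LINT x:gap D0 (e (t n))|lebesgue. u x * \<psi> (x \<bullet> e (t n))) = 0" for n
      by (rule integral_gap_eq_0_if_radon[OF int D0(1) ne \<psi>]) (use t(1)[of n] in \<open>simp add: good_def\<close>)
  qed
qed

lemma radon_data_if_L1:
  fixes u :: "real^2 \<Rightarrow> complex"
  assumes int: "integrable lebesgue u" and D0: "open D0" "convex D0" "bounded D0" "D0 \<noteq> {}"
    and rad: "AE (\<omega>, p) in arc_length \<Otimes>\<^sub>M lborel. line \<omega> p \<inter> D0 \<noteq> {} \<longrightarrow> radon u \<omega> p = 0"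
    and D1: "compact D1" "convex D1" "D1 \<noteq> {}" and out: "AE x in lebesgue. x \<notin> D1 \<longrightarrow> u x = 0"
  shows "radon_data u D0 D1"
proof (unfold_locales; (intro int D0 D1 out)?)
  fix \<omega> :: "real^2" and \<psi> :: "real \<Rightarrow> complex" assume \<omega>: "\<omega> \<noteq> 0" and \<psi>: "continuous_on UNIV \<psi>"
  obtain R where R: "\<And>x. x \<in> D1 \<Longrightarrow> norm x \<le> R" using compact_imp_bounded[OF D1(1)] by (auto simp: bounded_iff)
  define K where "K = \<bar>R\<bar> * norm \<omega>"
  have K: "K \<ge> 0" by (simp add: K_def)
  \<comment> \<open>From \<open>D1\<close> only the values of \<psi> on \<open>{-K..K}\<close> are
    seen; clamping the argument makes \<psi> bounded, as the limit argument requires.\<close>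
  define cl where "cl s = max (- K) (min K s)" for s :: real
  have clc: "continuous_on UNIV cl" unfolding cl_def by (intro continuous_intros)
  have cl: "\<bar>cl s\<bar> \<le> K" for s using K by (auto simp: cl_def)
  have clx: "cl (x \<bullet> \<omega>) = x \<bullet> \<omega>" if "x \<in> D1" for x
  proof -
    have "\<bar>x \<bullet> \<omega>\<bar> \<le> norm x * norm \<omega>" by (rule Cauchy_Schwarz_ineq2)
    also have "\<dots> \<le> K" unfolding K_def using R[OF that] by (intro mult_right_mono) auto
    finally show ?thesis by (auto simp: cl_def)
  qed
  have "bounded (\<psi> ` {-K..K})" by (intro compact_imp_bounded compact_continuous_image continuous_on_subset[OF \<psi>]) auto
  then obtain B where B: "\<And>s. s \<in> {-K..K} \<Longrightarrow> norm (\<psi> s) \<le> B" unfolding bounded_iff by blast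
  define \<omega>' where "\<omega>' = \<omega> /\<^sub>R norm \<omega>"
  have \<omega>': "norm \<omega>' = 1" using \<omega> by (simp add: \<omega>'_def)
  have gap: "gap D0 \<omega>' = gap D0 \<omega>" using \<omega> by (simp add: gap_def \<omega>'_def)
  define \<psi>' where "\<psi>' s = \<psi> (cl (norm \<omega> * s))" for s
  have zero: "(LINT x:gap D0 \<omega>'|lebesgue. u x * \<psi>' (x \<bullet> \<omega>')) = 0"
  proof (rule integral_gap_eq_0_all[OF int D0(1-3) rad \<omega>'])
    show "continuous_on UNIV \<psi>'" unfolding \<psi>'_def
      by (intro continuous_on_compose2[OF \<psi>] continuous_on_compose2[OF clc] continuous_intros) auto
    show "norm (\<psi>' s) \<le> B" for s unfolding \<psi>'_def using cl[of "norm \<omega> * s"] by (intro B) auto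
  qed
  have eq: "\<psi>' (x \<bullet> \<omega>') = \<psi> (cl (x \<bullet> \<omega>))" for x
  proof -
    have "norm \<omega> * (x \<bullet> \<omega>') = x \<bullet> \<omega>" using \<omega> by (simp add: \<omega>'_def mult.assoc[symmetric])
    then show ?thesis by (simp only: \<psi>'_def)
  qed
  have meas: "(\<lambda>x. indicator (gap D0 \<omega>) x *\<^sub>R (u x * \<phi> (x \<bullet> \<omega>))) \<in> borel_measurable lebesgue"
    if \<phi>: "continuous_on UNIV \<phi>" for \<phi> :: "real \<Rightarrow> complex"
  proof -
    have "(\<lambda>x::real^2. \<phi> (x \<bullet> \<omega>)) \<in> borel_measurable lborel"
      using borel_measurable_continuous_onI[OF continuous_on_compose2[OF \<phi>, of UNIV "\<lambda>x::real^2. x \<bullet> \<omega>"]]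
      by (simp add: continuous_intros)
    then have "(\<lambda>x::real^2. \<phi> (x \<bullet> \<omega>)) \<in> borel_measurable lebesgue" by (rule measurable_completion)
    moreover have "gap D0 \<omega> \<in> sets lebesgue" using open_gap[OF D0(1)] by simp
    ultimately show ?thesis
      by (intro borel_measurable_scaleR borel_measurable_indicator borel_measurable_times borel_measurable_integrable[OF int])
  qed
  have "(LINT x:gap D0 \<omega>|lebesgue. u x * \<psi> (x \<bullet> \<omega>)) = (LINT x:gap D0 \<omega>|lebesgue. u x * \<psi> (cl (x \<bullet> \<omega>)))"
    unfolding set_lebesgue_integral_def
  proof (rule integral_cong_AE)
    show "AE x in lebesgue. indicator (gap D0 \<omega>) x *\<^sub>R (u x * \<psi> (x \<bullet> \<omega>)) = indicator (gap D0 \<omega>) x *\<^sub>R (u x * \<psi> (cl (x \<bullet> \<omega>)))"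
      using out by eventually_elim (use clx in fastforce)
    show "(\<lambda>x. indicator (gap D0 \<omega>) x *\<^sub>R (u x * \<psi> (x \<bullet> \<omega>))) \<in> borel_measurable lebesgue" by (rule meas[OF \<psi>])
    show "(\<lambda>x. indicator (gap D0 \<omega>) x *\<^sub>R (u x * \<psi> (cl (x \<bullet> \<omega>)))) \<in> borel_measurable lebesgue"
      by (rule meas[of "\<lambda>s. \<psi> (cl s)"]) (intro continuous_on_compose2[OF \<psi> clc], simp)
  qed
  also have "\<dots> = 0" using zero by (simp add: gap eq)
  finally show "(LINT x:gap D0 \<omega>|lebesgue. u x * \<psi> (x \<bullet> \<omega>)) = 0" .
qed

section \<open>Ellipses and quadratic forms\<close>

lemma positive_definite_form_2:
  fixes p q r :: real
  shows "(\<forall>y z. (y, z) \<noteq> (0, 0) \<longrightarrow> p * y^2 + 2 * q * (y * z) + r * z^2 > 0) \<longleftrightarrow> p > 0 \<and> p * r - q^2 > 0"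
proof
  assume pos: "\<forall>y z. (y, z) \<noteq> (0, 0) \<longrightarrow> p * y^2 + 2 * q * (y * z) + r * z^2 > 0"
  have p: "p > 0" using pos[rule_format, of 1 0] by simp
  have "p * (p * r - q^2) > 0"
    using pos[rule_format, of "- q" p] p by (simp add: power2_eq_square algebra_simps)
  then show "p > 0 \<and> p * r - q^2 > 0" using p zero_less_mult_pos by blast
next
  assume pr: "p > 0 \<and> p * r - q^2 > 0"
  show "\<forall>y z. (y, z) \<noteq> (0, 0) \<longrightarrow> p * y^2 + 2 * q * (y * z) + r * z^2 > 0"
  proof (intro allI impI)
    fix y z :: real assume yz: "(y, z) \<noteq> (0, 0)"
    have eq: "p * (p * y^2 + 2 * q * (y * z) + r * z^2) = (p * y + q * z)^2 + (p * r - q^2) * z^2"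
      by algebra
    have "p * (p * y^2 + 2 * q * (y * z) + r * z^2) > 0"
    proof (cases "z = 0")
      case True then show ?thesis unfolding eq using yz pr by simp
    next
      case False then show ?thesis unfolding eq using pr by (intro add_nonneg_pos mult_pos_pos) auto
    qed
    then show "p * y^2 + 2 * q * (y * z) + r * z^2 > 0" using pr zero_less_mult_pos by blast
  qed
qed

lemma positive_definite_2:
  fixes S :: "real^2^2"
  shows "positive_definite S \<longleftrightarrow>
    S $ 2 $ 1 = S $ 1 $ 2 \<and> S $ 1 $ 1 > 0 \<and> S $ 1 $ 1 * S $ 2 $ 2 - (S $ 1 $ 2)^2 > 0"
proof -
  have T: "transpose S = S \<longleftrightarrow> S $ 2 $ 1 = S $ 1 $ 2"
    unfolding vec_eq_iff forall_2 transpose_def vec_lambda_beta by argo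
  have vec: "(\<forall>x::real^2. x \<noteq> 0 \<longrightarrow> R (x $ 1) (x $ 2)) \<longleftrightarrow> (\<forall>y z. (y, z) \<noteq> (0, 0) \<longrightarrow> R y z)" for R
  proof
    assume *: "\<forall>x::real^2. x \<noteq> 0 \<longrightarrow> R (x $ 1) (x $ 2)"
    show "\<forall>y z. (y, z) \<noteq> (0, 0) \<longrightarrow> R y z"
    proof (intro allI impI)
      fix y z :: real assume "(y, z) \<noteq> (0, 0)"
      then have "(vector [y, z] :: real^2) \<noteq> 0" by (auto simp: vec_eq_iff forall_2)
      then show "R y z" using *[rule_format, of "vector [y, z]"] by simp
    qed
  next
    assume *: "\<forall>y z. (y, z) \<noteq> (0, 0) \<longrightarrow> R y z"
    show "\<forall>x::real^2. x \<noteq> 0 \<longrightarrow> R (x $ 1) (x $ 2)"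
      using * by (auto simp: vec_eq_iff forall_2)
  qed
  have form: "x \<bullet> (S *v x) = S $ 1 $ 1 * (x $ 1)^2 + (S $ 1 $ 2 + S $ 2 $ 1) * (x $ 1 * x $ 2) + S $ 2 $ 2 * (x $ 2)^2" for x
    unfolding inner_vec_def matrix_vector_mult_def sum_2 vec_lambda_beta inner_real_def by algebra
  show ?thesis
  proof (cases "S $ 2 $ 1 = S $ 1 $ 2")
    case True
    have "positive_definite S \<longleftrightarrow> (\<forall>y z. (y, z) \<noteq> (0, 0) \<longrightarrow> S $ 1 $ 1 * y^2 + 2 * S $ 1 $ 2 * (y * z) + S $ 2 $ 2 * z^2 > 0)"
      unfolding positive_definite_def T form True mult_2[symmetric] by (simp only: vec[symmetric] simp_thms)
    then show ?thesis unfolding positive_definite_form_2 using True by simp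
  next
    case False
    then show ?thesis unfolding positive_definite_def T by simp
  qed
qed

lemma square_2:
  fixes S Q :: "real^2^2"
  assumes "S $ 2 $ 1 = S $ 1 $ 2" "Q $ 2 $ 1 = Q $ 1 $ 2"
  shows "S ** S = Q \<longleftrightarrow> (S $ 1 $ 1)^2 + (S $ 1 $ 2)^2 = Q $ 1 $ 1 \<and> S $ 1 $ 2 * (S $ 1 $ 1 + S $ 2 $ 2) = Q $ 1 $ 2 \<and>
    (S $ 1 $ 2)^2 + (S $ 2 $ 2)^2 = Q $ 2 $ 2"
  using assms by (auto simp: vec_eq_iff forall_2 matrix_matrix_mult_def sum_2 power2_eq_square algebra_simps)

lemma matrix_sqrt_2:
  fixes Q :: "real^2^2"
  assumes Q: "positive_definite Q"
  shows "positive_definite (matrix_sqrt Q) \<and> matrix_sqrt Q ** matrix_sqrt Q = Q"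
proof -
  define A where "A = Q $ 1 $ 1"
  define B where "B = Q $ 1 $ 2"
  define D where "D = Q $ 2 $ 2"
  have q: "Q $ 2 $ 1 = B" "A > 0" "A * D - B^2 > 0"
    using Q unfolding positive_definite_2 by (auto simp: A_def B_def D_def)
  have D0: "D > 0"
  proof -
    have "A * D > 0" using q(3) zero_le_power2[of B] by linarith
    then show ?thesis using q(2) by (simp add: zero_less_mult_iff)
  qed
  \<comment> \<open>By Cayley-Hamilton a square root satisfies S^2 = (tr S) S - (det S) I, so S = (Q
    + d I) / t with d = det S = sqrt (det Q) and t = tr S = sqrt (tr Q + 2 d). The uniqueness half
    recovers the same values.\<close>
  define d where "d = sqrt (A * D - B^2)"
  have d: "d > 0" "d^2 = A * D - B^2" using q by (auto simp: d_def)
  define t where "t = sqrt (A + D + 2 * d)"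
  have t: "t > 0" "t^2 = A + D + 2 * d" using q D0 d by (auto simp: t_def)
  have "\<exists>!S. positive_definite S \<and> S ** S = Q"
  proof (rule ex_ex1I)
    define S :: "real^2^2" where "S = vector [vector [(A + d) / t, B / t], vector [B / t, (D + d) / t]]"
    have S: "S $ 1 $ 1 = (A + d) / t" "S $ 1 $ 2 = B / t" "S $ 2 $ 1 = B / t" "S $ 2 $ 2 = (D + d) / t"
      by (simp_all add: S_def)
    have "(A + d) * (D + d) - B^2 = d * t^2" unfolding t(2) using d(2) by algebra
    then have "(A + d) / t * ((D + d) / t) - (B / t)^2 = d"
      using t(1) by (simp add: power_divide power2_eq_square diff_divide_distrib[symmetric])
    then have "positive_definite S" unfolding positive_definite_2 S using q d t by auto
    moreover have "S ** S = Q"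
    proof (subst square_2)
      have "(A + d)^2 + B^2 = A * t^2" "(B)^2 + (D + d)^2 = D * t^2"
        unfolding t(2) using d(2) by algebra+
      moreover have "A + d + (D + d) = t^2" unfolding t(2) by simp
      ultimately show "(S $ 1 $ 1)^2 + (S $ 1 $ 2)^2 = Q $ 1 $ 1 \<and> S $ 1 $ 2 * (S $ 1 $ 1 + S $ 2 $ 2) = Q $ 1 $ 2 \<and>
         (S $ 1 $ 2)^2 + (S $ 2 $ 2)^2 = Q $ 2 $ 2"
        unfolding S A_def[symmetric] B_def[symmetric] D_def[symmetric] using t(1)
        by (simp add: power_divide add_divide_distrib[symmetric] power2_eq_square)
    qed (use S q B_def in auto)
    ultimately show "\<exists>S. positive_definite S \<and> S ** S = Q" by blast
  next
    fix S S' :: "real^2^2"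
    have S: "S $ 1 $ 1 = (A + d) / t \<and> S $ 1 $ 2 = B / t \<and> S $ 2 $ 1 = B / t \<and> S $ 2 $ 2 = (D + d) / t"
      if "positive_definite S \<and> S ** S = Q" for S :: "real^2^2"
    proof -
      have s: "S $ 2 $ 1 = S $ 1 $ 2" "S $ 1 $ 1 > 0" "S $ 1 $ 1 * S $ 2 $ 2 - (S $ 1 $ 2)^2 > 0"
        using that unfolding positive_definite_2 by auto
      have e: "(S $ 1 $ 1)^2 + (S $ 1 $ 2)^2 = A" "S $ 1 $ 2 * (S $ 1 $ 1 + S $ 2 $ 2) = B" "(S $ 1 $ 2)^2 + (S $ 2 $ 2)^2 = D"
        using that square_2[of S Q] s q(1) by (auto simp: A_def B_def D_def)
      have s2: "S $ 2 $ 2 > 0"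
      proof -
        have "S $ 1 $ 1 * S $ 2 $ 2 > 0" using s(3) zero_le_power2[of "S $ 1 $ 2"] by linarith
        then show ?thesis using s(2) by (simp add: zero_less_mult_iff)
      qed
      have "(S $ 1 $ 1 * S $ 2 $ 2 - (S $ 1 $ 2)^2)^2 = d^2" unfolding d(2) e[symmetric] by algebra
      then have dd: "S $ 1 $ 1 * S $ 2 $ 2 - (S $ 1 $ 2)^2 = d" using s(3) d(1) by (simp add: power2_eq_iff_nonneg)
      have "(S $ 1 $ 1 + S $ 2 $ 2)^2 = t^2" unfolding t(2) dd[symmetric] e[symmetric] by algebra
      then have tt: "S $ 1 $ 1 + S $ 2 $ 2 = t" using s(2) s2 t(1) by (simp add: power2_eq_iff_nonneg)
      have "S $ 1 $ 1 * t = A + d" "S $ 2 $ 2 * t = D + d"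
        unfolding tt[symmetric] dd[symmetric] e[symmetric] by algebra+
      moreover have "S $ 1 $ 2 * t = B" unfolding tt[symmetric] by (rule e(2))
      ultimately show ?thesis using t(1) s(1) by (simp add: field_simps)
    qed
    assume "positive_definite S \<and> S ** S = Q" "positive_definite S' \<and> S' ** S' = Q"
    then show "S = S'" using S[of S] S[of S'] by (simp add: vec_eq_iff forall_2)
  qed
  then show ?thesis unfolding matrix_sqrt_def by (rule theI')
qed

definition quad :: "real \<Rightarrow> real \<Rightarrow> real \<Rightarrow> real^2 \<Rightarrow> real" where
  "quad a b d z = a * (z $ 1)^2 + 2 * b * (z $ 1 * z $ 2) + d * (z $ 2)^2"

text \<open>The image is where the quadratic form of the inverse of \<open>Q\<close>, centred at
  \<open>c\<close>, is at most 1. Multiplication by the determinant replaces the inverse by the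
  adjugate, whose entries appear in \<open>quad\<close>.\<close>

lemma sqrt_image_eq:
  fixes S :: "real^2^2"
  assumes S: "S $ 2 $ 1 = S $ 1 $ 2" "S $ 1 $ 1 * S $ 2 $ 2 - (S $ 1 $ 2)^2 > 0"
    and Q: "S ** S = Q" "Q $ 2 $ 1 = Q $ 1 $ 2"
  shows "(\<lambda>x. c + S *v x) ` cball 0 1 = {x. quad (Q $ 2 $ 2) (- (Q $ 1 $ 2)) (Q $ 1 $ 1) (x - c) \<le> Q $ 1 $ 1 * Q $ 2 $ 2 - (Q $ 1 $ 2)^2}"
proof -
  define p where "p = S $ 1 $ 1"
  define q where "q = S $ 1 $ 2"
  define r where "r = S $ 2 $ 2"
  have Qe: "Q $ 1 $ 1 = p^2 + q^2" "Q $ 1 $ 2 = q * (p + r)" "Q $ 2 $ 2 = q^2 + r^2"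
    using Q square_2[OF S(1) Q(2)] by (auto simp: p_def q_def r_def)
  have det: "Q $ 1 $ 1 * Q $ 2 $ 2 - (Q $ 1 $ 2)^2 = (p * r - q^2)^2" unfolding Qe by algebra
  have pr: "p * r - q^2 > 0" using S(2) by (simp add: p_def q_def r_def)
  have Sy: "(S *v y) $ 1 = p * y $ 1 + q * y $ 2" "(S *v y) $ 2 = q * y $ 1 + r * y $ 2" for y
    using S(1) by (simp_all add: matrix_vector_mult_def sum_2 p_def q_def r_def)
  have form: "quad (Q $ 2 $ 2) (- (Q $ 1 $ 2)) (Q $ 1 $ 1) (S *v y) = (p * r - q^2)^2 * (norm y)^2" for y
    unfolding quad_def Sy norm_vec2 Qe by algebra
  show ?thesis
  proof (intro set_eqI iffI)
    fix x assume "x \<in> (\<lambda>x. c + S *v x) ` cball 0 1"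
    then obtain y where y: "x = c + S *v y" "norm y \<le> 1" by auto
    have "(norm y)^2 \<le> 1" using y(2) by (simp add: power_le_one)
    then have "(p * r - q^2)^2 * (norm y)^2 \<le> (p * r - q^2)^2 * 1" by (intro mult_left_mono) auto
    then show "x \<in> {x. quad (Q $ 2 $ 2) (- (Q $ 1 $ 2)) (Q $ 1 $ 1) (x - c) \<le> Q $ 1 $ 1 * Q $ 2 $ 2 - (Q $ 1 $ 2)^2}"
      by (simp add: y(1) form det)
  next
    fix x assume x: "x \<in> {x. quad (Q $ 2 $ 2) (- (Q $ 1 $ 2)) (Q $ 1 $ 1) (x - c) \<le> Q $ 1 $ 1 * Q $ 2 $ 2 - (Q $ 1 $ 2)^2}"
    define z where "z = x - c"
    define y :: "real^2" where "y = vector [(r * z $ 1 - q * z $ 2) / (p * r - q^2), (p * z $ 2 - q * z $ 1) / (p * r - q^2)]"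
    have "S *v y = z"
    proof -
      have "p * (r * z $ 1 - q * z $ 2) + q * (p * z $ 2 - q * z $ 1) = (p * r - q^2) * z $ 1"
        "q * (r * z $ 1 - q * z $ 2) + r * (p * z $ 2 - q * z $ 1) = (p * r - q^2) * z $ 2" by algebra+
      then have "(S *v y) $ 1 = z $ 1" "(S *v y) $ 2 = z $ 2"
        unfolding Sy using pr by (simp_all add: y_def add_divide_distrib[symmetric])
      then show ?thesis by (simp add: vec_eq_iff forall_2)
    qed
    moreover have "(p * r - q^2)^2 * (norm y)^2 \<le> (p * r - q^2)^2 * 1"
      using x form[of y] unfolding \<open>S *v y = z\<close> by (simp add: z_def det)
    then have "(norm y)^2 \<le> 1" using pr by simp
    then have "(norm y)^2 \<le> 1^2" by simp
    then have "norm y \<le> 1" by (rule power2_le_imp_le) simp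
    ultimately show "x \<in> (\<lambda>x. c + S *v x) ` cball 0 1"
    proof -
      assume "S *v y = z" "norm y \<le> 1"
      then have "x = c + S *v y" "y \<in> cball 0 1" by (simp_all add: z_def)
      then show ?thesis by (rule image_eqI)
    qed
  qed
qed

lemma is_ellipse_iff_quad:
  "is_ellipse c E \<longleftrightarrow> (\<exists>a b d. a > 0 \<and> a * d - b^2 > 0 \<and> E = {x. quad a b d (x - c) \<le> 1})"
proof
  assume "is_ellipse c E"
  then obtain Q where Q: "positive_definite Q" "E = (\<lambda>x. c + matrix_sqrt Q *v x) ` cball 0 1"
    by (auto simp: is_ellipse_def)
  have q: "Q $ 2 $ 1 = Q $ 1 $ 2" "Q $ 1 $ 1 > 0" "Q $ 1 $ 1 * Q $ 2 $ 2 - (Q $ 1 $ 2)^2 > 0"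
    using Q(1) unfolding positive_definite_2 by auto
  define \<Delta> where "\<Delta> = Q $ 1 $ 1 * Q $ 2 $ 2 - (Q $ 1 $ 2)^2"
  have \<Delta>: "\<Delta> > 0" using q by (simp add: \<Delta>_def)
  have "Q $ 2 $ 2 > 0"
  proof -
    have "Q $ 1 $ 1 * Q $ 2 $ 2 > 0" using q(3) zero_le_power2[of "Q $ 1 $ 2"] by linarith
    then show ?thesis using q(2) by (simp add: zero_less_mult_iff)
  qed
  have s: "positive_definite (matrix_sqrt Q)" "matrix_sqrt Q ** matrix_sqrt Q = Q" using matrix_sqrt_2[OF Q(1)] by auto
  have E: "E = {x. quad (Q $ 2 $ 2) (- (Q $ 1 $ 2)) (Q $ 1 $ 1) (x - c) \<le> \<Delta>}"
    unfolding Q(2) \<Delta>_def using s(1) unfolding positive_definite_2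
    by (intro sqrt_image_eq s(2) q(1)) auto
  have "quad (Q $ 2 $ 2) (- (Q $ 1 $ 2)) (Q $ 1 $ 1) z \<le> \<Delta> \<longleftrightarrow>
      quad (Q $ 2 $ 2 / \<Delta>) (- (Q $ 1 $ 2) / \<Delta>) (Q $ 1 $ 1 / \<Delta>) z \<le> 1" for z
  proof -
    have "quad (Q $ 2 $ 2 / \<Delta>) (- (Q $ 1 $ 2) / \<Delta>) (Q $ 1 $ 1 / \<Delta>) z = quad (Q $ 2 $ 2) (- (Q $ 1 $ 2)) (Q $ 1 $ 1) z / \<Delta>"
      by (simp add: quad_def add_divide_distrib diff_divide_distrib)
    then show ?thesis using \<Delta> by (simp add: divide_le_eq)
  qed
  moreover have "Q $ 2 $ 2 / \<Delta> * (Q $ 1 $ 1 / \<Delta>) - (- (Q $ 1 $ 2) / \<Delta>)^2 = \<Delta> / \<Delta>^2"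
    by (simp add: \<Delta>_def power_divide power2_eq_square diff_divide_distrib mult.commute)
  moreover have "Q $ 2 $ 2 / \<Delta> > 0" "\<Delta> / \<Delta>^2 > 0" using \<open>Q $ 2 $ 2 > 0\<close> \<Delta> by simp_all
  ultimately show "\<exists>a b d. a > 0 \<and> a * d - b^2 > 0 \<and> E = {x. quad a b d (x - c) \<le> 1}"
    by (intro exI[of _ "Q $ 2 $ 2 / \<Delta>"] exI[of _ "- (Q $ 1 $ 2) / \<Delta>"] exI[of _ "Q $ 1 $ 1 / \<Delta>"]) (simp only: E simp_thms)
next
  assume "\<exists>a b d. a > 0 \<and> a * d - b^2 > 0 \<and> E = {x. quad a b d (x - c) \<le> 1}"
  then obtain a b d where a: "a > 0" "a * d - b^2 > 0" and E: "E = {x. quad a b d (x - c) \<le> 1}" by blast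
  define \<Delta> where "\<Delta> = a * d - b^2"
  have \<Delta>: "\<Delta> > 0" using a by (simp add: \<Delta>_def)
  have d: "d > 0"
  proof -
    have "a * d > 0" using a(2) zero_le_power2[of b] by linarith
    then show ?thesis using a(1) by (simp add: zero_less_mult_iff)
  qed
  define Q :: "real^2^2" where "Q = vector [vector [d / \<Delta>, - b / \<Delta>], vector [- b / \<Delta>, a / \<Delta>]]"
  have Q: "Q $ 1 $ 1 = d / \<Delta>" "Q $ 1 $ 2 = - b / \<Delta>" "Q $ 2 $ 1 = - b / \<Delta>" "Q $ 2 $ 2 = a / \<Delta>"
    by (simp_all add: Q_def)
  have det: "d / \<Delta> * (a / \<Delta>) - (- b / \<Delta>)^2 = 1 / \<Delta>"
  proof -
    have "d / \<Delta> * (a / \<Delta>) - (- b / \<Delta>)^2 = \<Delta> / \<Delta>^2"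
      by (simp add: \<Delta>_def power_divide power2_eq_square diff_divide_distrib mult.commute)
    then show ?thesis using \<Delta> by (simp add: power2_eq_square)
  qed
  have pd: "positive_definite Q" unfolding positive_definite_2 Q det using d \<Delta> by simp
  have s: "positive_definite (matrix_sqrt Q)" "matrix_sqrt Q ** matrix_sqrt Q = Q" using matrix_sqrt_2[OF pd] by auto
  have "(\<lambda>x. c + matrix_sqrt Q *v x) ` cball 0 1 = {x. quad (a / \<Delta>) (- (- b / \<Delta>)) (d / \<Delta>) (x - c) \<le> 1 / \<Delta>}"
    using s(1) sqrt_image_eq[of "matrix_sqrt Q" Q c] s(2) unfolding positive_definite_2 Q det by auto
  also have "\<dots> = E"
  proof -
    have "quad (a / \<Delta>) (- (- b / \<Delta>)) (d / \<Delta>) z = quad a b d z / \<Delta>" for z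
      by (simp add: quad_def add_divide_distrib)
    then show ?thesis unfolding E using \<Delta> by (simp add: divide_le_cancel)
  qed
  finally show "is_ellipse c E" unfolding is_ellipse_def using pd by blast
qed

text \<open>Squaring loses nothing, since \<open>norm v0 < r\<close> excludes the spurious branch on
  which 1 is less than the inner product of \<open>v0\<close> and \<open>Y\<close>.\<close>

lemma focus_disc_eq:
  fixes v0 Y :: complex
  assumes r: "norm v0 < r"
  shows "v0 \<bullet> Y + r * norm Y \<le> 1 \<longleftrightarrow> r^2 * (norm Y)^2 - (v0 \<bullet> Y)^2 + 2 * (v0 \<bullet> Y) \<le> 1"
proof
  have r0: "r \<ge> 0" using r norm_ge_zero[of v0] by linarith
  {
    assume "v0 \<bullet> Y + r * norm Y \<le> 1"
    then have "(r * norm Y)^2 \<le> (1 - v0 \<bullet> Y)^2" using r0 by (intro power_mono) auto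
    then show "r^2 * (norm Y)^2 - (v0 \<bullet> Y)^2 + 2 * (v0 \<bullet> Y) \<le> 1"
      by (simp add: power_mult_distrib power2_diff)
  }
  assume "r^2 * (norm Y)^2 - (v0 \<bullet> Y)^2 + 2 * (v0 \<bullet> Y) \<le> 1"
  then have "(r * norm Y)^2 \<le> \<bar>1 - v0 \<bullet> Y\<bar>^2"
    by (simp add: power_mult_distrib power2_diff)
  then have le: "r * norm Y \<le> \<bar>1 - v0 \<bullet> Y\<bar>" by (rule power2_le_imp_le) simp
  show "v0 \<bullet> Y + r * norm Y \<le> 1"
  proof (cases "1 - v0 \<bullet> Y \<ge> 0")
    case True then show ?thesis using le by simp
  next
    case False
    have "v0 \<bullet> Y \<le> norm v0 * norm Y" by (rule norm_cauchy_schwarz)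
    also have "\<dots> \<le> r * norm Y" using r by (intro mult_right_mono) auto
    finally show ?thesis using le False by simp
  qed
qed

lemma is_ellipse_focus:
  fixes v0 x0 :: complex
  assumes \<tau>: "\<tau> > 0" and r: "norm v0 < r"
  shows "\<exists>c. is_ellipse c {x. v0 \<bullet> (Complex (x $ 1) (\<tau> * x $ 2) - x0) + r * norm (Complex (x $ 1) (\<tau> * x $ 2) - x0) \<le> 1}"
proof -
  define v1 where "v1 = Re v0"
  define v2 where "v2 = Im v0"
  define k where "k = r^2 - (v1^2 + v2^2)"
  have r0: "r > 0" using r norm_ge_zero[of v0] by linarith
  have "(norm v0)^2 < r^2" using r by (intro power_strict_mono) auto
  then have k: "k > 0" by (simp add: k_def cmod_power2 v1_def v2_def)
  \<comment> \<open>The quadratic function of \<open>focus_disc_eq\<close> is minimal at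
    \<open>Y = - v0 / k\<close>, which gives the centre. Measured from the minimum, the bound 1
    becomes \<open>r^2 / k\<close>, and \<open>m\<close> rescales this to 1.\<close>
  define c1 where "c1 = Re x0 - v1 / k"
  define c2 where "c2 = (Im x0 - v2 / k) / \<tau>"
  define c :: "real^2" where "c = vector [c1, c2]"
  define m where "m = k / r^2"
  have m: "m > 0" using k r0 by (simp add: m_def)
  define a where "a = (r^2 - v1^2) * m"
  define b where "b = - (v1 * v2 * \<tau> * m)"
  define d where "d = (r^2 - v2^2) * \<tau>^2 * m"
  have rv: "r^2 - v1^2 > 0" using k zero_le_power2[of v2] unfolding k_def by linarith
  have "a * d - b^2 = \<tau>^2 * m^2 * r^2 * k"
    unfolding a_def b_def d_def k_def by (simp add: power2_eq_square algebra_simps)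
  then have det: "a * d - b^2 > 0" using \<tau> m r0 k by simp
  have a0: "a > 0" using rv m by (simp add: a_def)
  have "v0 \<bullet> (Complex (x $ 1) (\<tau> * x $ 2) - x0) + r * norm (Complex (x $ 1) (\<tau> * x $ 2) - x0) \<le> 1
      \<longleftrightarrow> quad a b d (x - c) \<le> 1" for x
  proof -
    define z1 where "z1 = x $ 1 - c1"
    define z2 where "z2 = x $ 2 - c2"
    define Y where "Y = Complex (x $ 1) (\<tau> * x $ 2) - x0"
    have Y: "Re Y = z1 - v1 / k" "Im Y = \<tau> * z2 - v2 / k"
    proof -
      have "\<tau> * c2 = Im x0 - v2 / k" using \<tau> by (simp add: c2_def)
      then show "Re Y = z1 - v1 / k" "Im Y = \<tau> * z2 - v2 / k"
        by (simp_all add: Y_def z1_def z2_def c1_def right_diff_distrib)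
    qed
    have kk: "r^2 = k + v1^2 + v2^2" by (simp add: k_def)
    define F where "F = r^2 * (norm Y)^2 - (v0 \<bullet> Y)^2 + 2 * (v0 \<bullet> Y)"
    have "k * F + k = k * ((r^2 - v1^2) * z1^2 - 2 * (v1 * v2 * \<tau>) * (z1 * z2) + (r^2 - v2^2) * \<tau>^2 * z2^2) + (k - r^2 + k)"
    proof -
      define p where "p = v1 / k"
      define q where "q = v2 / k"
      have pq: "v1 = k * p" "v2 = k * q" using k by (simp_all add: p_def q_def)
      have F: "F = r^2 * ((z1 - p)^2 + (\<tau> * z2 - q)^2) - (k * p * (z1 - p) + k * q * (\<tau> * z2 - q))^2 + 2 * (k * p * (z1 - p) + k * q * (\<tau> * z2 - q))"
        unfolding F_def cmod_power2 inner_complex_def Y v1_def[symmetric] v2_def[symmetric] p_def[symmetric] q_def[symmetric] unfolding pq by simp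
      have "r^2 = k + (k * p)^2 + (k * q)^2" using kk unfolding pq .
      then show ?thesis unfolding F pq by algebra
    qed
    then have "F - 1 = (r^2 - v1^2) * z1^2 - 2 * (v1 * v2 * \<tau>) * (z1 * z2) + (r^2 - v2^2) * \<tau>^2 * z2^2 - r^2 / k"
      using k by (simp add: field_simps)
    then have "m * (F - 1) = m * ((r^2 - v1^2) * z1^2 - 2 * (v1 * v2 * \<tau>) * (z1 * z2) + (r^2 - v2^2) * \<tau>^2 * z2^2) - m * (r^2 / k)"
      by (simp only: right_diff_distrib)
    also have "m * (r^2 / k) = 1" using k r0 by (simp add: m_def)
    also have "m * ((r^2 - v1^2) * z1^2 - 2 * (v1 * v2 * \<tau>) * (z1 * z2) + (r^2 - v2^2) * \<tau>^2 * z2^2) = quad a b d (x - c)"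
      by (simp add: quad_def a_def b_def d_def z1_def z2_def c_def algebra_simps)
    finally have "quad a b d (x - c) - 1 = m * (F - 1)" by simp
    then have "quad a b d (x - c) \<le> 1 \<longleftrightarrow> m * (F - 1) \<le> 0" by linarith
    also have "\<dots> \<longleftrightarrow> F \<le> 1" using m by (simp add: mult_le_0_iff)
    finally show ?thesis using focus_disc_eq[OF r, of Y] by (simp add: F_def Y_def)
  qed
  then show ?thesis using a0 det unfolding is_ellipse_iff_quad by blast
qed

lemma compact_ellipse: assumes "is_ellipse c E" shows "compact E"
proof -
  obtain Q where E: "E = (\<lambda>x. c + matrix_sqrt Q *v x) ` cball 0 1" using assms by (auto simp: is_ellipse_def)
  show ?thesis unfolding E
    by (intro compact_continuous_image compact_cball continuous_intros matrix_vector_mult_linear_continuous_on)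
qed

section \<open>Existence of the separating ellipse\<close>

lemma ellipse_if_L1_bounded:
  assumes u: "integrable lebesgue u" "\<not> (AE x in lebesgue. u x = 0)"
    and rad: "AE (\<omega>, p) in arc_length \<Otimes>\<^sub>M lborel. line \<omega> p \<inter> D0 \<noteq> {} \<longrightarrow> radon u \<omega> p = 0"
    and D0: "open D0" "convex D0" "bounded D0" "D0 \<noteq> {}"
    and D1: "compact D1" "convex D1" "D1 \<noteq> {}" and out: "AE x in lebesgue. x \<notin> D1 \<longrightarrow> u x = 0"
  shows "\<exists>c E. is_ellipse c E \<and> D0 \<subseteq> E \<and> E \<subseteq> D1"
proof -
  interpret radon_data u D0 D1 by (rule radon_data_if_L1[OF u(1) D0 rad D1 out])
  obtain \<tau> k where \<tau>: "\<tau> > 0" "moment \<tau> k 0 \<noteq> 0" using AE_eq_0_if_moments_eq_0 u(2) by blast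
  then obtain x0 v0 r where r: "norm v0 < r" "\<And>x. x \<in> D0 \<Longrightarrow> v0 \<bullet> (y \<tau> x - x0) + r * norm (y \<tau> x - x0) \<le> 1"
    "\<And>x. v0 \<bullet> (y \<tau> x - x0) + r * norm (y \<tau> x - x0) \<le> 1 \<Longrightarrow> x \<in> D1"
    using ellipse_or_moments_eq_0[OF \<tau>(1)] by blast
  obtain c where "is_ellipse c {x. v0 \<bullet> (y \<tau> x - x0) + r * norm (y \<tau> x - x0) \<le> 1}"
    using is_ellipse_focus[OF \<tau>(1) r(1), of x0] unfolding y_def[OF \<tau>(1)] by blast
  then show ?thesis using r(2,3) by (intro exI[of _ c] exI conjI) auto
qed

text \<open>A priori \<open>D0\<close> may be unbounded. Its intersections with balls give ellipses
  inside the compact convex hull of \<open>supp u\<close>, so every point of \<open>D0\<close> lies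
  in this hull. Once \<open>D0\<close> is known to be bounded, the argument applies to all of
  it.\<close>

lemma separating_ellipse_if_L1:
  assumes D0: "open D0" "convex D0" and D: "open D" "convex D" and sol: "L1_interior_solution D0 D u"
  shows "\<exists>c E. separating_ellipse D0 D c E"
proof -
  have u: "integrable lebesgue u" "\<not> (AE x in lebesgue. u x = 0)" "supp u \<Subset> D"
    and rad: "AE (\<omega>, p) in arc_length \<Otimes>\<^sub>M lborel. line \<omega> p \<inter> D0 \<noteq> {} \<longrightarrow> radon u \<omega> p = 0"
    using sol by (auto simp: L1_interior_solution_def)
  have s: "compact (supp u)" "supp u \<subseteq> D" using u(3) closed_supp[of u] by (auto simp: relatively_compact_in_def)
  have s0: "supp u \<noteq> {}"
  proof
    assume "supp u = {}"
    then have "AE x in lebesgue. u x = 0" using AE_supp[of u] by simp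
    then show False using u(2) by simp
  qed
  define D1 where "D1 = convex hull (supp u)"
  have D1: "compact D1" "convex D1" "D1 \<noteq> {}" "D1 \<subseteq> D"
    using s s0 D by (auto simp: D1_def compact_convex_hull convex_convex_hull hull_minimal)
  have sub: "supp u \<subseteq> D1" by (simp add: D1_def hull_subset)
  have out: "AE x in lebesgue. x \<notin> D1 \<longrightarrow> u x = 0"
    using AE_supp[of u] by eventually_elim (use sub in blast)
  have rad': "AE (\<omega>, p) in arc_length \<Otimes>\<^sub>M lborel. line \<omega> p \<inter> D0' \<noteq> {} \<longrightarrow> radon u \<omega> p = 0" if "D0' \<subseteq> D0" for D0'
    using rad by (rule eventually_mono) (use that in auto)
  show ?thesis
  \<comment> \<open>The geometric argument requires a nonempty \<open>D0\<close>. For the empty set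
    any small disc in \<open>D\<close> will do; \<open>D\<close> has a point because
    \<open>supp u\<close> has one.\<close>
  proof (cases "D0 = {}")
    case True
    obtain c where c: "c \<in> D" using s s0 by blast
    then obtain \<epsilon> where \<epsilon>: "\<epsilon> > 0" "cball c \<epsilon> \<subseteq> D" using D(1) open_contains_cball by blast
    have "is_ellipse c {x. quad (1 / \<epsilon>^2) 0 (1 / \<epsilon>^2) (x - c) \<le> 1}"
      unfolding is_ellipse_iff_quad using \<epsilon>(1) by (intro exI conjI refl) auto
    moreover have "{x. quad (1 / \<epsilon>^2) 0 (1 / \<epsilon>^2) (x - c) \<le> 1} \<subseteq> D"
    proof
      fix x assume "x \<in> {x. quad (1 / \<epsilon>^2) 0 (1 / \<epsilon>^2) (x - c) \<le> 1}"
      then have "(norm (x - c))^2 / \<epsilon>^2 \<le> 1" by (simp add: quad_def norm_vec2 add_divide_distrib)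
      then have "(norm (x - c))^2 \<le> \<epsilon>^2" using \<epsilon>(1) by (simp add: divide_le_eq)
      then have "norm (x - c) \<le> \<epsilon>" by (rule power2_le_imp_le) (use \<epsilon>(1) in simp)
      then show "x \<in> D" using \<epsilon>(2) by (auto simp: dist_norm norm_minus_commute subset_iff)
    qed
    moreover have cl: "closure E = E" if "is_ellipse c E" for c E
      using compact_imp_closed[OF compact_ellipse[OF that]] by simp
    ultimately have "separating_ellipse D0 D c {x. quad (1 / \<epsilon>^2) 0 (1 / \<epsilon>^2) (x - c) \<le> 1}"
      using True compact_ellipse by (simp add: separating_ellipse_def relatively_compact_in_def)
    then show ?thesis by blast
  next
    case False
    obtain M where M: "\<And>x. x \<in> D1 \<Longrightarrow> norm x \<le> M" using compact_imp_bounded[OF D1(1)] by (auto simp: bounded_iff)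
    have "D0 \<subseteq> D1"
    proof
      fix x assume x: "x \<in> D0"
      let ?D = "D0 \<inter> ball 0 (norm x + 1)"
      have "\<exists>c E. is_ellipse c E \<and> ?D \<subseteq> E \<and> E \<subseteq> D1"
        by (rule ellipse_if_L1_bounded[OF u(1,2) rad' _ _ _ _ D1(1-3) out])
          (use D0 x in \<open>auto intro: convex_Int bounded_Int\<close>)
      then show "x \<in> D1" using x by auto
    qed
    then have "bounded D0" using compact_imp_bounded[OF D1(1)] bounded_subset by blast
    then obtain c E where E: "is_ellipse c E" "D0 \<subseteq> E" "E \<subseteq> D1"
      using ellipse_if_L1_bounded[OF u(1,2) rad D0 _ False D1(1-3) out] by blast
    have "closed E" using compact_ellipse[OF E(1)] by (rule compact_imp_closed)
    then have "closure D0 \<subseteq> E" "closure E = E" using E(2) by (simp_all add: closure_minimal)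
    moreover have "E \<Subset> D"
      unfolding relatively_compact_in_def \<open>closure E = E\<close> using E(3) D1(4) compact_ellipse[OF E(1)] by blast
    ultimately have "closure D0 \<subseteq> E" "E \<Subset> D" by blast+
    then show ?thesis using E(1) unfolding separating_ellipse_def by blast
  qed
qed

section \<open>Smooth bumps and fields\<close>

definition smooth_real :: "(real \<Rightarrow> real) \<Rightarrow> bool"
  where "smooth_real f \<longleftrightarrow> (\<exists>F. F 0 = f \<and> (\<forall>n t. (F n has_real_derivative F (Suc n) t) (at t)))"

lemma smooth_realD:
  assumes "smooth_real f"
  shows "\<exists>f'. smooth_real f' \<and> (\<forall>t. (f has_real_derivative f' t) (at t))"
proof -
  obtain F where F: "F 0 = f" "\<And>n t. (F n has_real_derivative F (Suc n) t) (at t)"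
    using assms by (auto simp: smooth_real_def)
  have "smooth_real (F 1)"
    unfolding smooth_real_def by (rule exI[of _ "\<lambda>n. F (Suc n)"]) (use F(2) in auto)
  then show ?thesis using F(1) F(2)[of 0] by auto
qed

lemma continuous_on_smooth_real:
  assumes "smooth_real f"
  shows "continuous_on S f"
proof -
  obtain f' where "\<And>t. (f has_real_derivative f' t) (at t)" using smooth_realD[OF assms] by blast
  then show ?thesis using DERIV_isCont by (blast intro: continuous_at_imp_continuous_on)
qed

text \<open>Membership in a class of functions closed under differentiation replaces formulas for
  higher derivatives. Bumps and their integrals are treated in this way, and functions on the plane
  by an analogous class.\<close>

lemma smooth_real_if_closed:
  assumes f: "f \<in> B" and B: "\<And>g. g \<in> B \<Longrightarrow> \<exists>g'\<in>B. \<forall>t. (g has_real_derivative g' t) (at t)"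
  shows "smooth_real f"
proof -
  obtain d where d: "\<And>g. g \<in> B \<Longrightarrow> d g \<in> B \<and> (\<forall>t. (g has_real_derivative d g t) (at t))"
    using B by (metis (no_types))
  have "(d ^^ n) f \<in> B" for n by (induction n) (use f d in auto)
  then show ?thesis unfolding smooth_real_def
    by (intro exI[of _ "\<lambda>n. (d ^^ n) f"]) (use d in auto)
qed

text \<open>The negative powers of \<open>t\<close> are carried along because differentiating
  \<open>exp (- (1 / t))\<close> produces them, so that the family determines its own
  derivatives.\<close>

definition flat :: "nat \<Rightarrow> real \<Rightarrow> real"
  where "flat k t = (if t > 0 then exp (- (1 / t)) / t ^ k else 0)"

lemma power_le_exp:
  fixes x :: real
  assumes "x \<ge> 0"
  shows "x ^ n \<le> fact n * exp x"
proof -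
  have "(\<Sum>k\<in>{n}. x ^ k /\<^sub>R fact k) \<le> (\<Sum>k. x ^ k /\<^sub>R fact k)"
    using assms by (intro sum_le_suminf summable_exp_generic) auto
  then show ?thesis by (simp add: exp_def field_simps)
qed

lemma abs_flat_le: "\<bar>flat k t\<bar> \<le> fact (Suc k) * \<bar>t\<bar>"
proof (cases "t > 0")
  case True
  have "(1 / t) ^ Suc k \<le> fact (Suc k) * exp (1 / t)" using True by (intro power_le_exp) simp
  then have "exp (- (1 / t)) / t ^ k \<le> fact (Suc k) * t"
    using True by (simp add: exp_minus field_simps)
  then show ?thesis using True by (simp add: flat_def)
next
  case False
  then show ?thesis using abs_ge_zero[of t] by (simp only: flat_def if_False abs_zero) (intro mult_nonneg_nonneg; simp)
qed

lemma has_real_derivative_flat: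
  "(flat k has_real_derivative flat (Suc (Suc k)) t - real k * flat (Suc k) t) (at t)"
proof (cases t "0 :: real" rule: linorder_cases)
  case less
  have "((\<lambda>_. 0) has_real_derivative 0) (at t)" by simp
  then have "(flat k has_real_derivative 0) (at t)"
    by (rule has_field_derivative_transform_within_open[where S = "{..<0}"]) (use less in \<open>auto simp: flat_def\<close>)
  then show ?thesis using less by (simp add: flat_def)
next
  case greater
  have "((\<lambda>s. exp (- (1 / s)) / s ^ k) has_real_derivative
      (exp (- (1 / t)) * (1 / t^2) * t ^ k - exp (- (1 / t)) * (real k * t ^ (k - 1))) / (t ^ k * t ^ k)) (at t)"
    using greater by (auto intro!: derivative_eq_intros simp: power2_eq_square)
  also have "(exp (- (1 / t)) * (1 / t^2) * t ^ k - exp (- (1 / t)) * (real k * t ^ (k - 1))) / (t ^ k * t ^ k)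
      = flat (Suc (Suc k)) t - real k * flat (Suc k) t"
    using greater by (cases k) (simp_all add: flat_def field_simps power2_eq_square)
  finally have "((\<lambda>s. exp (- (1 / s)) / s ^ k) has_real_derivative flat (Suc (Suc k)) t - real k * flat (Suc k) t) (at t)" .
  then show ?thesis
    by (rule has_field_derivative_transform_within_open[where S = "{0<..}"]) (use greater in \<open>auto simp: flat_def\<close>)
next
  case equal
  \<comment> \<open>The difference quotient of \<open>flat k\<close> at 0 is
    \<open>flat (Suc k)\<close>.\<close>
  have "(flat (Suc k) \<longlongrightarrow> 0) (at 0)"
  proof (rule Lim_null_comparison)
    show "\<forall>\<^sub>F s in at 0. norm (flat (Suc k) s) \<le> fact (Suc (Suc k)) * \<bar>s\<bar>"
      using abs_flat_le[of "Suc k"] by (intro always_eventually) auto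
    show "((\<lambda>s. fact (Suc (Suc k)) * \<bar>s\<bar>) \<longlongrightarrow> 0) (at (0::real))" by (auto intro!: tendsto_eq_intros)
  qed
  then have "((\<lambda>s. (flat k s - flat k 0) / (s - 0)) \<longlongrightarrow> 0) (at 0)"
    by (rule Lim_transform_eventually) (auto simp: flat_def)
  then show ?thesis unfolding equal has_field_derivative_iff by (simp add: flat_def)
qed

inductive_set bumps :: "real \<Rightarrow> real \<Rightarrow> (real \<Rightarrow> real) set" for \<alpha> \<beta> where
  rise: "(\<lambda>t. flat k (t - \<alpha>)) \<in> bumps \<alpha> \<beta>"
| fall: "(\<lambda>t. flat k (\<beta> - t)) \<in> bumps \<alpha> \<beta>"
| const: "(\<lambda>_. r) \<in> bumps \<alpha> \<beta>"
| add: "f \<in> bumps \<alpha> \<beta> \<Longrightarrow> g \<in> bumps \<alpha> \<beta> \<Longrightarrow> (\<lambda>t. f t + g t) \<in> bumps \<alpha> \<beta>"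
| mult: "f \<in> bumps \<alpha> \<beta> \<Longrightarrow> g \<in> bumps \<alpha> \<beta> \<Longrightarrow> (\<lambda>t. f t * g t) \<in> bumps \<alpha> \<beta>"

lemma bumps_deriv:
  assumes "f \<in> bumps \<alpha> \<beta>"
  shows "\<exists>f'\<in>bumps \<alpha> \<beta>. \<forall>t. (f has_real_derivative f' t) (at t)"
  using assms
proof induction
  case (rise k)
  show ?case
  proof (intro bexI allI)
    show "((\<lambda>t. flat k (t - \<alpha>)) has_real_derivative flat (Suc (Suc k)) (t - \<alpha>) + (- real k) * flat (Suc k) (t - \<alpha>)) (at t)" for t
      by (rule DERIV_chain2[OF has_real_derivative_flat, THEN DERIV_cong, of _ 1]) (auto intro!: derivative_eq_intros)
  qed (intro bumps.intros)
next
  case (fall k)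
  show ?case
  proof (intro bexI allI)
    show "((\<lambda>t. flat k (\<beta> - t)) has_real_derivative (- 1) * flat (Suc (Suc k)) (\<beta> - t) + real k * flat (Suc k) (\<beta> - t)) (at t)" for t
      by (rule DERIV_chain2[OF has_real_derivative_flat, THEN DERIV_cong, of _ "- 1"]) (auto intro!: derivative_eq_intros)
  qed (intro bumps.intros)
next
  case (const r)
  show ?case by (rule bexI[of _ "\<lambda>_. 0"]) (auto intro: bumps.intros)
next
  case (add f g)
  then obtain f' g' where "f' \<in> bumps \<alpha> \<beta>" "g' \<in> bumps \<alpha> \<beta>"
    "\<And>t. (f has_real_derivative f' t) (at t)" "\<And>t. (g has_real_derivative g' t) (at t)" by blast
  then show ?case by (intro bexI[of _ "\<lambda>t. f' t + g' t"]) (auto intro: bumps.intros DERIV_add)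
next
  case (mult f g)
  then obtain f' g' where "f' \<in> bumps \<alpha> \<beta>" "g' \<in> bumps \<alpha> \<beta>"
    "\<And>t. (f has_real_derivative f' t) (at t)" "\<And>t. (g has_real_derivative g' t) (at t)" by blast
  then show ?case using mult(1,2)
    by (intro bexI[of _ "\<lambda>t. f' t * g t + g' t * f t"]) (auto intro: bumps.intros DERIV_mult)
qed

lemma exists_bump:
  fixes \<alpha> \<beta> :: real
  assumes "\<alpha> < \<beta>"
  shows "\<exists>G g. (\<forall>t. (G has_real_derivative - g t) (at t)) \<and> smooth_real g \<and>
    (\<forall>t. G t \<ge> 0) \<and> (\<forall>t. \<alpha> < t \<longrightarrow> t < \<beta> \<longrightarrow> G t > 0) \<and>
    (\<forall>t. t \<le> \<alpha> \<or> t \<ge> \<beta> \<longrightarrow> G t = 0 \<and> g t = 0)"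
proof -
  define G where "G t = flat 0 (t - \<alpha>) * flat 0 (\<beta> - t)" for t
  define g where "g t = ((- 1) * flat 2 (t - \<alpha>)) * flat 0 (\<beta> - t) + flat 2 (\<beta> - t) * flat 0 (t - \<alpha>)" for t
  have F: "(flat 0 has_real_derivative flat 2 t) (at t)" for t
    using has_real_derivative_flat[of 0 t] by (simp add: numeral_2_eq_2)
  have "(G has_real_derivative - g t) (at t)" for t
    unfolding G_def g_def
    by (rule DERIV_cong, (rule DERIV_mult; rule DERIV_chain2[OF F])) (auto intro!: derivative_eq_intros)
  moreover have "g \<in> bumps \<alpha> \<beta>" unfolding g_def by (intro bumps.intros)
  then have "smooth_real g" using bumps_deriv by (rule smooth_real_if_closed)
  ultimately show ?thesis
    by (intro exI[of _ G] exI[of _ g]) (auto simp: G_def g_def flat_def)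
qed

text \<open>The coordinates are included because the gradient of \<open>quad\<close> is affine in
  them; together with products this makes the class closed under directional derivatives, which is
  what \<open>Ck\<close> asks for.\<close>

inductive_set quad_fields :: "real \<Rightarrow> real \<Rightarrow> real \<Rightarrow> real^2 \<Rightarrow> (real^2 \<Rightarrow> complex) set" for a b d c where
  of_quad: "smooth_real f \<Longrightarrow> (\<lambda>x. of_real (f (quad a b d (x - c)))) \<in> quad_fields a b d c"
| coord: "(\<lambda>x. of_real (x $ i)) \<in> quad_fields a b d c"
| const: "(\<lambda>_. z) \<in> quad_fields a b d c"
| add: "u \<in> quad_fields a b d c \<Longrightarrow> v \<in> quad_fields a b d c \<Longrightarrow> (\<lambda>x. u x + v x) \<in> quad_fields a b d c"
| mult: "u \<in> quad_fields a b d c \<Longrightarrow> v \<in> quad_fields a b d c \<Longrightarrow> (\<lambda>x. u x * v x) \<in> quad_fields a b d c"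

lemma has_derivative_quad:
  "((\<lambda>x. quad a b d (x - c)) has_derivative
     (\<lambda>v. v $ 1 * (2 * a * (x - c) $ 1 + 2 * b * (x - c) $ 2) + v $ 2 * (2 * b * (x - c) $ 1 + 2 * d * (x - c) $ 2))) (at x)"
proof -
  have nth: "((\<lambda>x. (x::real^2) $ i) has_derivative (\<lambda>v. v $ i)) (at x)" for i x
    by (rule bounded_linear.has_derivative[OF bounded_linear_vec_nth]) (rule has_derivative_ident)
  show ?thesis unfolding quad_def vector_minus_component
    by (rule has_derivative_eq_rhs, (rule derivative_intros nth)+) (auto simp: fun_eq_iff algebra_simps power2_eq_square)
qed

lemma quad_fields_deriv:
  assumes "u \<in> quad_fields a b d c"
  shows "\<exists>F. (\<forall>x. (u has_derivative F x) (at x)) \<and> (\<forall>v. (\<lambda>x. F x v) \<in> quad_fields a b d c)"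
  using assms
proof induction
  case (of_quad f)
  obtain f' where f': "smooth_real f'" "\<And>t. (f has_real_derivative f' t) (at t)" using smooth_realD[OF of_quad] by blast
  let ?l = "\<lambda>x v. v $ 1 * (2 * a * (x - c) $ 1 + 2 * b * (x - c) $ 2) + v $ 2 * (2 * b * (x - c) $ 1 + 2 * d * (x - c) $ 2)"
  let ?F = "\<lambda>x v. of_real (?l x v * f' (quad a b d (x - c))) :: complex"
  have "((\<lambda>x. of_real (f (quad a b d (x - c))) :: complex) has_derivative ?F x) (at x)" for x
  proof -
    have "((\<lambda>x. f (quad a b d (x - c))) has_derivative (\<lambda>v. ?l x v * f' (quad a b d (x - c)))) (at x)"
      by (rule DERIV_compose_FDERIV[OF f'(2) has_derivative_quad])
    then show ?thesis by (rule has_derivative_of_real)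
  qed
  moreover have "(\<lambda>x. ?F x v) \<in> quad_fields a b d c" for v
  proof -
    have "(\<lambda>x. (of_real (v $ 1) * (of_real (2 * a) * (of_real (x $ 1) + of_real (- (c $ 1))) + of_real (2 * b) * (of_real (x $ 2) + of_real (- (c $ 2))))
        + of_real (v $ 2) * (of_real (2 * b) * (of_real (x $ 1) + of_real (- (c $ 1))) + of_real (2 * d) * (of_real (x $ 2) + of_real (- (c $ 2)))))
        * of_real (f' (quad a b d (x - c)))) \<in> quad_fields a b d c"
      by (intro quad_fields.intros f')
    then show ?thesis by simp
  qed
  ultimately show ?case by (intro exI[of _ ?F]) blast
next
  case (coord i)
  have "((\<lambda>x. of_real (x $ i) :: complex) has_derivative (\<lambda>v. of_real (v $ i))) (at x)" for x :: "real^2"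
    by (intro has_derivative_of_real bounded_linear.has_derivative[OF bounded_linear_vec_nth] has_derivative_ident)
  then show ?case by (intro exI[of _ "\<lambda>x v. of_real (v $ i)"]) (auto intro: quad_fields.intros)
next
  case (const z)
  show ?case by (intro exI[of _ "\<lambda>x v. 0"]) (auto intro: quad_fields.intros)
next
  case (add u w)
  then obtain F H where "\<And>x. (u has_derivative F x) (at x)" "\<And>v. (\<lambda>x. F x v) \<in> quad_fields a b d c"
    "\<And>x. (w has_derivative H x) (at x)" "\<And>v. (\<lambda>x. H x v) \<in> quad_fields a b d c" by blast
  then show ?case
    by (intro exI[of _ "\<lambda>x v. F x v + H x v"] conjI allI has_derivative_add quad_fields.add)
next
  case (mult u w)
  then obtain F H where "\<And>x. (u has_derivative F x) (at x)" "\<And>v. (\<lambda>x. F x v) \<in> quad_fields a b d c"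
    "\<And>x. (w has_derivative H x) (at x)" "\<And>v. (\<lambda>x. H x v) \<in> quad_fields a b d c" by blast
  then show ?case using mult.hyps
    by (intro exI[of _ "\<lambda>x v. u x * H x v + F x v * w x"] conjI allI has_derivative_mult quad_fields.add quad_fields.mult)
qed

lemma Ck_quad_fields:
  assumes "u \<in> quad_fields a b d c"
  shows "Ck k u"
  using assms
proof (induction k arbitrary: u)
  case 0
  then obtain F where "\<And>x. (u has_derivative F x) (at x)" using quad_fields_deriv by blast
  then show ?case by (auto intro!: continuous_at_imp_continuous_on has_derivative_continuous)
next
  case (Suc k)
  obtain F where F: "\<And>x. (u has_derivative F x) (at x)" "\<And>v. (\<lambda>x. F x v) \<in> quad_fields a b d c"
    using quad_fields_deriv[OF Suc.prems] by blast
  have "frechet_derivative u (at x) = F x" for x using frechet_derivative_at[OF F(1)] by simp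
  then show ?case using F Suc.IH by (auto simp: differentiable_def)
qed

text \<open>Differentiation under the integral preserves the shape of the function and only replaces
  \<open>f\<close> by its derivative.\<close>

lemma smooth_real_integral:
  assumes "smooth_real f"
  shows "smooth_real (\<lambda>s. integral {- M..M} (\<lambda>\<sigma>. f (s + \<sigma>^2)))"
proof (rule smooth_real_if_closed)
  let ?B = "{\<lambda>s. integral {- M..M} (\<lambda>\<sigma>. f (s + \<sigma>^2)) |f. smooth_real f}"
  show "(\<lambda>s. integral {- M..M} (\<lambda>\<sigma>. f (s + \<sigma>^2))) \<in> ?B" using assms by auto
  fix g assume "g \<in> ?B"
  then obtain f where f: "smooth_real f" "g = (\<lambda>s. integral {- M..M} (\<lambda>\<sigma>. f (s + \<sigma>^2)))" by auto
  obtain f' where f': "smooth_real f'" "\<And>t. (f has_real_derivative f' t) (at t)" using smooth_realD[OF f(1)] by blast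
  have cont: "continuous_on S f'" "continuous_on S f" for S
    using f f' by (auto intro: continuous_on_smooth_real)
  have "(g has_real_derivative integral {- M..M} (\<lambda>\<sigma>. f' (s + \<sigma>^2))) (at s)" for s
  proof -
    have "((\<lambda>s. integral (cbox (- M) M) (\<lambda>\<sigma>. f (s + \<sigma>^2))) has_field_derivative
        integral (cbox (- M) M) (\<lambda>\<sigma>. f' (s + \<sigma>^2))) (at s within UNIV)"
    proof (rule leibniz_rule_field_derivative)
      show "((\<lambda>s. f (s + t^2)) has_field_derivative f' (s + t^2)) (at s within UNIV)" for s t
        using f'(2)[of "s + t^2"] by (simp only: DERIV_shift)
      show "(\<lambda>\<sigma>. f (s + \<sigma>^2)) integrable_on cbox (- M) M" for s
        by (intro integrable_continuous continuous_on_compose2[OF cont(2)[of UNIV]] continuous_intros) auto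
      show "continuous_on (UNIV \<times> cbox (- M) M) (\<lambda>(s, \<sigma>). f' (s + \<sigma>^2))"
        unfolding case_prod_beta by (intro continuous_on_compose2[OF cont(1)[of UNIV]] continuous_intros) auto
    qed auto
    then show ?thesis unfolding f(2) by simp
  qed
  moreover have "(\<lambda>s. integral {- M..M} (\<lambda>\<sigma>. f' (s + \<sigma>^2))) \<in> ?B" using f'(1) by auto
  ultimately show "\<exists>g'\<in>?B. \<forall>t. (g has_real_derivative g' t) (at t)" by (intro bexI allI)
qed

section \<open>Smooth solutions for a given ellipse\<close>

text \<open>By \<open>M^2 \<ge> \<beta>\<close> the interval \<open>{- M..M}\<close> contains every
  \<sigma> at which \<open>g (s + \<sigma>^2)\<close> is nonzero, for all \<open>s \<ge> 0\<close>.
  So the integral over the whole line is obtained without improper integrals; negative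
  \<open>s\<close> do not occur as values of the quadratic form.\<close>

locale bump =
  fixes \<alpha> \<beta> M :: real and G g :: "real \<Rightarrow> real"
  assumes M: "M > 0" "M^2 \<ge> \<beta>" and \<alpha>: "0 < \<alpha>" "\<alpha> < \<beta>"
    and G: "(G has_real_derivative - g t) (at t)"
    and g: "smooth_real g"
    and G_nonneg: "G t \<ge> 0"
    and G_pos: "\<alpha> < t \<Longrightarrow> t < \<beta> \<Longrightarrow> G t > 0"
    and G_0: "t \<le> \<alpha> \<or> t \<ge> \<beta> \<Longrightarrow> G t = 0"
    and g_0: "t \<le> \<alpha> \<or> t \<ge> \<beta> \<Longrightarrow> g t = 0"
begin

definition profile :: "real \<Rightarrow> real"
  where "profile s = integral {- M..M} (\<lambda>\<sigma>. g (s + \<sigma>^2))"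

lemma smooth_profile: "smooth_real profile"
  unfolding profile_def by (rule smooth_real_integral[OF g])

lemma continuous_profile: "continuous_on S profile"
  by (rule continuous_on_smooth_real[OF smooth_profile])

lemma continuous_g: "continuous_on S g"
  by (rule continuous_on_smooth_real[OF g])

lemma profile_eq_0: "s \<ge> \<beta> \<Longrightarrow> profile s = 0"
  unfolding profile_def using g_0 by (simp add: add_increasing2)

text \<open>Dividing by \<open>\<rho>\<close> is harmless because \<open>G\<close> vanishes near \<open>m\<close>. The product rule then
  turns \<open>g (m + \<rho>)\<close>, with \<open>\<rho>\<close> a quadratic form, into a divergence.\<close>

lemma exists_quotient:
  assumes m: "m < \<alpha>"
  shows "\<exists>\<kappa> \<kappa>'. (\<forall>\<rho>. (\<kappa> has_real_derivative \<kappa>' \<rho>) (at \<rho>)) \<and> continuous_on UNIV \<kappa>' \<and>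
    (\<forall>\<rho>. \<rho> * \<kappa>' \<rho> = - g (m + \<rho>) - \<kappa> \<rho>) \<and> (\<forall>\<rho>\<ge>0. \<kappa> \<rho> \<ge> 0) \<and>
    (\<forall>\<rho>. m + \<rho> \<ge> \<beta> \<longrightarrow> \<kappa> \<rho> = 0) \<and> (\<forall>\<rho>. \<alpha> < m + \<rho> \<longrightarrow> m + \<rho> < \<beta> \<longrightarrow> \<kappa> \<rho> > 0)"
proof -
  \<comment> \<open>At \<rho> = 0 both quotients are 0 by the convention for division. This is the
    right value, because \<open>G\<close> and \<open>g\<close> vanish below \<alpha>.\<close>
  define \<kappa> where "\<kappa> \<rho> = G (m + \<rho>) / \<rho>" for \<rho>
  define \<kappa>' where "\<kappa>' \<rho> = (- g (m + \<rho>) - \<kappa> \<rho>) / \<rho>" for \<rho>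
  have z: "\<kappa> \<rho> = 0" "\<kappa>' \<rho> = 0" if "\<rho> < \<alpha> - m" for \<rho>
    using that by (auto simp: \<kappa>_def \<kappa>'_def G_0 g_0)
  have op: "open {..<\<alpha> - m}" "0 \<in> {..<\<alpha> - m}" using m by auto
  have \<kappa>: "(\<kappa> has_real_derivative \<kappa>' \<rho>) (at \<rho>)" for \<rho>
  proof (cases "\<rho> = 0")
    case True
    have "((\<lambda>_. 0) has_real_derivative \<kappa>' \<rho>) (at \<rho>)" using z(2)[of 0] m True by simp
    then show ?thesis
      by (rule has_field_derivative_transform_within_open[OF _ op(1)]) (use True op z in auto)
  next
    case False
    have "((\<lambda>\<rho>. G (m + \<rho>)) has_real_derivative - g (m + \<rho>)) (at \<rho>)"
      using G[of "\<rho> + m"] by (simp only: DERIV_shift add.commute)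
    then show ?thesis unfolding \<kappa>_def[abs_def] \<kappa>'_def using False
      by (auto intro!: derivative_eq_intros simp: \<kappa>_def field_simps)
  qed
  have "isCont \<kappa>' \<rho>" for \<rho>
  proof (cases "\<rho> = 0")
    case True
    have "continuous_on {..<\<alpha> - m} \<kappa>' \<longleftrightarrow> continuous_on {..<\<alpha> - m} (\<lambda>_. 0 :: real)"
      by (rule continuous_on_cong) (use z in auto)
    then show ?thesis using op True by (simp add: continuous_on_eq_continuous_at)
  next
    case False
    have "isCont (\<lambda>\<rho>. g (m + \<rho>)) \<rho>"
      by (intro continuous_on_interior[of UNIV] continuous_on_compose2[OF continuous_g[of UNIV]] continuous_intros) auto
    then show ?thesis unfolding \<kappa>'_def[abs_def] using False DERIV_isCont[OF \<kappa>[of \<rho>]]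
      by (intro continuous_intros)
  qed
  moreover have "\<rho> * \<kappa>' \<rho> = - g (m + \<rho>) - \<kappa> \<rho>" for \<rho>
    using z[of 0] m by (cases "\<rho> = 0") (auto simp: \<kappa>'_def g_0 \<kappa>_def)
  moreover have "\<kappa> \<rho> \<ge> 0" if "\<rho> \<ge> 0" for \<rho> using that G_nonneg by (simp add: \<kappa>_def)
  moreover have "\<kappa> \<rho> > 0" if "\<alpha> < m + \<rho>" "m + \<rho> < \<beta>" for \<rho>
    unfolding \<kappa>_def using that G_pos m by (intro divide_pos_pos) auto
  moreover have "\<kappa> \<rho> = 0" if "m + \<rho> \<ge> \<beta>" for \<rho> using that by (simp add: \<kappa>_def G_0)
  ultimately show ?thesis using \<kappa>
    by (intro exI[of _ \<kappa>] exI[of _ \<kappa>']) (simp add: continuous_at_imp_continuous_on)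
qed

text \<open>The derivative of \<open>\<sigma> * \<kappa> (\<sigma>^2)\<close> is
  \<open>- 2 * g (s + \<sigma>^2) - \<kappa> (\<sigma>^2)\<close>, and the boundary terms vanish.
  Hence \<open>- 2 * profile s\<close> is the integral of the nonnegative function
  \<open>\<kappa> (\<sigma>^2)\<close>.\<close>

lemma profile_neg:
  assumes s: "0 \<le> s" "s < \<alpha>"
  shows "profile s < 0"
proof -
  obtain \<kappa> \<kappa>' where \<kappa>: "\<And>\<rho>. (\<kappa> has_real_derivative \<kappa>' \<rho>) (at \<rho>)" "continuous_on UNIV \<kappa>'"
    "\<And>\<rho>. \<rho> * \<kappa>' \<rho> = - g (s + \<rho>) - \<kappa> \<rho>" "\<And>\<rho>. \<rho> \<ge> 0 \<Longrightarrow> \<kappa> \<rho> \<ge> 0"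
    "\<And>\<rho>. s + \<rho> \<ge> \<beta> \<Longrightarrow> \<kappa> \<rho> = 0" "\<And>\<rho>. \<alpha> < s + \<rho> \<Longrightarrow> s + \<rho> < \<beta> \<Longrightarrow> \<kappa> \<rho> > 0"
    using exists_quotient[OF s(2)] by auto
  have cont: "continuous_on UNIV \<kappa>"
    using \<kappa>(1) by (auto intro!: continuous_at_imp_continuous_on DERIV_isCont)
  have cont2: "continuous_on S (\<lambda>\<sigma>. \<kappa> (\<sigma>^2))" for S :: "real set"
    by (intro continuous_on_compose2[OF cont] continuous_intros) auto
  have "((\<lambda>\<sigma>. - 2 * g (s + \<sigma>^2) - \<kappa> (\<sigma>^2)) has_integral M * \<kappa> (M^2) - (- M) * \<kappa> ((- M)^2)) {- M..M}"
  proof (rule fundamental_theorem_of_calculus)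
    show "- M \<le> M" using M by simp
    fix \<sigma>
    have "((\<lambda>\<sigma>. \<kappa> (\<sigma>^2)) has_real_derivative \<kappa>' (\<sigma>^2) * (2 * \<sigma>)) (at \<sigma>)"
      by (rule DERIV_chain2[OF \<kappa>(1)]) (auto intro!: derivative_eq_intros)
    then have "((\<lambda>\<sigma>. \<sigma> * \<kappa> (\<sigma>^2)) has_real_derivative 1 * \<kappa> (\<sigma>^2) + \<kappa>' (\<sigma>^2) * (2 * \<sigma>) * \<sigma>) (at \<sigma>)"
      by (intro DERIV_mult DERIV_ident)
    moreover have "1 * \<kappa> (\<sigma>^2) + \<kappa>' (\<sigma>^2) * (2 * \<sigma>) * \<sigma> = - 2 * g (s + \<sigma>^2) - \<kappa> (\<sigma>^2)"
      using \<kappa>(3)[of "\<sigma>^2"] by (simp add: power2_eq_square algebra_simps)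
    ultimately show "((\<lambda>\<sigma>. \<sigma> * \<kappa> (\<sigma>^2)) has_vector_derivative - 2 * g (s + \<sigma>^2) - \<kappa> (\<sigma>^2)) (at \<sigma> within {- M..M})"
      by (simp only: has_vector_derivative_at_within has_real_derivative_iff_has_vector_derivative)
  qed
  moreover have "\<kappa> (M^2) = 0" using \<kappa>(5) M s by simp
  ultimately have "((\<lambda>\<sigma>. - 2 * g (s + \<sigma>^2) - \<kappa> (\<sigma>^2)) has_integral 0) {- M..M}" by simp
  then have "((\<lambda>\<sigma>. - 2 * g (s + \<sigma>^2) - \<kappa> (\<sigma>^2) + \<kappa> (\<sigma>^2)) has_integral 0 + integral {- M..M} (\<lambda>\<sigma>. \<kappa> (\<sigma>^2))) {- M..M}"
    by (intro has_integral_add integrable_integral integrable_continuous_interval cont2)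
  then have "integral {- M..M} (\<lambda>\<sigma>. - 2 * g (s + \<sigma>^2)) = integral {- M..M} (\<lambda>\<sigma>. \<kappa> (\<sigma>^2))"
    by (intro integral_unique) simp
  then have eq: "- 2 * profile s = integral {- M..M} (\<lambda>\<sigma>. \<kappa> (\<sigma>^2))"
    unfolding profile_def integral_mult_right .
  \<comment> \<open>Chosen such that \<open>s + \<sigma>^2\<close> is the midpoint of \<alpha> and
    \<beta>, where \<kappa> is positive; this makes the integral nonzero.\<close>
  define \<sigma> where "\<sigma> = sqrt ((\<alpha> + \<beta>) / 2 - s)"
  have \<sigma>: "\<sigma>^2 = (\<alpha> + \<beta>) / 2 - s" "\<sigma> \<ge> 0" using s \<alpha> by (auto simp: \<sigma>_def)
  have "\<kappa> (\<sigma>^2) > 0" by (rule \<kappa>(6)) (use \<sigma> \<alpha> in auto)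
  moreover have "\<sigma> \<in> {- M..M}"
  proof -
    have "\<sigma>^2 \<le> M^2" unfolding \<sigma>(1) using s(1) M(2) \<alpha>(2) by (simp add: field_simps)
    then have "\<sigma> \<le> M" by (rule power2_le_imp_le) (use M in simp)
    then show ?thesis using \<sigma>(2) M by simp
  qed
  ultimately have "integral {- M..M} (\<lambda>\<sigma>. \<kappa> (\<sigma>^2)) \<noteq> 0"
    using M \<kappa>(4) by (subst integral_eq_0_iff[OF cont2]) force+
  moreover have "integral {- M..M} (\<lambda>\<sigma>. \<kappa> (\<sigma>^2)) \<ge> 0"
    by (rule integral_nonneg[OF integrable_continuous_interval[OF cont2]]) (use \<kappa>(4) in auto)
  ultimately show ?thesis using eq by linarith
qed

text \<open>Underlying fact: the area of the set where \<open>R \<le> \<rho>\<close> is proportional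
  to \<rho>, so the planar integral of \<open>g (m + R)\<close> is a multiple of the integral of
  \<open>g\<close> from \<open>m\<close> to infinity, which is \<open>G m = 0\<close>. The proof
  uses the field \<kappa>(R) (t - t0, \<sigma>), whose divergence \<open>P + Q\<close> is
  \<open>- 2 * g (m + R)\<close>; each component is integrated in its own variable first.\<close>

lemma integral_profile_parabola:
  assumes A: "A > 0" and m: "0 \<le> m" "m < \<alpha>" and T: "T > 0" "A * T^2 \<ge> \<beta>"
  shows "integral {t0 - T..t0 + T} (\<lambda>t. profile (A * (t - t0)^2 + m)) = 0"
proof -
  obtain \<kappa> \<kappa>' where \<kappa>: "\<And>\<rho>. (\<kappa> has_real_derivative \<kappa>' \<rho>) (at \<rho>)" "continuous_on UNIV \<kappa>'"
    "\<And>\<rho>. \<rho> * \<kappa>' \<rho> = - g (m + \<rho>) - \<kappa> \<rho>"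
    "\<And>\<rho>. m + \<rho> \<ge> \<beta> \<Longrightarrow> \<kappa> \<rho> = 0"
    using exists_quotient[OF m(2)] by auto
  have cont: "continuous_on UNIV \<kappa>"
    using \<kappa>(1) by (auto intro!: continuous_at_imp_continuous_on DERIV_isCont)
  define R where "R t \<sigma> = A * (t - t0)^2 + \<sigma>^2" for t \<sigma>
  define P where "P t \<sigma> = \<kappa> (R t \<sigma>) + \<kappa>' (R t \<sigma>) * (2 * A * (t - t0)) * (t - t0)" for t \<sigma>
  define Q where "Q t \<sigma> = \<kappa> (R t \<sigma>) + \<kappa>' (R t \<sigma>) * (2 * \<sigma>) * \<sigma>" for t \<sigma>
  have R0: "A * (t - t0)^2 \<ge> 0" for t using A by simp
  have sum: "P t \<sigma> + Q t \<sigma> = - 2 * g (m + R t \<sigma>)" for t \<sigma>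
  proof -
    have "P t \<sigma> + Q t \<sigma> = 2 * \<kappa> (R t \<sigma>) + 2 * (R t \<sigma> * \<kappa>' (R t \<sigma>))"
      by (simp add: P_def Q_def R_def power2_eq_square algebra_simps)
    then show ?thesis unfolding \<kappa>(3) by simp
  qed
  have contP: "continuous_on S (\<lambda>z. P (fst z) (snd z))" for S
    unfolding P_def R_def
    by (intro continuous_intros continuous_on_compose2[OF cont] continuous_on_compose2[OF \<kappa>(2)]) auto
  have "(P t has_integral - 2 * profile (A * (t - t0)^2 + m)) {- M..M}" for t
  proof -
    have "(Q t has_integral M * \<kappa> (R t M) - (- M) * \<kappa> (R t (- M))) {- M..M}"
    proof (rule fundamental_theorem_of_calculus)
      show "- M \<le> M" using M by simp
      fix \<sigma>
      have "((\<lambda>\<sigma>. \<kappa> (R t \<sigma>)) has_real_derivative \<kappa>' (R t \<sigma>) * (2 * \<sigma>)) (at \<sigma>)"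
        unfolding R_def by (rule DERIV_chain2[OF \<kappa>(1)]) (auto intro!: derivative_eq_intros)
      then have "((\<lambda>\<sigma>. \<sigma> * \<kappa> (R t \<sigma>)) has_real_derivative 1 * \<kappa> (R t \<sigma>) + \<kappa>' (R t \<sigma>) * (2 * \<sigma>) * \<sigma>) (at \<sigma>)"
        by (intro DERIV_mult DERIV_ident)
      then show "((\<lambda>\<sigma>. \<sigma> * \<kappa> (R t \<sigma>)) has_vector_derivative Q t \<sigma>) (at \<sigma> within {- M..M})"
        unfolding Q_def
        by (simp only: mult_1_left has_vector_derivative_at_within has_real_derivative_iff_has_vector_derivative)
    qed
    moreover have "\<kappa> (R t M) = 0" "\<kappa> (R t (- M)) = 0"
      using R0[of t] M m by (auto intro!: \<kappa>(4) simp: R_def)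
    ultimately have Q: "(Q t has_integral 0) {- M..M}" by simp
    have "((\<lambda>\<sigma>. - 2 * g (A * (t - t0)^2 + m + \<sigma>^2)) has_integral - 2 * profile (A * (t - t0)^2 + m)) {- M..M}"
      unfolding profile_def
      by (intro has_integral_mult_right integrable_integral integrable_continuous_interval
          continuous_on_compose2[OF continuous_g[of UNIV]] continuous_intros) auto
    then have "((\<lambda>\<sigma>. P t \<sigma> + Q t \<sigma>) has_integral - 2 * profile (A * (t - t0)^2 + m)) {- M..M}"
      unfolding sum by (simp add: R_def algebra_simps)
    from has_integral_diff[OF this Q] show ?thesis by simp
  qed
  then have Pt: "integral {- M..M} (P t) = - 2 * profile (A * (t - t0)^2 + m)" for t
    by (rule integral_unique)
  have "((\<lambda>t. P t \<sigma>) has_integral (t0 + T - t0) * \<kappa> (R (t0 + T) \<sigma>) - (t0 - T - t0) * \<kappa> (R (t0 - T) \<sigma>)) {t0 - T..t0 + T}" for \<sigma>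
  proof (rule fundamental_theorem_of_calculus)
    show "t0 - T \<le> t0 + T" using T by simp
    fix t
    have "((\<lambda>t. \<kappa> (R t \<sigma>)) has_real_derivative \<kappa>' (R t \<sigma>) * (2 * A * (t - t0))) (at t)"
      unfolding R_def by (rule DERIV_chain2[OF \<kappa>(1)]) (auto intro!: derivative_eq_intros)
    moreover have "((\<lambda>t. t - t0) has_real_derivative 1) (at t)" by (auto intro!: derivative_eq_intros)
    ultimately have "((\<lambda>t. (t - t0) * \<kappa> (R t \<sigma>)) has_real_derivative 1 * \<kappa> (R t \<sigma>) + \<kappa>' (R t \<sigma>) * (2 * A * (t - t0)) * (t - t0)) (at t)"
      by (intro DERIV_mult)
    then show "((\<lambda>t. (t - t0) * \<kappa> (R t \<sigma>)) has_vector_derivative P t \<sigma>) (at t within {t0 - T..t0 + T})"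
      unfolding P_def
      by (simp only: mult_1_left has_vector_derivative_at_within has_real_derivative_iff_has_vector_derivative)
  qed
  moreover have "\<kappa> (R (t0 + T) \<sigma>) = 0" "\<kappa> (R (t0 - T) \<sigma>) = 0" for \<sigma>
    using T m by (auto intro!: \<kappa>(4) simp: R_def add_increasing add_increasing2)
  ultimately have P\<sigma>: "((\<lambda>t. P t \<sigma>) has_integral 0) {t0 - T..t0 + T}" for \<sigma> by simp
  have "- 2 * integral {t0 - T..t0 + T} (\<lambda>t. profile (A * (t - t0)^2 + m)) = integral {t0 - T..t0 + T} (\<lambda>t. integral {- M..M} (P t))"
    unfolding Pt by (rule integral_mult_right[symmetric])
  also have "\<dots> = integral {- M..M} (\<lambda>\<sigma>. integral {t0 - T..t0 + T} (\<lambda>t. P t \<sigma>))"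
    using integral_swap_continuous[of "t0 - T" "- M" "t0 + T" M P] contP by (simp add: case_prod_beta)
  also have "\<dots> = 0" using integral_unique[OF P\<sigma>] by simp
  finally show ?thesis by simp
qed

lemma LINT_profile_parabola:
  assumes A: "A > 0" and m: "0 \<le> m" "m < \<alpha>"
  shows "(LINT t|lebesgue. profile (A * (t - t0)^2 + m)) = 0"
proof -
  define T where "T = sqrt (\<beta> / A)"
  have T: "T > 0" "A * T^2 = \<beta>" using A \<alpha> by (auto simp: T_def)
  have cont: "continuous_on S (\<lambda>t. profile (A * (t - t0)^2 + m))" for S
    by (intro continuous_on_compose2[OF continuous_profile[of UNIV]] continuous_intros) auto
  let ?S = "{t0 - T..t0 + T}"
  have out: "profile (A * (t - t0)^2 + m) = 0" if "t \<notin> ?S" for t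
  proof -
    have "T \<le> \<bar>t - t0\<bar>" using that by auto
    then have "T^2 \<le> \<bar>t - t0\<bar>^2" using T by (intro power_mono) auto
    then have "A * T^2 \<le> A * (t - t0)^2" using A by simp
    then show ?thesis using T m by (intro profile_eq_0) simp
  qed
  have "(LINT t|lebesgue. profile (A * (t - t0)^2 + m)) = (LINT t|lborel. profile (A * (t - t0)^2 + m))"
    by (rule integral_completion) (simp add: borel_measurable_continuous_onI cont)
  also have "\<dots> = (LINT t:?S|lborel. profile (A * (t - t0)^2 + m))"
    unfolding set_lebesgue_integral_def
    by (intro Bochner_Integration.integral_cong refl) (use out in \<open>auto simp: indicator_def\<close>)
  also have "\<dots> = integral ?S (\<lambda>t. profile (A * (t - t0)^2 + m))"
    by (intro set_borel_integral_eq_integral borel_integrable_atLeastAtMost' cont)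
  also have "\<dots> = 0" using A m T by (intro integral_profile_parabola) auto
  finally show ?thesis .
qed

end

section \<open>Construction of the smooth solution\<close>

lemma in_supp_if_continuous:
  assumes u: "continuous_on UNIV u" and x: "u x \<noteq> 0"
  shows "x \<in> supp u"
proof (rule ccontr)
  assume "x \<notin> supp u"
  define W where "W = - supp u \<inter> {x. u x \<noteq> 0}"
  have "open {x. u x \<noteq> 0}"
    using open_Collect_neq[OF u continuous_on_const] .
  then have W: "open W" "x \<in> W" using x \<open>x \<notin> supp u\<close> closed_supp[of u] by (auto simp: W_def)
  have "AE x in lebesgue. x \<notin> W" using AE_supp[of u] by eventually_elim (auto simp: W_def)
  then have "W \<in> null_sets lebesgue"
    using W(1) by (subst (asm) AE_iff_null_sets[symmetric]) auto
  then show False using W open_not_negligible negligible_iff_null_sets by blast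
qed

lemma L1_interior_solution_if_smooth:
  assumes "smooth_interior_solution D0 D u"
  shows "L1_interior_solution D0 D u"
proof -
  have u: "\<And>k. Ck k u" "supp u \<Subset> D" "\<exists>x. u x \<noteq> 0"
    and rad: "\<And>\<omega> p. \<omega> \<in> sphere 0 1 \<Longrightarrow> line \<omega> p \<inter> D0 \<noteq> {} \<Longrightarrow> radon u \<omega> p = 0"
    using assms by (auto simp: smooth_interior_solution_def Cc_infinity_def)
  have cont: "continuous_on UNIV u" using u(1)[of 0] by simp
  have comp: "compact (supp u)" using u(2) closed_supp[of u] by (simp add: relatively_compact_in_def)
  have "integrable lborel (\<lambda>x. indicator (supp u) x *\<^sub>R u x)"
    by (rule borel_integrable_compact[OF comp continuous_on_subset[OF cont]]) simp
  also have "(\<lambda>x. indicator (supp u) x *\<^sub>R u x) = u"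
    using in_supp_if_continuous[OF cont] by (auto simp: fun_eq_iff indicator_def)
  finally have "integrable lebesgue u"
    using integrable_completion[of u lborel] borel_measurable_continuous_onI[OF cont] by simp
  moreover have "\<not> (AE x in lebesgue. u x = 0)"
  proof
    assume ae: "AE x in lebesgue. u x = 0"
    obtain x where "u x \<noteq> 0" using u(3) by blast
    then have "x \<in> supp u" by (rule in_supp_if_continuous[OF cont])
    moreover have "AE x in lebesgue. x \<in> UNIV \<longrightarrow> u x = 0" using ae by simp
    ultimately show False unfolding supp_def by blast
  qed
  moreover have "AE (\<omega>, p) in arc_length \<Otimes>\<^sub>M lborel. line \<omega> p \<inter> D0 \<noteq> {} \<longrightarrow> radon u \<omega> p = 0"
  proof (rule AE_I2, clarify, rule rad)
    fix \<omega> p x assume "(\<omega>, p) \<in> space (arc_length \<Otimes>\<^sub>M lborel)"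
    then show "\<omega> \<in> sphere 0 1" by (auto simp: space_pair_measure arc_length_def space_restrict_space)
  qed auto
  ultimately show ?thesis using u(2) by (simp add: L1_interior_solution_def)
qed

lemma quad_pos:
  assumes "a > 0" "a * d - b^2 > 0" "z \<noteq> 0"
  shows "quad a b d z > 0"
proof -
  have "(z $ 1, z $ 2) \<noteq> (0, 0)" using assms(3) by (auto simp: vec_eq_iff forall_2)
  then show ?thesis using positive_definite_form_2[of a b d] assms(1,2) by (auto simp: quad_def)
qed

lemma quad_nonneg: "a > 0 \<Longrightarrow> a * d - b^2 > 0 \<Longrightarrow> quad a b d z \<ge> 0"
  using quad_pos[of a d b z] by (cases "z = 0") (auto simp: quad_def)

lemma quad_scaleR: "quad a b d (r *\<^sub>R z) = r^2 * quad a b d z"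
  by (simp add: quad_def power2_eq_square algebra_simps)

lemma quad_line:
  assumes ab: "a > 0" "a * d - b^2 > 0" and n: "n \<noteq> 0"
  shows "\<exists>A t0 m. A > 0 \<and> m \<ge> 0 \<and> (\<forall>t. quad a b d (y + t *\<^sub>R n) = A * (t - t0)^2 + m)"
proof -
  define A where "A = quad a b d n"
  define B where "B = a * (y $ 1 * n $ 1) + b * (y $ 1 * n $ 2 + y $ 2 * n $ 1) + d * (y $ 2 * n $ 2)"
  define C where "C = quad a b d y"
  have A: "A > 0" unfolding A_def by (rule quad_pos[OF ab n])
  have q: "quad a b d (y + t *\<^sub>R n) = A * t^2 + 2 * B * t + C" for t
    by (simp add: A_def B_def C_def quad_def power2_eq_square algebra_simps)
  also have "A * t^2 + 2 * B * t + C = A * (t - (- B / A))^2 + (C - B^2 / A)" for t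
    using A by (simp add: field_simps power2_eq_square)
  finally have eq: "quad a b d (y + t *\<^sub>R n) = A * (t - (- B / A))^2 + (C - B^2 / A)" for t .
  moreover have "C - B^2 / A \<ge> 0" using eq[of "- B / A"] quad_nonneg[OF ab, of "y + (- B / A) *\<^sub>R n"] by simp
  ultimately show ?thesis using A by blast
qed

lemma exists_enlarged_ellipse:
  assumes ab: "a > 0" "a * d - b^2 > 0" and comp: "compact {x. quad a b d (x - c) \<le> 1}"
    and D: "open D" "{x. quad a b d (x - c) \<le> 1} \<subseteq> D"
  shows "\<exists>\<beta>>1. {x. quad a b d (x - c) \<le> \<beta>} \<subseteq> D"
proof -
  let ?E = "{x. quad a b d (x - c) \<le> 1}"
  obtain \<epsilon> where \<epsilon>: "\<epsilon> > 0" "(\<Union>x\<in>?E. ball x \<epsilon>) \<subseteq> D"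
    using compact_subset_open_imp_ball_epsilon_subset[OF comp D] by blast
  obtain R where R: "R > 0" "\<And>x. x \<in> ?E \<Longrightarrow> norm x \<le> R"
    using compact_imp_bounded[OF comp] by (auto simp: bounded_pos)
  \<comment> \<open>Scaling by \<open>r\<close> about \<open>c\<close> moves a point of the ellipse
    by at most \<open>(r - 1) * (R + norm c)\<close>, which is half of \<epsilon>.\<close>
  define r where "r = 1 + \<epsilon> / (2 * (R + norm c))"
  have Rc: "R + norm c > 0" using R(1) norm_ge_zero[of c] by linarith
  then have r: "r > 1" using \<epsilon>(1) by (simp add: r_def)
  show ?thesis
  proof (intro exI[of _ "r^2"] conjI subsetI)
    show "1 < r^2" using r by (simp add: one_less_power)
    fix x assume "x \<in> {x. quad a b d (x - c) \<le> r^2}"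
    then have x: "quad a b d (x - c) \<le> r^2" by simp
    define y where "y = c + (1 / r) *\<^sub>R (x - c)"
    have "quad a b d (y - c) = quad a b d (x - c) / r^2"
      by (simp add: y_def quad_scaleR power_divide)
    then have y: "y \<in> ?E" using x r by (simp add: divide_le_eq)
    have "x - y = (r - 1) *\<^sub>R (y - c)"
      using r by (simp add: y_def vec_eq_iff field_simps)
    then have "dist y x = (r - 1) * norm (y - c)" using r by (simp add: dist_norm norm_minus_commute)
    also have "\<dots> \<le> (r - 1) * (R + norm c)"
      using r R(2)[OF y] norm_triangle_ineq4[of y c] by (intro mult_left_mono) auto
    also have "\<dots> = \<epsilon> / 2" using Rc unfolding r_def by (simp add: divide_simps)
    also have "\<dots> < \<epsilon>" using \<epsilon>(1) by simp
    finally show "x \<in> D" using \<epsilon>(2) y by (auto simp: subset_iff)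
  qed
qed

lemma exists_smooth_solution:
  assumes D: "open D" and sep: "separating_ellipse D0 D c E"
  shows "\<exists>u. smooth_interior_solution D0 D u \<and> (\<forall>x. u x \<in> \<real>) \<and> centrally_symmetric c u \<and>
    (\<exists>V. open V \<and> E \<subseteq> V \<and> (\<forall>x\<in>V. Re (u x) < 0)) \<and> E \<subseteq> supp u"
proof -
  have E: "is_ellipse c E" "closure D0 \<subseteq> E" "compact (closure E)" "closure E \<subseteq> D"
    using sep by (auto simp: separating_ellipse_def relatively_compact_in_def)
  obtain a b d where ab: "a > 0" "a * d - b^2 > 0" and E_eq: "E = {x. quad a b d (x - c) \<le> 1}"
    using E(1) unfolding is_ellipse_iff_quad by blast
  obtain \<beta> where \<beta>: "\<beta> > 1" "{x. quad a b d (x - c) \<le> \<beta>} \<subseteq> D"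
    using exists_enlarged_ellipse[OF ab _ D, of c] compact_ellipse[OF E(1)] E(4) closure_subset[of E]
    unfolding E_eq by blast
  \<comment> \<open>The bump sits between \<alpha> and \<beta>, strictly beyond the level 1 of
    \<open>E\<close>. The margin from 1 to \<alpha> provides the neighbourhood of \<open>E\<close>
    on which \<open>u\<close> is negative, and \<beta> bounds the support.\<close>
  define \<alpha> where "\<alpha> = (1 + \<beta>) / 2"
  have \<alpha>1: "1 < \<alpha>" "\<alpha> < \<beta>" using \<beta>(1) by (auto simp: \<alpha>_def)
  obtain G g where Gg: "\<And>t. (G has_real_derivative - g t) (at t)" "smooth_real g"
    "\<And>t. G t \<ge> 0" "\<And>t. \<alpha> < t \<Longrightarrow> t < \<beta> \<Longrightarrow> G t > 0"
    "\<And>t. t \<le> \<alpha> \<or> t \<ge> \<beta> \<Longrightarrow> G t = 0" "\<And>t. t \<le> \<alpha> \<or> t \<ge> \<beta> \<Longrightarrow> g t = 0"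
    using exists_bump[OF \<alpha>1(2)] by blast
  interpret bump \<alpha> \<beta> "sqrt \<beta>" G g
    by unfold_locales (use Gg \<alpha>1 in auto)
  define u :: "real^2 \<Rightarrow> complex" where "u x = of_real (profile (quad a b d (x - c)))" for x
  have smooth: "Ck k u" for k
    by (rule Ck_quad_fields) (auto simp: u_def[abs_def] intro: quad_fields.of_quad smooth_profile)
  have neg: "Re (u x) < 0" if "quad a b d (x - c) < \<alpha>" for x
    using profile_neg[OF quad_nonneg[OF ab] that] by (simp add: u_def)
  define F where "F = {x. quad a b d (x - c) \<le> \<beta>}"
  have "is_ellipse c F" unfolding is_ellipse_iff_quad F_def
  proof (intro exI conjI)
    show "a / \<beta> > 0" "a / \<beta> * (d / \<beta>) - (b / \<beta>)^2 > 0"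
      using ab \<beta>(1) by (auto simp: power2_eq_square diff_divide_distrib[symmetric])
    show "{x. quad a b d (x - c) \<le> \<beta>} = {x. quad (a / \<beta>) (b / \<beta>) (d / \<beta>) (x - c) \<le> 1}"
      using \<beta>(1) by (auto simp: quad_def field_simps)
  qed
  then have F: "compact F" by (rule compact_ellipse)
  have "supp u \<subseteq> F"
  proof -
    have "AE x in lebesgue. x \<in> - F \<longrightarrow> u x = 0"
      by (intro AE_I2) (auto simp: F_def u_def profile_eq_0)
    moreover have "open (- F)" using compact_imp_closed[OF F] by blast
    ultimately show ?thesis unfolding supp_def by blast
  qed
  then have "supp u \<Subset> D"
    using \<beta>(2) F closed_supp[of u] compact_Int_closed[OF F closed_supp[of u]]
    by (auto simp: relatively_compact_in_def F_def Int_absorb1 Int_absorb2)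
  moreover have "c \<in> E" by (simp add: E_eq quad_def)
  then have "u c \<noteq> 0" using neg[of c] \<alpha>1 by (auto simp: quad_def)
  moreover have "radon u \<omega> p = 0" if \<omega>: "\<omega> \<in> sphere 0 1" and meet: "line \<omega> p \<inter> D0 \<noteq> {}" for \<omega> p
  proof -
    obtain x where x: "x \<bullet> \<omega> = p" "x \<in> D0" using meet by (auto simp: line_def)
    have n1: "(\<omega> $ 1)^2 + (\<omega> $ 2)^2 = 1" using \<omega> norm_vec2[of \<omega>] by simp
    then have "perp \<omega> \<noteq> 0" by (auto simp: vec_eq_iff forall_2 perp_simps)
    then obtain A t0 m where A: "A > 0" "m \<ge> 0"
      "\<And>t. quad a b d ((p *\<^sub>R \<omega> - c) + t *\<^sub>R perp \<omega>) = A * (t - t0)^2 + m"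
      using quad_line[OF ab] by blast
    then have q: "quad a b d (p *\<^sub>R \<omega> + t *\<^sub>R perp \<omega> - c) = A * (t - t0)^2 + m" for t
      by (simp add: algebra_simps)
    \<comment> \<open>The position of \<open>x\<close> on the line. The minimum \<open>m\<close> of
      the form along the line is at most its value at \<open>x\<close>, hence at most 1 because
      \<open>x\<close> lies in \<open>E\<close>.\<close>
    define s where "s = x $ 2 * \<omega> $ 1 - x $ 1 * \<omega> $ 2"
    have "p = x $ 1 * \<omega> $ 1 + x $ 2 * \<omega> $ 2" using x(1) by (simp add: inner_vec_def sum_2)
    then have "x $ 1 = p * \<omega> $ 1 - s * \<omega> $ 2" "x $ 2 = p * \<omega> $ 2 + s * \<omega> $ 1"
      using n1 unfolding s_def by algebra+
    then have "x = p *\<^sub>R \<omega> + s *\<^sub>R perp \<omega>" by (simp add: vec_eq_iff forall_2 perp_simps)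
    moreover have "quad a b d (x - c) \<le> 1" using x(2) E(2) closure_subset[of D0] E_eq by blast
    ultimately have "A * (s - t0)^2 + m \<le> 1" using q[of s] by simp
    moreover have "A * (s - t0)^2 \<ge> 0" using A(1) by simp
    ultimately have "m < \<alpha>" using \<alpha>1 by linarith
    then have "(LINT t|lebesgue. profile (A * (t - t0)^2 + m)) = 0" by (rule LINT_profile_parabola[OF A(1,2)])
    then show ?thesis unfolding radon_def u_def q by simp
  qed
  ultimately have "smooth_interior_solution D0 D u"
    using smooth by (auto simp: smooth_interior_solution_def Cc_infinity_def)
  moreover have "centrally_symmetric c u"
    by (simp add: centrally_symmetric_def u_def quad_def)
  moreover have "open {x. quad a b d (x - c) < \<alpha>}"
    unfolding quad_def by (intro open_Collect_less continuous_intros)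
  moreover have "E \<subseteq> {x. quad a b d (x - c) < \<alpha>}" using \<alpha>1 by (auto simp: E_eq)
  moreover have "E \<subseteq> supp u"
  proof
    fix x assume "x \<in> E"
    then have "Re (u x) < 0" using neg[of x] \<alpha>1 by (auto simp: E_eq)
    then show "x \<in> supp u" using in_supp_if_continuous[of u x] smooth[of 0] by force
  qed
  moreover have "\<forall>x. u x \<in> \<real>" by (simp add: u_def)
  ultimately show ?thesis using neg by blast
qed

theorem theorem1:
  fixes D\<^sub>0 D :: "(real^2) set"
  assumes "open D\<^sub>0" and "convex D\<^sub>0" and "open D" and "convex D"
  shows "((\<exists>u. smooth_interior_solution D\<^sub>0 D u) \<longleftrightarrow> (\<exists>u. L1_interior_solution D\<^sub>0 D u)) \<and>
    ((\<exists>u. L1_interior_solution D\<^sub>0 D u) \<longleftrightarrow> (\<exists>c E. separating_ellipse D\<^sub>0 D c E)) \<and>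
    ((\<exists>u. smooth_interior_solution D\<^sub>0 D u) \<longrightarrow> D\<^sub>0 \<Subset> D) \<and>
    ((\<exists>u. L1_interior_solution D\<^sub>0 D u) \<longrightarrow> D\<^sub>0 \<Subset> D) \<and>
    ((\<exists>c E. separating_ellipse D\<^sub>0 D c E) \<longrightarrow> D\<^sub>0 \<Subset> D) \<and>
    (\<forall>c E. separating_ellipse D\<^sub>0 D c E \<longrightarrow>
       (\<exists>u. smooth_interior_solution D\<^sub>0 D u \<and>
            (\<forall>x. u x \<in> \<real>) \<and> centrally_symmetric c u \<and>
            (\<exists>V. open V \<and> E \<subseteq> V \<and> (\<forall>x\<in>V. Re (u x) < 0)) \<and>
            E \<subseteq> supp u))"
proof -
  have "D\<^sub>0 \<Subset> D" if "separating_ellipse D\<^sub>0 D c E" for c E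
  proof -
    have E: "is_ellipse c E" "closure D\<^sub>0 \<subseteq> E" "E \<Subset> D" using that by (auto simp: separating_ellipse_def)
    have "compact (closure D\<^sub>0)"
      using compact_Int_closed[OF compact_ellipse[OF E(1)] closed_closure[of D\<^sub>0]] E(2) by (simp add: Int_absorb1)
    then show ?thesis using E(2,3) closure_subset[of E] by (auto simp: relatively_compact_in_def)
  qed
  moreover have "\<exists>c E. separating_ellipse D\<^sub>0 D c E" if "L1_interior_solution D\<^sub>0 D u" for u
    by (rule separating_ellipse_if_L1[OF assms that])
  moreover note exists_smooth_solution[OF assms(3)] L1_interior_solution_if_smooth
  ultimately show ?thesis by (intro conjI iffI impI allI) meson+
qed

end
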